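(* Let $R$ be a Noetherian standard differential ring with one derivation. Then $R$ is a J-ring.
   Context: All rings are commutative with identity. A differential ring is a ring with finitely many pairwise commuting derivations. An ideal is differential if it is stable under the derivations; $\operatorname{Spec}^{\Delta}R$ is the set of differential prime ideals of $R$, assumed nonempty. $R\{z_1,\dots,z_n\}$ is the ring of differential polynomials in $n$ differential indeterminates over $R$. $R$ is standard if for every differential prime $\mathfrak p$ of $R$ the residue field $R_{\mathfrak p}/\mathfrak pR_{\mathfrak p}$ has characteristic zero. Gap measure: for $X\subseteq\operatorname{Spec}^{\Delta}R$ there is a unique function $\mu$ with values in $\mathbb Z\cup\{\infty\}$ on pairs $(\mathfrak p,\mathfrak p')$ of elements of $X$ with $\mathfrak p\supseteq\mathfrak p'$ such that: (1) $\mu(\mathfrak p,\mathfrak p')\ge 0$; (2) $\mu(\mathfrak p,\mathfrak p')=0$ iff $\mathfrak p=\mathfrak p'$ or there is no infinite strictly descending chain $\mathfrak p=\mathfrak p_0\supsetneq\mathfrak p_1\supsetneq\cdots\supseteq\mathfrak p'$ in $X$; (3) for an integer $d>0$, $\mu(\mathfrak p,\mathfrak p')\ge d$ iff $\mathfrak p\ne\mathfrak p'$ and there is an infinite strictly descending sequence $\mathfrak p=\mathfrak p_0\supsetneq\mathfrak p_1\supsetneq\cdots\supseteq\mathfrak p'$ in $X$ (all terms containing $\mathfrak p'$) with $\mu(\mathfrak p_{i-1},\mathfrak p_i)\ge d-1$ for all $i\ge 1$. The differential type $\operatorname{type}^{\Delta}R$ is the supremum of all $\mu(\mathfrak p,\mathfrak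 p')$ with $\mathfrak p\supseteq\mathfrak p'$ in $X=\operatorname{Spec}^{\Delta}R$. The differential dimension $\dim^{\Delta}R$ is the supremum of the integers $k\ge 0$ such that there is a chain $\mathfrak p_0\supsetneq\cdots\supsetneq\mathfrak p_k$ in $\operatorname{Spec}^{\Delta}R$ with $\mu(\mathfrak p_{i-1},\mathfrak p_i)=\operatorname{type}^{\Delta}R$ for $i=1,\dots,k$. J-ring: a differential ring $R$ with $m$ derivations and finite differential type $t$ is a J-ring if for every $n>0$ one has $\operatorname{type}^{\Delta}R\{z_1,\dots,z_n\}=\max(t,m)$ and: (i) $\dim^{\Delta}R\{z_1,\dots,z_n\}=n$ if $t<m$; (ii) $\dim^{\Delta}R<\infty$ and $\dim^{\Delta}R\{z_1,\dots,z_n\}=n+\dim^{\Delta}R$ if $t=m$; (iii) $\dim^{\Delta}R<\infty$ and $\dim^{\Delta}R\{z_1,\dots,z_n\}=\dim^{\Delta}R$ if $t>m$. (Here $m=1$.) *)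

theory Defs
  imports
    "HOL-Algebra.QuotRing"
    "HOL-Algebra.Ring_Divisibility"
    "HOL-Algebra.Indexed_Polynomials"
    "HOL-Library.Extended_Nat"
begin

section \<open>Differential rings and differential prime ideals\<close>

record 'a diff_ring = "'a ring" +
  derivs :: "('a \<Rightarrow> 'a) list"

locale differential_ring = cring R
  for R :: "('a, 'b) diff_ring_scheme" (structure) +
  assumes deriv_closed:
      "\<lbrakk>d \<in> set (derivs R); a \<in> carrier R\<rbrakk> \<Longrightarrow> d a \<in> carrier R"
    and deriv_add:
      "\<lbrakk>d \<in> set (derivs R); a \<in> carrier R; b \<in> carrier R\<rbrakk> \<Longrightarrow> d (a \<oplus> b) = d a \<oplus> d b"
    and deriv_mult:
      "\<lbrakk>d \<in> set (derivs R); a \<in> carrier R; b \<in> carrier R\<rbrakk>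
        \<Longrightarrow> d (a \<otimes> b) = d a \<otimes> b \<oplus> a \<otimes> d b"
    and deriv_commute:
      "\<lbrakk>d \<in> set (derivs R); e \<in> set (derivs R); a \<in> carrier R\<rbrakk> \<Longrightarrow> d (e a) = e (d a)"

definition diff_ideal :: "'a set \<Rightarrow> ('a, 'b) diff_ring_scheme \<Rightarrow> bool" where
  "diff_ideal I R \<longleftrightarrow> ideal I R \<and> (\<forall>d\<in>set (derivs R). \<forall>a\<in>I. d a \<in> I)"

definition diff_spec :: "('a, 'b) diff_ring_scheme \<Rightarrow> 'a set set" where
  "diff_spec R = {P. primeideal P R \<and> diff_ideal P R}"


section \<open>Residue fields\<close>

text \<open>The localization of \<open>R\<close> at a multiplicative subset \<open>S\<close>, by the usual equivalence
  relation on fractions; the operations are defined on all representatives at once.\<close>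

definition loc_rel :: "('a, 'b) ring_scheme \<Rightarrow> 'a set \<Rightarrow> (('a \<times> 'a) \<times> ('a \<times> 'a)) set" where
  "loc_rel R S =
    {((a, s), (b, t)). a \<in> carrier R \<and> b \<in> carrier R \<and> s \<in> S \<and> t \<in> S \<and>
       (\<exists>u\<in>S. u \<otimes>\<^bsub>R\<^esub> (a \<otimes>\<^bsub>R\<^esub> t) = u \<otimes>\<^bsub>R\<^esub> (b \<otimes>\<^bsub>R\<^esub> s))}"

definition loc_frac :: "('a, 'b) ring_scheme \<Rightarrow> 'a set \<Rightarrow> 'a \<Rightarrow> 'a \<Rightarrow> ('a \<times> 'a) set" where
  "loc_frac R S a s = loc_rel R S `` {(a, s)}"

definition localization :: "('a, 'b) ring_scheme \<Rightarrow> 'a set \<Rightarrow> ('a \<times> 'a) set ring" where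
  "localization R S =
    \<lparr>carrier = (carrier R \<times> S) // loc_rel R S,
     monoid.mult = (\<lambda>U V. \<Union>(a, s)\<in>U. \<Union>(b, t)\<in>V. loc_frac R S (a \<otimes>\<^bsub>R\<^esub> b) (s \<otimes>\<^bsub>R\<^esub> t)),
     one = loc_frac R S \<one>\<^bsub>R\<^esub> \<one>\<^bsub>R\<^esub>,
     zero = loc_frac R S \<zero>\<^bsub>R\<^esub> \<one>\<^bsub>R\<^esub>,
     add = (\<lambda>U V. \<Union>(a, s)\<in>U. \<Union>(b, t)\<in>V.
        loc_frac R S ((a \<otimes>\<^bsub>R\<^esub> t) \<oplus>\<^bsub>R\<^esub> (b \<otimes>\<^bsub>R\<^esub> s)) (s \<otimes>\<^bsub>R\<^esub> t))\<rparr>"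

definition residue_field :: "('a, 'b) ring_scheme \<Rightarrow> 'a set \<Rightarrow> ('a \<times> 'a) set set ring" where
  "residue_field R P =
    (let S = carrier R - P; L = localization R S
     in L Quot (Idl\<^bsub>L\<^esub> ((\<lambda>a. loc_frac R S a \<one>\<^bsub>R\<^esub>) ` P)))"

definition char_zero :: "('a, 'b) ring_scheme \<Rightarrow> bool" where
  "char_zero F \<longleftrightarrow> (\<forall>k::nat. k > 0 \<longrightarrow> [k] \<cdot>\<^bsub>F\<^esub> \<one>\<^bsub>F\<^esub> \<noteq> \<zero>\<^bsub>F\<^esub>)"

definition standard :: "('a, 'b) diff_ring_scheme \<Rightarrow> bool" where
  "standard R \<longleftrightarrow> (\<forall>P\<in>diff_spec R. char_zero (residue_field R P))"


section \<open>Differential polynomials\<close>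

text \<open>With \<open>m\<close> derivations, a derivative of the differential indeterminate \<open>z\<^sub>i\<close> is a pair
  \<open>(i, \<theta>)\<close>, where the multiset \<open>\<theta>\<close> over \<open>{0..<m}\<close> records how often each derivation has been
  applied; so \<open>(i, {#})\<close> is \<open>z\<^sub>i\<close> itself. The ring of differential polynomials is the
  polynomial ring in all these variables. As in \<^theory>\<open>HOL-Algebra.Indexed_Polynomials\<close>,
  a polynomial maps each monomial (a multiset of variables) to its coefficient.\<close>

type_synonym diff_var = "nat \<times> nat multiset"

definition diff_vars :: "nat \<Rightarrow> nat \<Rightarrow> diff_var set" where
  "diff_vars m n = {1..n} \<times> {\<theta>. set_mset \<theta> \<subseteq> {0..<m}}"

definition diff_var_shift :: "nat \<Rightarrow> diff_var \<Rightarrow> diff_var" where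
  "diff_var_shift j = (\<lambda>(i, \<theta>). (i, add_mset j \<theta>))"

definition indexed_mult ::
    "('a, 'b) ring_scheme \<Rightarrow> ('v multiset \<Rightarrow> 'a) \<Rightarrow> ('v multiset \<Rightarrow> 'a) \<Rightarrow> 'v multiset \<Rightarrow> 'a" where
  "indexed_mult R f g = (\<lambda>M. \<Oplus>\<^bsub>R\<^esub>K\<in>{K. K \<subseteq># M}. f K \<otimes>\<^bsub>R\<^esub> g (M - K))"

text \<open>The extension of the derivation \<open>d\<close> of \<open>R\<close> that sends each variable \<open>v\<close> to \<open>s v\<close>,
  for injective \<open>s\<close>. It sends \<open>c\<cdot>N\<close>, for a monomial \<open>N\<close>, to
  \<open>d c\<cdot>N\<close> plus the sum over the variables \<open>v\<close> in \<open>N\<close> of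
  \<open>(count N v)\<cdot>c\<cdot>(N - v + s v)\<close>. The coefficient of the monomial \<open>M\<close> in the second
  part therefore comes from \<open>N = M - s v + v\<close>, for the \<open>v\<close> with \<open>s v\<close> in \<open>M\<close>.\<close>

definition indexed_deriv ::
    "('a, 'b) ring_scheme \<Rightarrow> ('a \<Rightarrow> 'a) \<Rightarrow> ('v \<Rightarrow> 'v) \<Rightarrow> ('v multiset \<Rightarrow> 'a) \<Rightarrow> 'v multiset \<Rightarrow> 'a" where
  "indexed_deriv R d s f = (\<lambda>M. d (f M) \<oplus>\<^bsub>R\<^esub>
     (\<Oplus>\<^bsub>R\<^esub>v\<in>{v. s v \<in># M}.
        let N = add_mset v (M - {#s v#}) in [count N v] \<cdot>\<^bsub>R\<^esub> f N))"

definition diff_poly_ring ::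
    "('a, 'b) diff_ring_scheme \<Rightarrow> nat \<Rightarrow> (diff_var multiset \<Rightarrow> 'a) diff_ring" where
  "diff_poly_ring R n =
    \<lparr>carrier = ring.indexed_pset R (diff_vars (length (derivs R)) n) (carrier R),
     monoid.mult = indexed_mult R,
     one = ring.indexed_const R \<one>\<^bsub>R\<^esub>,
     zero = ring.indexed_const R \<zero>\<^bsub>R\<^esub>,
     add = ring.indexed_padd R,
     derivs = map (\<lambda>j. indexed_deriv R (derivs R ! j) (diff_var_shift j)) [0..<length (derivs R)]\<rparr>"

lemma (in differential_ring) deriv_zero:
  assumes "d \<in> set (derivs R)"
  shows "d \<zero> = \<zero>"
proof -
  have "d \<zero> \<oplus> d \<zero> = d \<zero>"
    using deriv_add[OF assms zero_closed zero_closed] by simp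
  thus ?thesis
    using deriv_closed[OF assms zero_closed] by (simp add: add.l_cancel_one)
qed

lemma (in differential_ring) deriv_one:
  assumes "d \<in> set (derivs R)"
  shows "d \<one> = \<zero>"
proof -
  have "d \<one> \<oplus> d \<one> = d \<one>"
    using deriv_mult[OF assms one_closed one_closed] deriv_closed[OF assms one_closed] by simp
  thus ?thesis
    using deriv_closed[OF assms one_closed] by (simp add: add.l_cancel_one)
qed

lemma (in differential_ring) indexed_deriv_const:
  fixes s :: "'v \<Rightarrow> 'v"
  assumes "d \<in> set (derivs R)" "a \<in> carrier R"
  shows "indexed_deriv R d s (indexed_const a) = indexed_const (d a)"
  using assms deriv_closed[OF assms]
  by (auto simp: indexed_deriv_def indexed_const_def fun_eq_iff deriv_zero)

lemma (in differential_ring) indexed_deriv_var: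
  assumes "d \<in> set (derivs R)" "inj s"
  shows "indexed_deriv R d s (indexed_var v) = indexed_var (s v)"
proof
  fix M :: "'c multiset"
  have var: "indexed_var w = (\<lambda>N. if N = {#w#} then \<one> else \<zero>)" for w :: 'c
    by (auto simp: indexed_var_def indexed_pmult_def indexed_const_def fun_eq_iff
        dest!: multi_member_split)
  have d: "d (indexed_var v M) = \<zero>"
    using assms by (simp add: var deriv_zero deriv_one)
  have fin: "finite {w. s w \<in># M}"
    using finite_vimageI[OF finite_set_mset assms(2), of M] by (simp add: vimage_def)
  let ?t = "\<lambda>w. let N = add_mset w (M - {#s w#}) in [count N w] \<cdot> indexed_var v N"
  have t: "?t w = (if w = v \<and> M = {#s v#} then \<one> else \<zero>)" if "s w \<in># M" for w
    using that by (auto simp: var Let_def dest!: multi_member_split)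
  have "(\<Oplus>w\<in>{w. s w \<in># M}. ?t w)
      = (\<Oplus>w\<in>{w. s w \<in># M}. if v = w then (if M = {#s v#} then \<one> else \<zero>) else \<zero>)"
    by (intro finsum_cong') (auto simp: t)
  also have "\<dots> = (if M = {#s v#} then \<one> else \<zero>)"
  proof (cases "s v \<in># M")
    case True
    thus ?thesis
      using add.finprod_singleton[OF _ fin, of v "\<lambda>_. if M = {#s v#} then \<one> else \<zero>"]
      by (simp add: Pi_def)
  next
    case False
    hence "M \<noteq> {#s v#}" by auto
    moreover have "(\<Oplus>w\<in>{w. s w \<in># M}. if v = w then (if M = {#s v#} then \<one> else \<zero>) else \<zero>)
        = (\<Oplus>w\<in>{w. s w \<in># M}. \<zero>)"
      using False by (intro finsum_cong') auto
    ultimately show ?thesis by simp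
  qed
  finally show "indexed_deriv R d s (indexed_var v) M = indexed_var (s v) M"
    by (simp add: indexed_deriv_def d var[of "s v"])
qed

lemma inj_diff_var_shift: "inj (diff_var_shift j)"
  by (auto simp: inj_def diff_var_shift_def)


section \<open>The gap measure\<close>

definition descending_chain :: "'a set set \<Rightarrow> 'a set \<Rightarrow> 'a set \<Rightarrow> (nat \<Rightarrow> 'a set) \<Rightarrow> bool" where
  "descending_chain A p p' c \<longleftrightarrow>
     c 0 = p \<and> (\<forall>i. c i \<in> A \<and> p' \<subseteq> c i \<and> c (Suc i) \<subset> c i)"

text \<open>Nonnegativity of the measure is built into the type \<^typ>\<open>enat\<close>.\<close>

definition is_gap_measure :: "'a set set \<Rightarrow> ('a set \<Rightarrow> 'a set \<Rightarrow> enat) \<Rightarrow> bool" where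
  "is_gap_measure A \<mu> \<longleftrightarrow>
    (\<forall>p\<in>A. \<forall>p'\<in>A. p' \<subseteq> p \<longrightarrow>
       (\<mu> p p' = 0 \<longleftrightarrow> p = p' \<or> \<not> (\<exists>c. descending_chain A p p' c)) \<and>
       (\<forall>d::nat. d > 0 \<longrightarrow>
          (\<mu> p p' \<ge> enat d \<longleftrightarrow>
             p \<noteq> p' \<and> (\<exists>c. descending_chain A p p' c \<and>
                              (\<forall>i\<ge>1. \<mu> (c (i - 1)) (c i) \<ge> enat (d - 1))))))"

text \<open>The conditions determine the measure only on pairs \<open>p' \<subseteq> p\<close> in \<open>A\<close>; elsewhere the value
  is fixed to be \<open>0\<close>, so that the function is unique.\<close>

definition gap_measure :: "'a set set \<Rightarrow> 'a set \<Rightarrow> 'a set \<Rightarrow> enat" where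
  "gap_measure A =
    (THE \<mu>. is_gap_measure A \<mu> \<and> (\<forall>p p'. \<not> (p \<in> A \<and> p' \<in> A \<and> p' \<subseteq> p) \<longrightarrow> \<mu> p p' = 0))"

primrec gap_ge :: "'a set set \<Rightarrow> nat \<Rightarrow> 'a set \<Rightarrow> 'a set \<Rightarrow> bool" where
  "gap_ge A 0 p p' \<longleftrightarrow> True"
| "gap_ge A (Suc d) p p' \<longleftrightarrow>
     p \<noteq> p' \<and> (\<exists>c. descending_chain A p p' c \<and> (\<forall>i. gap_ge A d (c i) (c (Suc i))))"

lemma gap_ge_SucD: "gap_ge A (Suc d) p p' \<Longrightarrow> gap_ge A d p p'"
proof (induction d arbitrary: p p')
  case (Suc d)
  then obtain c where "p \<noteq> p'" "descending_chain A p p' c"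
    "\<And>i. gap_ge A (Suc d) (c i) (c (Suc i))" by auto
  with Suc.IH show ?case by (auto intro!: exI[of _ c])
qed simp

lemma gap_ge_antimono: "d \<le> e \<Longrightarrow> gap_ge A e p p' \<Longrightarrow> gap_ge A d p p'"
  by (induction e rule: dec_induct) (use gap_ge_SucD in blast)+

lemma all_ge_1_iff: "(\<forall>i\<ge>1. Q (i - 1) i) \<longleftrightarrow> (\<forall>i. Q i (Suc i))" for Q :: "nat \<Rightarrow> nat \<Rightarrow> bool"
proof
  assume "\<forall>i. Q i (Suc i)"
  thus "\<forall>i\<ge>1. Q (i - 1) i" by (auto simp: Suc_le_eq dest!: gr0_implies_Suc)
next
  assume "\<forall>i\<ge>1. Q (i - 1) i"
  thus "\<forall>i. Q i (Suc i)" by (metis diff_Suc_1 le_add1 plus_1_eq_Suc)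
qed

lemma descending_chain_domain:
  assumes "descending_chain A p p' c"
  shows "c i \<in> A \<and> c (Suc i) \<in> A \<and> c (Suc i) \<subseteq> c i"
  using assms unfolding descending_chain_def by blast

lemma is_gap_measure_iff_gap_ge:
  assumes "is_gap_measure A \<mu>" "p \<in> A" "p' \<in> A" "p' \<subseteq> p"
  shows "enat d \<le> \<mu> p p' \<longleftrightarrow> gap_ge A d p p'"
  using assms(2-)
proof (induction d arbitrary: p p')
  case 0
  show ?case by (simp flip: zero_enat_def)
next
  case (Suc d)
  have "enat (Suc d) \<le> \<mu> p p' \<longleftrightarrow> p \<noteq> p' \<and> (\<exists>c. descending_chain A p p' c \<and>
          (\<forall>i\<ge>1. \<mu> (c (i - 1)) (c i) \<ge> enat (Suc d - 1)))"
    using assms(1) Suc.prems unfolding is_gap_measure_def by blast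
  also have "\<dots> \<longleftrightarrow> p \<noteq> p' \<and> (\<exists>c. descending_chain A p p' c \<and>
          (\<forall>i. enat d \<le> \<mu> (c i) (c (Suc i))))"
    using all_ge_1_iff[of "\<lambda>i j. enat d \<le> \<mu> (_ i) (_ j)"] by simp
  also have "\<dots> \<longleftrightarrow> gap_ge A (Suc d) p p'"
    unfolding gap_ge.simps using Suc.IH descending_chain_domain by metis
  finally show ?case .
qed

lemma enat_le_Sup_iff:
  assumes "\<And>d e. d \<le> e \<Longrightarrow> P e \<Longrightarrow> P d" "P 0"
  shows "enat d \<le> Sup {enat e | e. P e} \<longleftrightarrow> P d"
proof
  assume *: "enat d \<le> Sup {enat e | e. P e}"
  show "P d"
  proof (cases d)
    case (Suc d')
    have "enat d' < Sup {enat e | e. P e}"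
      using * Suc by (metis Suc_ile_eq)
    then obtain e where "P e" "d' < e"
      by (auto simp: less_Sup_iff)
    thus ?thesis using assms(1)[of d e] Suc by simp
  qed (use assms(2) in simp)
next
  assume "P d"
  thus "enat d \<le> Sup {enat e | e. P e}" by (auto intro: Sup_upper)
qed

lemma enat_eqI: "(\<And>d::nat. enat d \<le> a \<longleftrightarrow> enat d \<le> b) \<Longrightarrow> a = b"
  by (metis dual_order.antisym enat_ord_code(3) not_enat_eq order_refl Suc_ile_eq
      enat_ord_simps(1) not_less_eq_eq nle_le)

lemma ex1_gap_measure:
  "\<exists>!\<mu>. is_gap_measure A \<mu> \<and> (\<forall>p p'. \<not> (p \<in> A \<and> p' \<in> A \<and> p' \<subseteq> p) \<longrightarrow> \<mu> p p' = 0)"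
proof (rule ex_ex1I)
  define \<mu> where "\<mu> p p' = (if p \<in> A \<and> p' \<in> A \<and> p' \<subseteq> p
    then Sup {enat e | e. gap_ge A e p p'} else 0)" for p p'
  have ge: "enat d \<le> \<mu> p p' \<longleftrightarrow> gap_ge A d p p'" if "p \<in> A" "p' \<in> A" "p' \<subseteq> p" for d p p'
    using enat_le_Sup_iff[of "\<lambda>e. gap_ge A e p p'" d] gap_ge_antimono that
    by (simp add: \<mu>_def) blast
  have "is_gap_measure A \<mu>"
    unfolding is_gap_measure_def
  proof (intro ballI impI conjI allI)
    fix p p' assume p: "p \<in> A" "p' \<in> A" "p' \<subseteq> p"
    show "\<mu> p p' = 0 \<longleftrightarrow> p = p' \<or> \<not> (\<exists>c. descending_chain A p p' c)"
      using ge[OF p, of 1] by (simp add: Suc_ile_eq flip: zero_enat_def) blast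
  next
    fix p p' and d :: nat assume p: "p \<in> A" "p' \<in> A" "p' \<subseteq> p" and "d > 0"
    then obtain e where d: "d = Suc e" by (meson gr0_implies_Suc)
    have "enat d \<le> \<mu> p p' \<longleftrightarrow> p \<noteq> p' \<and>
        (\<exists>c. descending_chain A p p' c \<and> (\<forall>i. gap_ge A e (c i) (c (Suc i))))"
      using ge[OF p] d by simp
    also have "\<dots> \<longleftrightarrow> p \<noteq> p' \<and>
        (\<exists>c. descending_chain A p p' c \<and> (\<forall>i. enat e \<le> \<mu> (c i) (c (Suc i))))"
      using ge descending_chain_domain by metis
    also have "\<dots> \<longleftrightarrow> p \<noteq> p' \<and>
        (\<exists>c. descending_chain A p p' c \<and> (\<forall>i\<ge>1. enat (d - 1) \<le> \<mu> (c (i - 1)) (c i)))"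
      using all_ge_1_iff[of "\<lambda>i j. enat e \<le> \<mu> (_ i) (_ j)"] d by simp
    finally show "enat d \<le> \<mu> p p' \<longleftrightarrow> p \<noteq> p' \<and>
        (\<exists>c. descending_chain A p p' c \<and> (\<forall>i\<ge>1. enat (d - 1) \<le> \<mu> (c (i - 1)) (c i)))" .
  qed
  moreover have "\<forall>p p'. \<not> (p \<in> A \<and> p' \<in> A \<and> p' \<subseteq> p) \<longrightarrow> \<mu> p p' = 0"
    by (auto simp: \<mu>_def)
  ultimately show
    "\<exists>\<mu>. is_gap_measure A \<mu> \<and> (\<forall>p p'. \<not> (p \<in> A \<and> p' \<in> A \<and> p' \<subseteq> p) \<longrightarrow> \<mu> p p' = 0)"
    by blast
next
  fix \<mu> \<nu>
  assume \<mu>: "is_gap_measure A \<mu> \<and> (\<forall>p p'. \<not> (p \<in> A \<and> p' \<in> A \<and> p' \<subseteq> p) \<longrightarrow> \<mu> p p' = 0)"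
    and \<nu>: "is_gap_measure A \<nu> \<and> (\<forall>p p'. \<not> (p \<in> A \<and> p' \<in> A \<and> p' \<subseteq> p) \<longrightarrow> \<nu> p p' = 0)"
  have "\<mu> p p' = \<nu> p p'" for p p'
  proof (cases "p \<in> A \<and> p' \<in> A \<and> p' \<subseteq> p")
    case True
    thus ?thesis using \<mu> \<nu> by (intro enat_eqI) (metis is_gap_measure_iff_gap_ge)
  qed (use \<mu> \<nu> in simp)
  thus "\<mu> = \<nu>" by blast
qed

lemma is_gap_measure_gap_measure: "is_gap_measure A (gap_measure A)"
  using theI'[OF ex1_gap_measure[of A]] unfolding gap_measure_def by blast

lemma enat_le_gap_measure_iff:
  assumes "p \<in> A" "p' \<in> A" "p' \<subseteq> p"
  shows "enat d \<le> gap_measure A p p' \<longleftrightarrow> gap_ge A d p p'"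
  using is_gap_measure_iff_gap_ge[OF is_gap_measure_gap_measure assms] .


section \<open>Differential type, differential dimension and J-rings\<close>

definition diff_type :: "('a, 'b) diff_ring_scheme \<Rightarrow> enat" where
  "diff_type R = Sup {gap_measure (diff_spec R) p p' | p p'.
     p \<in> diff_spec R \<and> p' \<in> diff_spec R \<and> p' \<subseteq> p}"

definition diff_dim :: "('a, 'b) diff_ring_scheme \<Rightarrow> enat" where
  "diff_dim R = Sup {enat k | k. \<exists>p :: nat \<Rightarrow> 'a set.
     (\<forall>i\<le>k. p i \<in> diff_spec R) \<and>
     (\<forall>i\<in>{1..k}. p i \<subset> p (i - 1) \<and>
        gap_measure (diff_spec R) (p (i - 1)) (p i) = diff_type R)}"

definition J_ring :: "('a, 'b) diff_ring_scheme \<Rightarrow> bool" where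
  "J_ring R \<longleftrightarrow>
     differential_ring R \<and> diff_type R < \<infinity> \<and>
     (let m = enat (length (derivs R)); t = diff_type R
      in \<forall>n>0.
           diff_type (diff_poly_ring R n) = max t m \<and>
           (t < m \<longrightarrow> diff_dim (diff_poly_ring R n) = enat n) \<and>
           (t = m \<longrightarrow> diff_dim R < \<infinity> \<and>
                      diff_dim (diff_poly_ring R n) = enat n + diff_dim R) \<and>
           (t > m \<longrightarrow> diff_dim R < \<infinity> \<and>
                      diff_dim (diff_poly_ring R n) = diff_dim R))"

end

theory Submission
  imports Defs
begin

text \<open>
  For a prime \<open>P\<close> of \<open>R{z\<^sub>1,\<dots>,z\<^sub>n}\<close>, list the derivatives of the indeterminates as
  \<open>x 0, x 1, \<dots>\<close>, lower orders first, and call \<open>j\<close> a jump of \<open>P\<close> if \<open>x j\<close> is algebraic modulo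
  \<open>P\<close> over the smaller variables. By Krull's height theorem in the Noetherian rings
  \<open>R[x 0, \<dots>, x (m-1)]\<close>, the height of the contraction of \<open>P\<close> lies between the number of
  jumps below \<open>m\<close> and that number plus a constant independent of \<open>m\<close>. If \<open>P\<close> is differential,
  then differentiating a polynomial that witnesses a jump at \<open>j\<close> gives one at \<open>j + n\<close>,
  whose leading coefficient is the separant; here characteristic zero enters. Hence the number of
  jumps below \<open>m\<close> is \<open>a(P) m/n + O(1)\<close>, where \<open>a(P) \<le> n\<close> counts the residue classes modulo
  \<open>n\<close> that contain a jump. An infinite descending chain from \<open>P\<close> down to \<open>P'\<close> makes the heights
  differ by arbitrarily much, so \<open>a(P') < a(P)\<close>. This bounds type and dimension from above. The
  primes generated by a differential prime of \<open>R\<close>, the derivatives of \<open>z\<^sub>1, \<dots>, z\<^sub>k\<close>, and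
  the derivatives of \<open>z\<^sub>k\<^sub>+\<^sub>1\<close> of order at least \<open>j\<close> give the lower bounds.
\<close>

section \<open>Height of primes in Noetherian rings\<close>

text \<open>The differential polynomial ring is not Noetherian, so lengths of chains are compared
  only after contraction to finitely many variables, where a strict inclusion shows only once a
  witness for it is present. For k steps of a descending chain this gives a threshold on m that
  depends on k, while the additive constant must not; it is the number of generators of the
  contraction of \<open>P\<close> to the constants, and every jump costs at most one generator more.
  Since \<open>R\<close> may have zero divisors, Krull's theorem is stated relative to a prime at
  the bottom of the chain. A chain from \<open>P\<close> to \<open>P'\<close> is prolonged below
  \<open>P'\<close> by one step per jump of \<open>P'\<close>, and Krull bounds the total length, so
  heights never occur as numbers. Ideals saturated at a prime take the place of localizations. The
  type of \<open>R\<close> itself is 0, because a Noetherian ring has no infinite descending chain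
  of primes, so only the case t < m of the definition of a J-ring arises. A gap of 2 would demand
  infinitely many successive drops of the natural number a(P).\<close>

lemma (in cring) cring_idealI:
  assumes "I \<subseteq> carrier R" "\<zero> \<in> I"
    and "\<And>a b. a \<in> I \<Longrightarrow> b \<in> I \<Longrightarrow> a \<oplus> b \<in> I"
    and mult: "\<And>a r. a \<in> I \<Longrightarrow> r \<in> carrier R \<Longrightarrow> r \<otimes> a \<in> I"
  shows "ideal I R"
proof (rule idealI[OF ring_axioms])
  show "subgroup I (add_monoid R)"
  proof
    fix x assume x: "x \<in> I"
    have "\<ominus> \<one> \<otimes> x \<in> I" using mult[OF x] by simp
    moreover have "\<ominus> \<one> \<otimes> x = \<ominus> x" using x assms(1) by (simp add: l_minus subset_iff)
    ultimately show "inv\<^bsub>add_monoid R\<^esub> x \<in> I" by (simp add: a_inv_def)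
  qed (use assms in auto)
  fix a x assume "a \<in> I" "x \<in> carrier R"
  then show "x \<otimes> a \<in> I" "a \<otimes> x \<in> I"
    using mult assms(1) m_comm[of x a] by (metis subsetD)+
qed

lemma (in ideal) diff_closed: "\<lbrakk>a \<in> I; b \<in> I\<rbrakk> \<Longrightarrow> a \<ominus> b \<in> I"
  by (simp add: minus_eq)

lemma (in ideal) add_cancel:
  assumes "a \<in> carrier R" "b \<in> I" "a \<oplus> b \<in> I"
  shows "a \<in> I"
proof -
  have "(a \<oplus> b) \<ominus> b \<in> I" using diff_closed assms by blast
  moreover have "(a \<oplus> b) \<ominus> b = a" using assms Icarr by (simp add: minus_eq a_assoc r_neg)
  ultimately show ?thesis by simp
qed

lemma (in primeideal) mult_notin:
  "\<lbrakk>a \<in> carrier R - I; b \<in> carrier R - I\<rbrakk> \<Longrightarrow> a \<otimes> b \<in> carrier R - I"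
  using I_prime by blast

lemma (in primeideal) one_notin: "\<one> \<notin> I"
  using one_imp_carrier I_notcarr by blast

lemma (in primeideal) pow_memD:
  "\<lbrakk>a \<in> carrier R; a [^] (n::nat) \<in> I\<rbrakk> \<Longrightarrow> a \<in> I"
proof (induction n)
  case (Suc n)
  then show ?case using I_prime[of "a [^] n" a] by auto
qed (use one_notin in simp)

text \<open>For an ideal \<open>I\<close> this is the preimage in \<open>R\<close> of the ideal that
  \<open>I\<close> generates in the localization at the prime \<open>P\<close>. It lets local
  arguments be carried out inside \<open>R\<close>.\<close>

definition (in cring) sat :: "'a set \<Rightarrow> 'a set \<Rightarrow> 'a set" where
  "sat P I = {a \<in> carrier R. \<exists>s\<in>carrier R - P. s \<otimes> a \<in> I}"

definition (in cring) adjoin :: "'a set \<Rightarrow> 'a \<Rightarrow> 'a set" where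
  "adjoin I a = {i \<oplus> r \<otimes> a | i r. i \<in> I \<and> r \<in> carrier R}"

context cring
begin

lemma sat_mono: "I \<subseteq> J \<Longrightarrow> sat P I \<subseteq> sat P J"
  unfolding sat_def by blast

lemma subset_sat:
  assumes "primeideal P R" "I \<subseteq> carrier R"
  shows "I \<subseteq> sat P I"
proof
  interpret P: primeideal P R by fact
  fix a assume "a \<in> I"
  then show "a \<in> sat P I"
    using assms(2) P.one_notin unfolding sat_def by (intro CollectI conjI bexI[of _ \<one>]) auto
qed

lemma sat_sat:
  assumes "primeideal P R"
  shows "sat P (sat P I) = sat P I"
proof
  interpret P: primeideal P R by fact
  show "sat P (sat P I) \<subseteq> sat P I"
  proof
    fix a assume "a \<in> sat P (sat P I)"
    then obtain s t where "a \<in> carrier R" "s \<in> carrier R - P" "t \<in> carrier R - P" "t \<otimes> (s \<otimes> a) \<in> I"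
      unfolding sat_def by blast
    then show "a \<in> sat P I"
      using P.mult_notin[of t s] unfolding sat_def by (auto simp: m_assoc intro!: bexI[of _ "t \<otimes> s"])
  qed
  show "sat P I \<subseteq> sat P (sat P I)"
    by (rule subset_sat[OF assms]) (auto simp: sat_def)
qed

lemma sat_ideal:
  assumes "primeideal P R" "ideal I R"
  shows "ideal (sat P I) R"
proof (rule cring_idealI)
  interpret P: primeideal P R by fact
  interpret I: ideal I R by fact
  show "sat P I \<subseteq> carrier R" by (auto simp: sat_def)
  show "\<zero> \<in> sat P I"
    using subset_sat[OF assms(1), of I] I.zero_closed I.a_subset by blast
  fix a assume "a \<in> sat P I"
  then obtain s where a: "a \<in> carrier R" "s \<in> carrier R - P" "s \<otimes> a \<in> I" by (auto simp: sat_def)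
  show "r \<otimes> a \<in> sat P I" if "r \<in> carrier R" for r
  proof -
    have "r \<otimes> (s \<otimes> a) \<in> I" using a that by (simp add: I.I_l_closed)
    also have "r \<otimes> (s \<otimes> a) = s \<otimes> (r \<otimes> a)" using a that by (simp add: m_lcomm)
    finally show ?thesis using a that by (auto simp: sat_def)
  qed
  fix b assume "b \<in> sat P I"
  then obtain t where b: "b \<in> carrier R" "t \<in> carrier R - P" "t \<otimes> b \<in> I" by (auto simp: sat_def)
  have "t \<otimes> (s \<otimes> a) \<oplus> s \<otimes> (t \<otimes> b) \<in> I" using a b by (simp add: I.I_l_closed)
  also have "t \<otimes> (s \<otimes> a) \<oplus> s \<otimes> (t \<otimes> b) = (s \<otimes> t) \<otimes> (a \<oplus> b)"
    using a b by (simp add: r_distr m_assoc m_lcomm)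
  finally show "a \<oplus> b \<in> sat P I"
    using a b P.mult_notin[of s t] by (auto simp: sat_def)
qed

lemma sat_memD:
  assumes "sat P I = I" "s \<in> carrier R - P" "a \<in> carrier R" "s \<otimes> a \<in> I"
  shows "a \<in> I"
  using assms unfolding sat_def by blast

lemma adjoin_memI: "\<lbrakk>i \<in> I; r \<in> carrier R\<rbrakk> \<Longrightarrow> i \<oplus> r \<otimes> a \<in> adjoin I a"
  unfolding adjoin_def by blast

lemma adjoin_ideal:
  assumes "ideal I R" "a \<in> carrier R"
  shows "ideal (adjoin I a) R"
proof -
  have "adjoin I a = I <+> PIdl a"
    unfolding adjoin_def cgenideal_def set_add_def' by blast
  then show ?thesis using add_ideals[OF assms(1) cgenideal_ideal[OF assms(2)]] by simp
qed

lemma subset_adjoin: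
  assumes "I \<subseteq> carrier R" "a \<in> carrier R"
  shows "I \<subseteq> adjoin I a"
proof
  fix i assume "i \<in> I"
  then show "i \<in> adjoin I a" using adjoin_memI[of i I \<zero> a] assms by auto
qed

lemma adjoin_self:
  assumes "\<zero> \<in> I" "a \<in> carrier R"
  shows "a \<in> adjoin I a"
  using adjoin_memI[of \<zero> I \<one> a] assms by simp

lemma adjoin_mono: "I \<subseteq> J \<Longrightarrow> adjoin I a \<subseteq> adjoin J a"
  unfolding adjoin_def by blast

lemma adjoin_subset:
  assumes "ideal J R" "I \<subseteq> J" "a \<in> J"
  shows "adjoin I a \<subseteq> J"
proof -
  interpret J: ideal J R by fact
  show ?thesis using assms J.I_l_closed unfolding adjoin_def by blast
qed

end

section \<open>Chain conditions and associated primes\<close>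

locale noetherian_cring = noetherian_ring R + cring R for R (structure)

lemma (in noetherian_cring) ex_maximal_ideal:
  assumes "S \<noteq> {}" "\<And>I. I \<in> S \<Longrightarrow> ideal I R"
  obtains M where "M \<in> S" "\<And>J. \<lbrakk>J \<in> S; M \<subseteq> J\<rbrakk> \<Longrightarrow> J = M"
proof -
  have "\<exists>M\<in>S. \<forall>J\<in>S. M \<subseteq> J \<longrightarrow> J = M"
  proof (rule subset_Zorn)
    fix C assume C: "subset.chain S C"
    show "\<exists>U\<in>S. \<forall>I\<in>C. I \<subseteq> U"
    proof (cases "C = {}")
      case False
      have "subset.chain {I. ideal I R} C"
        using C assms(2) unfolding pred_on.chain_def by blast
      from ideal_chain_is_trivial[OF False this] show ?thesis
        using C unfolding pred_on.chain_def by (intro bexI[of _ "\<Union>C"]) blast+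
    qed (use assms(1) in blast)
  qed
  then show ?thesis using that by blast
qed

lemma (in noetherian_cring) ideal_noetherian_induct [consumes 1]:
  assumes "ideal I R"
    and "\<And>I. \<lbrakk>ideal I R; \<And>J. \<lbrakk>ideal J R; I \<subset> J\<rbrakk> \<Longrightarrow> Q J\<rbrakk> \<Longrightarrow> Q I"
  shows "Q I"
proof (rule ccontr)
  assume "\<not> Q I"
  then have "{J. ideal J R \<and> \<not> Q J} \<noteq> {}" using assms(1) by blast
  then obtain M where M: "M \<in> {J. ideal J R \<and> \<not> Q J}"
    "\<And>J. \<lbrakk>J \<in> {J. ideal J R \<and> \<not> Q J}; M \<subseteq> J\<rbrakk> \<Longrightarrow> J = M"
    by (rule ex_maximal_ideal) auto
  then have "Q M" using assms(2)[of M] by blast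
  then show False using M by blast
qed

text \<open>The colon ideal of \<open>a\<close> is the annihilator of the class of \<open>a\<close>
  in R/I. Among the annihilators of nonzero classes there is a maximal one, and it is prime: an
  associated prime of R/I.\<close>

lemma (in noetherian_cring) ex_prime_colon:
  assumes "ideal I R" "I \<noteq> carrier R"
  obtains a where "a \<in> carrier R" "a \<notin> I" "primeideal {r \<in> carrier R. r \<otimes> a \<in> I} R"
proof -
  interpret I: ideal I R by fact
  define col where "col a = {r \<in> carrier R. r \<otimes> a \<in> I}" for a
  have col: "ideal (col a) R" if "a \<in> carrier R" for a
    using that by (intro cring_idealI) (auto simp: col_def l_distr m_assoc I.I_l_closed)
  have "col ` (carrier R - I) \<noteq> {}" using assms(2) I.a_subset by blast
  then obtain M where M: "M \<in> col ` (carrier R - I)"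
    "\<And>J. \<lbrakk>J \<in> col ` (carrier R - I); M \<subseteq> J\<rbrakk> \<Longrightarrow> J = M"
    by (rule ex_maximal_ideal) (use col in auto)
  then obtain a where a: "a \<in> carrier R" "a \<notin> I" "M = col a" by blast
  have "primeideal (col a) R"
  proof (rule primeidealI[OF col[OF a(1)] is_cring])
    have "\<one> \<notin> col a" using a by (simp add: col_def)
    then show "carrier R \<noteq> col a" by blast
    fix r s assume rs: "r \<in> carrier R" "s \<in> carrier R" "r \<otimes> s \<in> col a"
    show "r \<in> col a \<or> s \<in> col a"
    proof (rule disjCI)
      assume "s \<notin> col a"
      \<comment> \<open>The class of \<open>s \<otimes> a\<close> is still nonzero, so its
        annihilator, which contains the maximal one, must equal it.\<close>
      then have "s \<otimes> a \<in> carrier R - I" using rs a by (simp add: col_def)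
      moreover have "col a \<subseteq> col (s \<otimes> a)"
        using rs a I.I_l_closed m_lcomm[of _ s a] by (auto simp: col_def)
      ultimately have "col (s \<otimes> a) = col a" using M(2) a(3) by blast
      moreover have "r \<in> col (s \<otimes> a)" using rs a by (simp add: col_def m_assoc)
      ultimately show "r \<in> col a" by simp
    qed
  qed
  then show ?thesis using that a by (simp add: col_def)
qed

section \<open>Minimal primes and Krull's principal ideal theorem\<close>

definition minimal_prime_over :: "('a, 'b) ring_scheme \<Rightarrow> 'a set \<Rightarrow> 'a set \<Rightarrow> bool" where
  "minimal_prime_over R I P \<longleftrightarrow>
     primeideal P R \<and> I \<subseteq> P \<and> (\<forall>Q. primeideal Q R \<and> I \<subseteq> Q \<and> Q \<subseteq> P \<longrightarrow> Q = P)"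

text \<open>Localizing at \<open>P\<close> and dividing by \<open>I\<close> gives an Artinian ring; its ideals are
  the saturated ideals containing \<open>I\<close>.\<close>

lemma (in noetherian_cring) saturated_chain_stabilizes:
  assumes P: "minimal_prime_over R I P"
    and "\<And>n. ideal (C n) R" "\<And>n. sat P (C n) = C n" "\<And>n. C (Suc n) \<subseteq> C n" "\<And>n. I \<subseteq> C n"
  obtains n where "\<And>m. m \<ge> n \<Longrightarrow> C m = C n"
proof -
  interpret P: primeideal P R using P by (simp add: minimal_prime_over_def)
  \<comment> \<open>The claim for chains above a varying saturated ideal \<open>K\<close>, proved by
    Noetherian induction on \<open>K\<close>. The case wanted in the end is the saturation of the
    ideal generated by \<open>I\<close>.\<close>
  let ?good = "\<lambda>K. I \<subseteq> K \<longrightarrow> sat P K = K \<longrightarrow> (\<forall>C. (\<forall>n. ideal (C n) R) \<and> (\<forall>n. sat P (C n) = C n)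
    \<and> (\<forall>n. C (Suc n) \<subseteq> C n) \<and> (\<forall>n. K \<subseteq> C n) \<longrightarrow> (\<exists>n. \<forall>m\<ge>n. C m = C n))"
  have good: "?good K" if "ideal K R" for K
    using that
  proof (induction K rule: ideal_noetherian_induct)
    fix K assume K: "ideal K R" and IH: "\<And>J. ideal J R \<Longrightarrow> K \<subset> J \<Longrightarrow> ?good J"
    interpret K: ideal K R by fact
    show "?good K"
    proof (intro impI allI)
      fix C assume IK: "I \<subseteq> K" and satK: "sat P K = K" and "(\<forall>n. ideal (C n) R) \<and> (\<forall>n. sat P (C n) = C n)
         \<and> (\<forall>n. C (Suc n) \<subseteq> C n) \<and> (\<forall>n. K \<subseteq> C n)"
      then have C: "\<And>n. ideal (C n) R" "\<And>n. sat P (C n) = C n" "\<And>n. C (Suc n) \<subseteq> C n" "\<And>n. K \<subseteq> C n"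
        by auto
      have anti: "C m \<subseteq> C n" if "n \<le> m" for m n
        using that C(3) by (metis lift_Suc_antimono_le)
      have carr: "C n \<subseteq> carrier R" for n
        using C(1) by (metis additive_subgroup.a_subset ideal.axioms(1))
      show "\<exists>n. \<forall>m\<ge>n. C m = C n"
      proof (cases "K = carrier R")
        case True
        then have "C n = carrier R" for n using C(4) carr by blast
        then show ?thesis by simp
      next
        case False
        then obtain a where a: "a \<in> carrier R" "a \<notin> K" and pr: "primeideal {r \<in> carrier R. r \<otimes> a \<in> K} R"
          by (rule ex_prime_colon[OF K])
        let ?Q = "{r \<in> carrier R. r \<otimes> a \<in> K}"
        \<comment> \<open>Saturation of \<open>K\<close> forces the associated prime
          \<open>?Q\<close> into \<open>P\<close>, and minimality of \<open>P\<close> over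
          \<open>I\<close> makes the two equal. Locally at \<open>P\<close> the quotient (K + Ra)/K
          is then the residue field, so a chain has room for only one drop there.\<close>
        have "I \<subseteq> ?Q" using IK a(1) K.I_r_closed K.a_subset by blast
        moreover have "?Q \<subseteq> P" using satK a unfolding sat_def by blast
        ultimately have Q: "?Q = P" using P pr unfolding minimal_prime_over_def by blast
        define D where "D n = sat P (adjoin (C n) a)" for n
        let ?K' = "sat P (adjoin K a)"
        have K'_ideal: "ideal ?K' R" by (intro sat_ideal P.primeideal adjoin_ideal K a)
        have "adjoin K a \<subseteq> ?K'"
          by (metis K'_ideal K a(1) adjoin_ideal P.primeideal subset_sat additive_subgroup.a_subset ideal.axioms(1))
        then have K': "K \<subseteq> ?K'" "a \<in> ?K'"
          using subset_adjoin[OF K.a_subset a(1)] adjoin_self[OF K.zero_closed a(1)] by auto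
        then have KK': "K \<subset> ?K'" using a by blast
        have "\<exists>n. \<forall>m\<ge>n. D m = D n"
        proof (rule IH[OF K'_ideal KK', rule_format])
          show "I \<subseteq> ?K'" using IK K' by blast
          show "sat P ?K' = ?K'" by (rule sat_sat[OF P.primeideal])
          have "ideal (D n) R" "sat P (D n) = D n" for n
            unfolding D_def by (intro sat_ideal adjoin_ideal C(1) P.primeideal a sat_sat)+
          moreover have "D (Suc n) \<subseteq> D n" "?K' \<subseteq> D n" for n
            unfolding D_def by (intro sat_mono adjoin_mono C)+
          ultimately show "(\<forall>n. ideal (D n) R) \<and> (\<forall>n. sat P (D n) = D n) \<and>
            (\<forall>n. D (Suc n) \<subseteq> D n) \<and> (\<forall>n. ?K' \<subseteq> D n)" by blast
        qed
        then obtain n1 where n1: "\<And>m. m \<ge> n1 \<Longrightarrow> D m = D n1" by blast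
        \<comment> \<open>As the chain descends, \<open>a\<close> either belongs to all of its
          members or to none from some index on.\<close>
        obtain n2 where n2: "(\<forall>n. a \<in> C n) \<or> (\<forall>m\<ge>n2. a \<notin> C m)"
          using anti by blast
        define n where "n = max n1 n2"
        have "C n \<subseteq> C m" if "m \<ge> n" for m
        proof
          fix c assume c: "c \<in> C n"
          interpret Cm: ideal "C m" R by (rule C)
          interpret Cn: ideal "C n" R by (rule C)
          have "D n = D m" using n1[of n] n1[of m] that by (simp add: n_def)
          moreover have "c \<in> D n"
            unfolding D_def using subset_sat[OF P.primeideal] subset_adjoin[OF Cn.a_subset a(1)] c
              adjoin_ideal[OF C(1) a(1)] by (meson additive_subgroup.a_subset ideal.axioms(1) subsetD)
          ultimately have "c \<in> sat P (adjoin (C m) a)" by (simp add: D_def)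
          then obtain s c' r where s: "s \<in> carrier R - P" "c' \<in> C m" "r \<in> carrier R" "s \<otimes> c = c' \<oplus> r \<otimes> a"
            by (auto simp: sat_def adjoin_def)
          \<comment> \<open>If \<open>a\<close> has left the chain, then
            \<open>r \<otimes> a\<close> in the saturated ideal \<open>C n\<close> with
            \<open>a\<close> outside it puts \<open>r\<close> into \<open>P\<close>, the annihilator
            of \<open>a\<close> modulo \<open>K\<close>.\<close>
          have "r \<otimes> a \<in> C m"
          proof (cases "a \<in> C m")
            case True
            then show ?thesis using s Cm.I_l_closed by blast
          next
            case False
            then have an: "a \<notin> C n" using n2 by (auto simp: n_def)
            have "r \<otimes> a \<oplus> c' = s \<otimes> c" using s a Cm.Icarr by (simp add: a_comm)
            moreover have "s \<otimes> c \<in> C n" using s c Cn.I_l_closed by blast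
            moreover have "c' \<in> C n" using anti[OF that] s by blast
            ultimately have ra: "r \<otimes> a \<in> C n" using s a by (metis Cn.add_cancel m_closed)
            have "r \<in> P"
              using sat_memD[OF C(2) _ a(1) ra] s an by blast
            then show ?thesis using Q C(4) by blast
          qed
          then have "s \<otimes> c \<in> C m" using s by simp
          then show "c \<in> C m" using sat_memD[OF C(2) s(1)] c carr by blast
        qed
        then have "\<forall>m\<ge>n. C m = C n" using anti by blast
        then show ?thesis ..
      qed
    qed
  qed
  have I: "I \<subseteq> carrier R" using P P.a_subset by (auto simp: minimal_prime_over_def)
  let ?K = "sat P (Idl I)"
  have K: "ideal ?K R" "I \<subseteq> ?K"
    using sat_ideal[OF P.primeideal genideal_ideal[OF I]] genideal_self[OF I]
      subset_sat[OF P.primeideal, of "Idl I"] genideal_ideal[OF I]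
    by (auto simp: additive_subgroup.a_subset ideal.axioms(1))
  have "?K \<subseteq> C n" for n
    using sat_mono[OF genideal_minimal[OF assms(2,5)], of P n] assms(3) by simp
  then have "\<exists>n. \<forall>m\<ge>n. C m = C n"
    using good[OF K(1)] K(2) sat_sat[OF P.primeideal] assms(2-4) by blast
  then show ?thesis using that by blast
qed

text \<open>Nakayama's lemma in the localization at \<open>P\<close>: hypothesis \<open>fg\<close> says that \<open>F\<close>
  generates \<open>M\<close> modulo \<open>T\<close>.\<close>

lemma (in cring) nakayama:
  assumes "primeideal P R" "x \<in> P" "finite F" "ideal M R" "F \<subseteq> M" "ideal T R"
    and fg: "\<And>J. \<lbrakk>ideal J R; T \<subseteq> J; F \<subseteq> J\<rbrakk> \<Longrightarrow> M \<subseteq> sat P J"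
    and "\<And>m. m \<in> M \<Longrightarrow> \<exists>s\<in>carrier R - P. \<exists>t\<in>T. \<exists>m'\<in>M. s \<otimes> m = t \<oplus> x \<otimes> m'"
  shows "M \<subseteq> sat P T"
  using assms(3,5-)
proof (induction F arbitrary: T)
  case empty
  then show ?case by blast
next
  case (insert a F)
  interpret P: primeideal P R by fact
  interpret M: ideal M R by fact
  interpret T: ideal T R by fact
  have a: "a \<in> carrier R" "a \<in> M" using insert M.a_subset by auto
  have x: "x \<in> carrier R" using assms P.a_subset by blast
  interpret Ta: ideal "adjoin T a" R by (rule adjoin_ideal) fact+
  have sub: "T \<subseteq> adjoin T a" "a \<in> adjoin T a"
    using subset_adjoin[OF T.a_subset a(1)] adjoin_self[OF T.zero_closed a(1)] .
  \<comment> \<open>Enlarging \<open>T\<close> by \<open>a\<close> leaves the generators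
    \<open>F\<close> to the induction hypothesis; afterwards \<open>a\<close> alone has to be
    absorbed into \<open>T\<close>.\<close>
  have M: "M \<subseteq> sat P (adjoin T a)"
  proof (rule insert.IH)
    fix J assume "ideal J R" "adjoin T a \<subseteq> J" "F \<subseteq> J"
    then show "M \<subseteq> sat P J" using sub by (intro insert.prems(3)) auto
  next
    fix m assume "m \<in> M"
    then show "\<exists>s\<in>carrier R - P. \<exists>t\<in>adjoin T a. \<exists>m'\<in>M. s \<otimes> m = t \<oplus> x \<otimes> m'"
      using insert.prems(4) sub(1) by blast
  qed (use insert Ta.is_ideal in auto)
  obtain s t m where s: "s \<in> carrier R - P" "t \<in> T" "m \<in> M" "s \<otimes> a = t \<oplus> x \<otimes> m"
    using insert.prems(4)[OF a(2)] by blast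
  obtain u t' r where u: "u \<in> carrier R - P" "t' \<in> T" "r \<in> carrier R" "u \<otimes> m = t' \<oplus> r \<otimes> a"
    using M s(3) unfolding sat_def adjoin_def by blast
  have c: "a \<in> carrier R" "s \<in> carrier R" "u \<in> carrier R" "r \<in> carrier R" "t \<in> carrier R"
    "t' \<in> carrier R" "m \<in> carrier R" using a s u T.Icarr M.Icarr by auto
  \<comment> \<open>Eliminating \<open>m\<close> from the two relations gives a multiple of
    \<open>a\<close> in \<open>T\<close>. The factor lies outside \<open>P\<close>, because
    \<open>u \<otimes> s\<close> does and \<open>x \<otimes> r\<close> lies in
    \<open>P\<close>.\<close>
  have "(u \<otimes> s \<ominus> x \<otimes> r) \<otimes> a = u \<otimes> (s \<otimes> a) \<ominus> x \<otimes> (r \<otimes> a)"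
    using c x by algebra
  also have "\<dots> = u \<otimes> t \<oplus> x \<otimes> (u \<otimes> m) \<ominus> x \<otimes> (r \<otimes> a)"
    using c x s(4) by (simp add: r_distr m_lcomm)
  also have "\<dots> = u \<otimes> t \<oplus> x \<otimes> (t' \<oplus> r \<otimes> a) \<ominus> x \<otimes> (r \<otimes> a)" by (simp add: u(4))
  also have "\<dots> = u \<otimes> t \<oplus> x \<otimes> t'"
    using c x by algebra
  also have "\<dots> \<in> T" using s u x c by (intro T.a_closed T.I_l_closed) auto
  finally have "(u \<otimes> s \<ominus> x \<otimes> r) \<otimes> a \<in> T" .
  moreover have "u \<otimes> s \<ominus> x \<otimes> r \<in> carrier R - P"
  proof -
    have "x \<otimes> r \<in> P" using assms(2) u P.I_r_closed by blast
    moreover have "u \<otimes> s \<ominus> x \<otimes> r \<oplus> x \<otimes> r = u \<otimes> s" using c x by algebra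
    ultimately show ?thesis
      using P.mult_notin[OF u(1) s(1)] c x
      by (metis Diff_iff P.a_closed m_closed minus_closed)
  qed
  ultimately have asat: "a \<in> sat P T" using a(1) unfolding sat_def by blast
  interpret S: ideal "sat P T" R by (intro sat_ideal) fact+
  have "T \<subseteq> sat P T" by (rule subset_sat) (fact | rule T.a_subset)+
  then have "adjoin T a \<subseteq> sat P T" by (intro adjoin_subset S.is_ideal asat)
  then have "sat P (adjoin T a) \<subseteq> sat P T"
    using sat_mono sat_sat[OF P.primeideal] by metis
  then show ?case using M by blast
qed

text \<open>Krull's principal ideal theorem, relative to a prime \<open>Q\<close>.
  For \<open>y\<close> in \<open>Q'\<close> but not in \<open>Q\<close>, the ideals \<open>N n\<close> replace the symbolic powers of \<open>Q'\<close>
  of the usual proof.\<close>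

lemma (in noetherian_cring) principal_ideal_theorem:
  assumes P: "minimal_prime_over R (adjoin Q x) P" and x: "x \<in> carrier R"
    and "primeideal Q R" "primeideal Q' R" and sub: "Q \<subseteq> Q'" "Q' \<subset> P"
  shows "Q' = Q"
proof (rule ccontr)
  assume "Q' \<noteq> Q"
  interpret P: primeideal P R using P by (simp add: minimal_prime_over_def)
  interpret Q: primeideal Q R by fact
  interpret Q': primeideal Q' R by fact
  from sub \<open>Q' \<noteq> Q\<close> obtain y where y: "y \<in> Q'" "y \<notin> Q" by blast
  have yc: "y \<in> carrier R" using y Q'.Icarr by blast
  have xP: "x \<in> P"
    using P adjoin_self[OF Q.zero_closed x] unfolding minimal_prime_over_def by blast
  have xQ': "x \<notin> Q'"
  proof
    assume "x \<in> Q'"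
    then have "adjoin Q x \<subseteq> Q'" by (intro adjoin_subset Q'.is_ideal sub)
    then show False using P sub Q'.primeideal unfolding minimal_prime_over_def by blast
  qed
  define N where "N n = sat Q' (adjoin Q (y [^] (n::nat)))" for n
  define C where "C n = sat P (adjoin (N n) x)" for n
  have N: "ideal (N n) R" "Q \<subseteq> N n" "y [^] n \<in> N n" for n
  proof -
    have i: "ideal (adjoin Q (y [^] n)) R" by (intro adjoin_ideal Q.is_ideal) (simp add: yc)
    then show "ideal (N n) R" unfolding N_def by (rule sat_ideal[OF Q'.primeideal])
    have "adjoin Q (y [^] n) \<subseteq> N n" unfolding N_def
      by (intro subset_sat Q'.primeideal) (meson i additive_subgroup.a_subset ideal.axioms(1))
    then show "Q \<subseteq> N n" "y [^] n \<in> N n"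
      using subset_adjoin[OF Q.a_subset] adjoin_self[OF Q.zero_closed] yc by (blast intro: nat_pow_closed)+
  qed
  have Nsat: "sat Q' (N n) = N n" for n unfolding N_def by (rule sat_sat[OF Q'.primeideal])
  have Ndec: "N (Suc n) \<subseteq> N n" for n
  proof -
    interpret J: ideal "adjoin Q (y [^] n)" R by (intro adjoin_ideal Q.is_ideal) (simp add: yc)
    have "y [^] Suc n \<in> adjoin Q (y [^] n)"
      using adjoin_self[OF Q.zero_closed, of "y [^] n"] yc J.I_r_closed by simp
    moreover have "Q \<subseteq> adjoin Q (y [^] n)" using subset_adjoin[OF Q.a_subset] yc by simp
    ultimately show ?thesis
      unfolding N_def by (intro sat_mono adjoin_subset J.is_ideal)
  qed
  have C_ideal: "ideal (C n) R" for n
    unfolding C_def by (intro sat_ideal adjoin_ideal N P.primeideal x)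
  have NC: "adjoin (N n) x \<subseteq> C n" for n unfolding C_def
    by (intro subset_sat P.primeideal) (meson N x adjoin_ideal additive_subgroup.a_subset ideal.axioms(1))
  obtain n where n: "\<And>m. m \<ge> n \<Longrightarrow> C m = C n"
  proof (rule saturated_chain_stabilizes[OF P])
    show "ideal (C n) R" for n by (rule C_ideal)
    show "sat P (C n) = C n" for n unfolding C_def by (rule sat_sat[OF P.primeideal])
    show "C (Suc n) \<subseteq> C n" for n unfolding C_def by (intro sat_mono adjoin_mono Ndec)
    show "adjoin Q x \<subseteq> C n" for n using NC adjoin_mono[OF N(2)] by blast
  qed blast
  interpret Nn: ideal "N n" R by (rule N)
  interpret Ns: ideal "N (Suc n)" R by (rule N)
  obtain F where F: "F \<subseteq> carrier R" "finite F" "N n = Idl F"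
    using finetely_gen[OF N(1)] by blast
  \<comment> \<open>Stability of \<open>C\<close> says that, up to a factor outside
    \<open>P\<close>, each element of \<open>N n\<close> has the form b + r x with b in
    \<open>N (Suc n)\<close>. Then r x lies in \<open>N n\<close>, which is saturated at
    \<open>Q'\<close>, and \<open>x\<close> is outside \<open>Q'\<close>; so r lies in
    \<open>N n\<close>, as Nakayama's lemma requires.\<close>
  have "N n \<subseteq> sat P (N (Suc n))"
  proof (rule nakayama[OF P.primeideal xP F(2) N(1) _ N(1)])
    show "F \<subseteq> N n" using genideal_self[OF F(1)] F(3) by simp
    show "N n \<subseteq> sat P J" if "ideal J R" "N (Suc n) \<subseteq> J" "F \<subseteq> J" for J
      using genideal_minimal[OF that(1,3)] F(3) subset_sat[OF P.primeideal, of J] that(1)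
      by (metis additive_subgroup.a_subset ideal.axioms(1) subset_trans)
    fix m assume m: "m \<in> N n"
    then have mc: "m \<in> carrier R" by (rule Nn.Icarr)
    have "m \<in> C n" using m NC subset_adjoin[OF Nn.a_subset x] by blast
    then have "m \<in> C (Suc n)" using n[of "Suc n"] by simp
    then obtain s b r where s: "s \<in> carrier R - P" "b \<in> N (Suc n)" "r \<in> carrier R"
      "s \<otimes> m = b \<oplus> r \<otimes> x" by (auto simp: C_def sat_def adjoin_def)
    have "x \<otimes> r \<oplus> b = s \<otimes> m" using s x Ns.Icarr[OF s(2)] by (simp add: a_comm m_comm)
    moreover have "s \<otimes> m \<in> N n" using s m Nn.I_l_closed by blast
    moreover have "b \<in> N n" using s Ndec by blast
    ultimately have "x \<otimes> r \<in> N n" using Nn.add_cancel[of "x \<otimes> r" b] x s(3) by simp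
    then have "r \<in> N n" using sat_memD[OF Nsat] x xQ' s(3) by blast
    moreover have "s \<otimes> m = b \<oplus> x \<otimes> r" using s x by (simp add: m_comm)
    ultimately show "\<exists>s\<in>carrier R - P. \<exists>t\<in>N (Suc n). \<exists>m'\<in>N n. s \<otimes> m = t \<oplus> x \<otimes> m'"
      using s by blast
  qed
  \<comment> \<open>A multiplier outside \<open>P\<close> is also outside \<open>Q'\<close>, and
    \<open>N (Suc n)\<close> is saturated at \<open>Q'\<close>.\<close>
  also have "\<dots> \<subseteq> N (Suc n)"
    using sub Nsat[of "Suc n"] unfolding sat_def by blast
  finally have "y [^] n \<in> N (Suc n)" using N(3) by blast
  then obtain t q r where t: "t \<in> carrier R - Q'" "q \<in> Q" "r \<in> carrier R"
    "t \<otimes> y [^] n = q \<oplus> r \<otimes> y [^] Suc n" unfolding N_def sat_def adjoin_def by blast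
  have tc: "t \<in> carrier R" using t by blast
  \<comment> \<open>Modulo \<open>Q\<close> the relation reads (t - r y) y^n = 0. The first factor
    is outside \<open>Q'\<close>, hence outside \<open>Q\<close>, so y^n and then \<open>y\<close>
    would lie in \<open>Q\<close>.\<close>
  have tr: "t \<ominus> r \<otimes> y \<notin> Q'"
  proof
    assume "t \<ominus> r \<otimes> y \<in> Q'"
    moreover have "r \<otimes> y \<in> Q'" using t y Q'.I_l_closed by blast
    ultimately have "t \<ominus> r \<otimes> y \<oplus> r \<otimes> y \<in> Q'" by (rule Q'.a_closed)
    moreover have "t \<ominus> r \<otimes> y \<oplus> r \<otimes> y = t" using tc t(3) yc by algebra
    ultimately show False using t by simp
  qed
  have qc: "q \<in> carrier R" using t Q.Icarr by blast
  have ync: "y [^] n \<in> carrier R" using yc by simp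
  have "(t \<ominus> r \<otimes> y) \<otimes> y [^] n = t \<otimes> y [^] n \<ominus> r \<otimes> (y [^] n \<otimes> y)"
    using tc t(3) yc ync by algebra
  also have "\<dots> = q \<oplus> r \<otimes> (y [^] n \<otimes> y) \<ominus> r \<otimes> (y [^] n \<otimes> y)" using t(4) by simp
  also have "\<dots> = q" using t(3) qc yc ync by algebra
  finally have "(t \<ominus> r \<otimes> y) \<otimes> y [^] n \<in> Q" using t by simp
  then have "y [^] n \<in> Q" using Q.I_prime tr sub t(1,3) yc by (metis DiffD1 m_closed minus_closed nat_pow_closed subsetD)
  then show False using Q.pow_memD yc y by blast
qed

text \<open>Every element of \<open>P\<close> becomes nilpotent modulo \<open>I\<close> after
  localizing at \<open>P\<close>: the saturations of I + (x^n) stabilize, and a relation t x^n = q +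
  r x^(n+1) with t outside \<open>P\<close> yields the multiplier t - r x, again outside
  \<open>P\<close>.\<close>

lemma (in noetherian_cring) pow_mem_minimal_prime:
  assumes P: "minimal_prime_over R I P" and I: "ideal I R" and x: "x \<in> P"
  obtains s n where "s \<in> carrier R - P" "s \<otimes> x [^] (n::nat) \<in> I"
proof -
  interpret P: primeideal P R using P by (simp add: minimal_prime_over_def)
  interpret I: ideal I R by fact
  have xc[simp]: "x \<in> carrier R" using x P.Icarr by blast
  define C where "C n = sat P (adjoin I (x [^] (n::nat)))" for n
  have J: "ideal (adjoin I (x [^] n)) R" "I \<subseteq> adjoin I (x [^] n)" "x [^] n \<in> adjoin I (x [^] n)" for n :: nat
    using adjoin_ideal[OF I, of "x [^] n"] subset_adjoin[OF I.a_subset, of "x [^] n"]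
      adjoin_self[OF I.zero_closed, of "x [^] n"] by auto
  have JC: "adjoin I (x [^] n) \<subseteq> C n" for n unfolding C_def
    by (intro subset_sat P.primeideal) (meson J additive_subgroup.a_subset ideal.axioms(1))
  obtain n where n: "\<And>m. m \<ge> n \<Longrightarrow> C m = C n"
  proof (rule saturated_chain_stabilizes[OF P])
    show "ideal (C n) R" for n unfolding C_def by (intro sat_ideal J P.primeideal)
    show "sat P (C n) = C n" for n unfolding C_def by (rule sat_sat[OF P.primeideal])
    have "x [^] Suc n \<in> adjoin I (x [^] n)" for n
      using ideal.I_r_closed[OF J(1) J(3)] by simp
    then show "C (Suc n) \<subseteq> C n" for n unfolding C_def by (intro sat_mono adjoin_subset J)
    show "I \<subseteq> C n" for n using J(2) JC by blast
  qed blast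
  have "x [^] n \<in> C (Suc n)" using JC J(3) n[of "Suc n"] by auto
  then obtain t q r where t: "t \<in> carrier R - P" "q \<in> I" "r \<in> carrier R"
    "t \<otimes> x [^] n = q \<oplus> r \<otimes> x [^] Suc n" unfolding C_def sat_def adjoin_def by blast
  have tc: "t \<in> carrier R" using t by blast
  have tr: "t \<ominus> r \<otimes> x \<notin> P"
  proof
    assume "t \<ominus> r \<otimes> x \<in> P"
    moreover have "r \<otimes> x \<in> P" using t x P.I_l_closed by blast
    ultimately have "t \<ominus> r \<otimes> x \<oplus> r \<otimes> x \<in> P" by (rule P.a_closed)
    moreover have "t \<ominus> r \<otimes> x \<oplus> r \<otimes> x = t" using tc t(3) xc by algebra
    ultimately show False using t by simp
  qed
  have qc: "q \<in> carrier R" using t I.Icarr by blast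
  have xnc: "x [^] n \<in> carrier R" by simp
  have "(t \<ominus> r \<otimes> x) \<otimes> x [^] n = t \<otimes> x [^] n \<ominus> r \<otimes> (x [^] n \<otimes> x)"
    using tc t(3) xc xnc by algebra
  also have "\<dots> = q \<oplus> r \<otimes> (x [^] n \<otimes> x) \<ominus> r \<otimes> (x [^] n \<otimes> x)" using t(4) by simp
  also have "\<dots> = q" using t(3) qc xc xnc by algebra
  finally have "(t \<ominus> r \<otimes> x) \<otimes> x [^] n \<in> I" using t by simp
  then show ?thesis using that tr t(1,3) xc by (metis DiffD1 DiffI m_closed minus_closed)
qed

section \<open>Prime chains and Krull's height theorem\<close>

inductive prime_chain :: "('a, 'b) ring_scheme \<Rightarrow> nat \<Rightarrow> 'a set \<Rightarrow> 'a set \<Rightarrow> bool" for R where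
  prime_chain_refl: "primeideal P R \<Longrightarrow> prime_chain R 0 P P"
| prime_chain_step: "\<lbrakk>primeideal P R; P' \<subset> P; prime_chain R h P' Q\<rbrakk> \<Longrightarrow> prime_chain R (Suc h) P Q"

lemma prime_chain_prime: "prime_chain R h P Q \<Longrightarrow> primeideal P R \<and> primeideal Q R \<and> Q \<subseteq> P"
  by (induction rule: prime_chain.induct) auto

lemma prime_chain_trans:
  "\<lbrakk>prime_chain R h P Q; prime_chain R k Q Q'\<rbrakk> \<Longrightarrow> prime_chain R (h + k) P Q'"
  by (induction rule: prime_chain.induct) (auto intro: prime_chain.intros)

lemma prime_chain_replace_top:
  assumes "prime_chain R h P Q" "primeideal P' R" "P \<subseteq> P'"
  shows "\<exists>h'\<ge>h. prime_chain R h' P' Q"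
proof (cases "P = P'")
  case False
  then have "prime_chain R (Suc h) P' Q" using assms by (intro prime_chain_step) auto
  then show ?thesis by (intro exI[of _ "Suc h"]) simp
qed (use assms in blast)

text \<open>Induction on the number of elements of \<open>F\<close>: below \<open>P\<close> take a
  prime \<open>M\<close> as large as possible above the next term of the chain, spend one element
  \<open>x\<close> of \<open>F\<close> outside \<open>M\<close>, and replace the others by elements
  of \<open>M\<close> congruent modulo \<open>x\<close> to multiples of their powers. The principal
  ideal theorem shows that \<open>M\<close> is minimal over \<open>Q\<close> and the
  replacements.\<close>

theorem (in noetherian_cring) height_theorem:
  assumes "finite F" "F \<subseteq> carrier R" "minimal_prime_over R (Q \<union> F) P" "prime_chain R h P Q"
  shows "h \<le> card F"
  using assms
proof (induction "card F" arbitrary: F P h rule: less_induct)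
  case less
  interpret Q: primeideal Q R using prime_chain_prime less.prems by blast
  interpret P: primeideal P R using prime_chain_prime less.prems by blast
  show ?case
  proof (cases h)
    case (Suc h')
    obtain P1 where P1: "P1 \<subset> P" "prime_chain R h' P1 Q"
      using less.prems(4) Suc by (cases rule: prime_chain.cases) auto
    note pr1 = prime_chain_prime[OF P1(2)]
    let ?S = "{P2. primeideal P2 R \<and> P1 \<subseteq> P2 \<and> P2 \<subset> P}"
    have "?S \<noteq> {}" using pr1 P1 by blast
    then obtain M where "M \<in> ?S" and M': "\<And>J. \<lbrakk>J \<in> ?S; M \<subseteq> J\<rbrakk> \<Longrightarrow> J = M"
      by (rule ex_maximal_ideal) (auto intro: primeideal.axioms)
    then have M: "primeideal M R" "P1 \<subseteq> M" "M \<subset> P" by auto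
    interpret M: primeideal M R by fact
    have QM: "Q \<subseteq> M" using M pr1 by blast
    obtain h1 where h1: "h1 \<ge> h'" "prime_chain R h1 M Q"
      using prime_chain_replace_top[OF P1(2) M(1,2)] by blast
    have "\<not> F \<subseteq> M" using less.prems(3) M QM unfolding minimal_prime_over_def by blast
    then obtain x where x: "x \<in> F" "x \<notin> M" by blast
    have xc: "x \<in> carrier R" using x less.prems(2) by blast
    have FP: "F \<subseteq> P" using less.prems(3) unfolding minimal_prime_over_def by blast
    have minP: "minimal_prime_over R (adjoin M x) P"
      unfolding minimal_prime_over_def
    proof (intro conjI allI impI)
      show "primeideal P R" by (rule P.primeideal)
      show "adjoin M x \<subseteq> P" using M x FP by (intro adjoin_subset P.is_ideal) auto
      fix P' assume P': "primeideal P' R \<and> adjoin M x \<subseteq> P' \<and> P' \<subseteq> P"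
      then have "M \<subseteq> P'" "x \<in> P'"
        using subset_adjoin[OF M.a_subset xc] adjoin_self[OF M.zero_closed xc] by auto
      then show "P' = P" using M'[of P'] P' M x by blast
    qed
    \<comment> \<open>\<open>P\<close> is minimal over M + (x), so up to a factor outside
      \<open>P\<close> some power of \<open>z\<close> falls into M + (x). The component in
      \<open>M\<close> is the replacement for \<open>z\<close>.\<close>
    have "\<exists>y. y \<in> M \<and> (\<exists>s\<in>carrier R - P. \<exists>r\<in>carrier R. \<exists>m::nat. s \<otimes> z [^] m = y \<oplus> r \<otimes> x)"
      if "z \<in> F" for z
    proof -
      have "z \<in> P" using FP that by blast
      then obtain s m where "s \<in> carrier R - P" "s \<otimes> z [^] (m::nat) \<in> adjoin M x"
        by (rule pow_mem_minimal_prime[OF minP adjoin_ideal[OF M.is_ideal xc]])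
      then show ?thesis unfolding adjoin_def by blast
    qed
    then have "\<forall>z\<in>F. \<exists>y. y \<in> M \<and>
        (\<exists>s\<in>carrier R - P. \<exists>r\<in>carrier R. \<exists>m::nat. s \<otimes> z [^] m = y \<oplus> r \<otimes> x)" by blast
    from bchoice[OF this] obtain y where sr: "\<And>z. z \<in> F \<Longrightarrow> y z \<in> M \<and>
        (\<exists>s\<in>carrier R - P. \<exists>r\<in>carrier R. \<exists>m::nat. s \<otimes> z [^] m = y z \<oplus> r \<otimes> x)" by blast
    let ?F = "y ` (F - {x})"
    have cF: "card ?F < card F" using less.prems(1) x
      by (metis card_Diff1_less card_image_le finite_Diff le_less_trans)
    have minM: "minimal_prime_over R (Q \<union> ?F) M"
      unfolding minimal_prime_over_def
    proof (intro conjI allI impI)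
      show "primeideal M R" by fact
      show "Q \<union> ?F \<subseteq> M" using QM sr by blast
      fix Q2 assume Q2: "primeideal Q2 R \<and> Q \<union> ?F \<subseteq> Q2 \<and> Q2 \<subseteq> M"
      interpret Q2: primeideal Q2 R using Q2 by blast
      \<comment> \<open>A prime inside \<open>P\<close> that contains \<open>Q2\<close> and
        \<open>x\<close> contains the replacements and hence all of \<open>F\<close>. So
        \<open>P\<close> is minimal over Q2 + (x), and no room is left for \<open>M\<close> strictly
        between \<open>Q2\<close> and \<open>P\<close>.\<close>
      have "minimal_prime_over R (adjoin Q2 x) P"
        unfolding minimal_prime_over_def
      proof (intro conjI allI impI)
        show "primeideal P R" by (rule P.primeideal)
        show "adjoin Q2 x \<subseteq> P" using M x FP Q2 by (intro adjoin_subset P.is_ideal) auto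
        fix P' assume P': "primeideal P' R \<and> adjoin Q2 x \<subseteq> P' \<and> P' \<subseteq> P"
        interpret P': primeideal P' R using P' by blast
        have sub: "Q2 \<subseteq> P'" "x \<in> P'"
          using P' subset_adjoin[OF Q2.a_subset xc] adjoin_self[OF Q2.zero_closed xc] by auto
        have "z \<in> P'" if "z \<in> F" for z
        proof (cases "z = x")
          case False
          then have "y z \<in> P'" using that Q2 sub by blast
          moreover obtain s r m where s: "s \<in> carrier R - P" "r \<in> carrier R"
            "s \<otimes> z [^] (m::nat) = y z \<oplus> r \<otimes> x" using sr[OF \<open>z \<in> F\<close>] by blast
          moreover have "r \<otimes> x \<in> P'" using sub s(2) P'.I_l_closed by blast
          ultimately have "s \<otimes> z [^] m \<in> P'" by simp
          moreover have "z \<in> carrier R" using that less.prems(2) by blast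
          moreover have "s \<notin> P'" "s \<in> carrier R" using s(1) P' by blast+
          ultimately show ?thesis using P'.I_prime[of s "z [^] m"] P'.pow_memD[of z m] by simp
        qed (use sub in simp)
        then have "Q \<union> F \<subseteq> P'" using sub(1) Q2 by auto
        then show "P' = P" using less.prems(3) P' unfolding minimal_prime_over_def by auto
      qed
      then have "M = Q2"
        using Q2 M by (intro principal_ideal_theorem[OF _ xc Q2.primeideal M(1)]) auto
      then show "Q2 = M" ..
    qed
    have "h1 \<le> card ?F"
    proof (rule less.hyps[OF cF _ _ minM h1(2)])
      show "finite ?F" using less.prems(1) by simp
      show "?F \<subseteq> carrier R" using sr M.a_subset by blast
    qed
    then show ?thesis using cF h1(1) Suc by simp
  qed simp
qed

section \<open>Adjoining one variable\<close>

lemma (in cring) cring_primeidealI: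
  assumes "I \<subseteq> carrier R" "\<zero> \<in> I"
    and "\<And>a b. a \<in> I \<Longrightarrow> b \<in> I \<Longrightarrow> a \<oplus> b \<in> I"
    and "\<And>a r. a \<in> I \<Longrightarrow> r \<in> carrier R \<Longrightarrow> r \<otimes> a \<in> I"
    and "\<one> \<notin> I"
    and "\<And>a b. \<lbrakk>a \<in> carrier R; b \<in> carrier R; a \<otimes> b \<in> I\<rbrakk> \<Longrightarrow> a \<in> I \<or> b \<in> I"
  shows "primeideal I R"
proof (rule primeidealI[OF _ is_cring])
  show "ideal I R" by (rule cring_idealI) (use assms in blast)+
  show "carrier R \<noteq> I" using assms(5) one_closed by blast
qed (rule assms(6))

lemma (in cring) contract_prime:
  assumes "primeideal P R" "subring S R"
  shows "primeideal (P \<inter> S) (R\<lparr>carrier := S\<rparr>)"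
proof -
  interpret P: primeideal P R by fact
  note S = subringE[OF assms(2)]
  interpret A: cring "R\<lparr>carrier := S\<rparr>"
    using subcring_iff[OF S(1)] subcringI'[OF assms(2)] by blast
  show ?thesis
  proof (rule A.cring_primeidealI)
    show "\<one>\<^bsub>R\<lparr>carrier := S\<rparr>\<^esub> \<notin> P \<inter> S" using P.one_notin by simp
    show "a \<in> P \<inter> S \<or> b \<in> P \<inter> S" if "a \<in> carrier (R\<lparr>carrier := S\<rparr>)" "b \<in> carrier (R\<lparr>carrier := S\<rparr>)"
      "a \<otimes>\<^bsub>R\<lparr>carrier := S\<rparr>\<^esub> b \<in> P \<inter> S" for a b
      using that S(1) P.I_prime[of a b] by auto
  qed (use S P.I_l_closed in auto)
qed

text \<open>\<open>R\<close> is the polynomial ring S[x], described by coefficient functions instead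
  of an isomorphism with a ring of univariate polynomials. Thus \<open>S\<close> remains a subset of
  \<open>R\<close>, and a ring in many variables fits for each choice of main variable.\<close>

locale poly_extension = cring R for R (structure) +
  fixes S :: "'a set" and x :: 'a and coef :: "nat \<Rightarrow> 'a \<Rightarrow> 'a"
  assumes subring: "subring S R"
    and x_closed[simp]: "x \<in> carrier R"
    and coef_in: "f \<in> carrier R \<Longrightarrow> coef i f \<in> S"
    and coef_add: "\<lbrakk>f \<in> carrier R; g \<in> carrier R\<rbrakk> \<Longrightarrow> coef i (f \<oplus> g) = coef i f \<oplus> coef i g"
    and coef_smult: "\<lbrakk>a \<in> S; f \<in> carrier R\<rbrakk> \<Longrightarrow> coef i (a \<otimes> f) = a \<otimes> coef i f"
    and coef_x_Suc: "f \<in> carrier R \<Longrightarrow> coef (Suc i) (x \<otimes> f) = coef i f"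
    and coef_x_0: "f \<in> carrier R \<Longrightarrow> coef 0 (x \<otimes> f) = \<zero>"
    and coef_const: "a \<in> S \<Longrightarrow> coef i a = (if i = 0 then a else \<zero>)"
    and coef_finite: "f \<in> carrier R \<Longrightarrow> \<exists>d. \<forall>i\<ge>d. coef i f = \<zero>"
    and coef_eq_0: "\<lbrakk>f \<in> carrier R; \<And>i. coef i f = \<zero>\<rbrakk> \<Longrightarrow> f = \<zero>"
begin

abbreviation "base \<equiv> R\<lparr>carrier := S\<rparr>"

lemmas S_subset = subringE(1)[OF subring]
lemma S_carr[simp]: "a \<in> S \<Longrightarrow> a \<in> carrier R" using S_subset by blast

lemma S_closed[simp]: "\<zero> \<in> S" "\<one> \<in> S" "a \<in> S \<Longrightarrow> \<ominus> a \<in> S"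
  "\<lbrakk>a \<in> S; b \<in> S\<rbrakk> \<Longrightarrow> a \<otimes> b \<in> S" "\<lbrakk>a \<in> S; b \<in> S\<rbrakk> \<Longrightarrow> a \<oplus> b \<in> S"
  using subringE[OF subring] by auto

lemma base_cring: "cring base"
  using subcring_iff[OF S_subset] subcringI'[OF subring] by blast

lemma coef_closed[simp]: "f \<in> carrier R \<Longrightarrow> coef i f \<in> carrier R"
  using coef_in by simp

lemma coef_zero[simp]: "coef i \<zero> = \<zero>"
  using coef_const[of \<zero> i] by simp

lemma coef_minus:
  assumes "f \<in> carrier R" "g \<in> carrier R"
  shows "coef i (f \<ominus> g) = coef i f \<ominus> coef i g"
proof -
  have "coef i ((\<ominus> \<one>) \<otimes> g) = (\<ominus> \<one>) \<otimes> coef i g" using assms by (intro coef_smult) auto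
  then have "coef i (\<ominus> g) = \<ominus> coef i g" using assms by (simp add: l_minus)
  then show ?thesis using assms by (simp add: minus_eq coef_add)
qed

lemma coef_x_pow:
  "f \<in> carrier R \<Longrightarrow> coef i (x [^] (k::nat) \<otimes> f) = (if i < k then \<zero> else coef (i - k) f)"
proof (induction k arbitrary: i f)
  case (Suc k)
  have "x [^] Suc k \<otimes> f = x [^] k \<otimes> (x \<otimes> f)" using Suc.prems by (simp add: m_assoc)
  then have "coef i (x [^] Suc k \<otimes> f) = (if i < k then \<zero> else coef (i - k) (x \<otimes> f))"
    using Suc by simp
  also have "\<dots> = (if i < Suc k then \<zero> else coef (i - Suc k) f)"
    using Suc.prems by (cases "i - k") (auto simp: coef_x_0 coef_x_Suc intro!: arg_cong[of _ _ "\<lambda>j. coef j f"])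
  finally show ?case .
qed simp

lemma coef_monom_mult:
  assumes "a \<in> S" "f \<in> carrier R"
  shows "coef i (a \<otimes> x [^] (k::nat) \<otimes> f) = (if i < k then \<zero> else a \<otimes> coef (i - k) f)"
  using assms by (simp add: m_assoc coef_smult coef_x_pow)

lemma coef_monom: "a \<in> S \<Longrightarrow> coef i (a \<otimes> x [^] (k::nat)) = (if i = k then a else \<zero>)"
  using coef_monom_mult[of a \<one> i k] by (auto simp: coef_const)

lemma monom_closed[simp]: "a \<in> S \<Longrightarrow> a \<otimes> x [^] (k::nat) \<in> carrier R" by simp

text \<open>A degree bound replaces the degree, so that the zero polynomial needs no
  convention.\<close>

definition deg_lt :: "'a \<Rightarrow> nat \<Rightarrow> bool" where
  "deg_lt f d \<longleftrightarrow> (\<forall>i\<ge>d. coef i f = \<zero>)"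

lemma deg_lt_0:
  assumes "f \<in> carrier R"
  shows "deg_lt f 0 \<longleftrightarrow> f = \<zero>"
proof
  assume "deg_lt f 0"
  then have "coef i f = \<zero>" for i by (simp add: deg_lt_def)
  then show "f = \<zero>" by (rule coef_eq_0[OF assms])
qed (simp add: deg_lt_def)

lemma deg_lt_mono: "deg_lt f d \<Longrightarrow> d \<le> e \<Longrightarrow> deg_lt f e"
  by (auto simp: deg_lt_def)

lemma ex_deg_lt: "f \<in> carrier R \<Longrightarrow> \<exists>d. deg_lt f d"
  using coef_finite by (auto simp: deg_lt_def)

lemma deg_lt_minus_lead:
  assumes "f \<in> carrier R" "g \<in> carrier R" "deg_lt f (Suc d)" "deg_lt g (Suc d)" "coef d f = coef d g"
  shows "deg_lt (f \<ominus> g) d"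
  unfolding deg_lt_def
proof (intro allI impI)
  fix i assume "d \<le> i"
  then have "coef i f = coef i g" using assms(3-5) by (cases "i = d") (auto simp: deg_lt_def)
  then show "coef i (f \<ominus> g) = \<zero>" using assms(1,2) by (simp add: coef_minus)
qed

lemma deg_lt_monom: "a \<in> S \<Longrightarrow> deg_lt (a \<otimes> x [^] d) (Suc d)"
  by (auto simp: deg_lt_def coef_monom)

lemma minus_add_cancel: "\<lbrakk>f \<in> carrier R; g \<in> carrier R\<rbrakk> \<Longrightarrow> (f \<ominus> g) \<oplus> g = f"
  by (simp add: minus_eq a_assoc l_neg)

lemma poly_induct [consumes 2, case_names zero lead]:
  assumes "f \<in> carrier R" "deg_lt f d"
    and "\<And>d. Q d \<zero>"
    and "\<And>d f. \<lbrakk>f \<in> carrier R; deg_lt f (Suc d); deg_lt (f \<ominus> coef d f \<otimes> x [^] d) d;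
      Q d (f \<ominus> coef d f \<otimes> x [^] d)\<rbrakk> \<Longrightarrow> Q (Suc d) f"
  shows "Q d f"
  using assms(1,2)
proof (induction d arbitrary: f)
  case 0
  then show ?case using assms(3) deg_lt_0 by simp
next
  case (Suc d)
  have m: "coef d f \<otimes> x [^] d \<in> carrier R" using Suc.prems by simp
  have "deg_lt (f \<ominus> coef d f \<otimes> x [^] d) d"
    using Suc.prems by (intro deg_lt_minus_lead m deg_lt_monom) (auto simp: coef_in coef_monom)
  then show ?case using Suc m by (intro assms(4)) auto
qed

lemma mem_ideal_if_coefs:
  assumes "ideal I R" "f \<in> carrier R" "\<And>i. coef i f \<in> I"
  shows "f \<in> I"
proof -
  interpret I: ideal I R by fact
  obtain d where "deg_lt f d" using ex_deg_lt[OF assms(2)] by blast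
  from assms(2) this show ?thesis using assms(3)
  proof (induction d f rule: poly_induct)
    case (lead d f)
    have m: "coef d f \<otimes> x [^] d \<in> I" using lead by (intro I.I_r_closed) auto
    have "f \<ominus> coef d f \<otimes> x [^] d \<in> I"
    proof (rule lead.IH)
      fix i
      show "coef i (f \<ominus> coef d f \<otimes> x [^] d) \<in> I"
        using lead.hyps(1) lead.prems by (simp add: coef_minus coef_monom coef_in I.diff_closed)
    qed
    then show ?case using minus_add_cancel[OF lead.hyps(1), of "coef d f \<otimes> x [^] d"] m I.a_closed I.Icarr by metis
  qed auto
qed

lemma deg_lt_mult:
  assumes "f \<in> carrier R" "deg_lt f d" "g \<in> carrier R" "deg_lt g (Suc e)"
  shows "deg_lt (f \<otimes> g) (d + e)"
  using assms(1,2)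
proof (induction d f rule: poly_induct)
  case (lead d f)
  let ?m = "coef d f \<otimes> x [^] d"
  have m: "?m \<in> carrier R" using lead by simp
  have "f \<otimes> g = (f \<ominus> ?m) \<otimes> g \<oplus> ?m \<otimes> g"
    using lead(1) m assms(3) by algebra
  then show ?case
    using lead m assms(3,4)
    by (auto simp: deg_lt_def coef_add coef_monom_mult coef_in)
qed (use assms in \<open>simp add: deg_lt_def\<close>)

lemma coef_mult_lead:
  assumes "f \<in> carrier R" "deg_lt f (Suc d)" "g \<in> carrier R" "deg_lt g (Suc e)"
  shows "coef (d + e) (f \<otimes> g) = coef d f \<otimes> coef e g"
proof -
  let ?m = "coef d f \<otimes> x [^] d"
  have m: "?m \<in> carrier R" using assms by simp
  have "deg_lt (f \<ominus> ?m) d"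
    using assms by (intro deg_lt_minus_lead m deg_lt_monom) (auto simp: coef_in coef_monom)
  then have "deg_lt ((f \<ominus> ?m) \<otimes> g) (d + e)" using assms m by (intro deg_lt_mult) auto
  moreover have "f \<otimes> g = (f \<ominus> ?m) \<otimes> g \<oplus> ?m \<otimes> g"
    using assms(1,3) m by algebra
  ultimately show ?thesis
    using assms m by (auto simp: deg_lt_def coef_add coef_monom_mult coef_in)
qed

text \<open>Hilbert's argument in chain form. The coefficients of x^i in the elements of
  \<open>I\<close> of degree at most i form an ideal \<open>L i I\<close> of the base, increasing in
  i and in \<open>I\<close>, and nested ideals with the same ideals \<open>L i\<close>
  coincide.\<close>

lemma hilbert_basis:
  assumes "noetherian_ring base"
  shows "noetherian_ring R"
proof (rule trivial_ideal_chain_imp_noetherian)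
  interpret A: cring base by (rule base_cring)
  interpret A: noetherian_cring base using assms base_cring by (simp add: noetherian_cring_def)
  define L where "L i I = {coef i f | f. f \<in> I \<and> deg_lt f (Suc i)}" for i I
  have L_ideal: "ideal (L i I) base" if "ideal I R" for i I
  proof -
    interpret I: ideal I R by fact
    show ?thesis
    proof (rule A.cring_idealI)
      show "L i I \<subseteq> carrier base" using coef_in I.Icarr by (auto simp: L_def)
      show "\<zero>\<^bsub>base\<^esub> \<in> L i I" unfolding L_def
        by (auto intro!: exI[of _ \<zero>] simp: deg_lt_def)
      fix a assume "a \<in> L i I"
      then obtain f where f: "a = coef i f" "f \<in> I" "deg_lt f (Suc i)" unfolding L_def by blast
      show "r \<otimes>\<^bsub>base\<^esub> a \<in> L i I" if "r \<in> carrier base" for r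
        unfolding L_def using f that I.I_l_closed I.Icarr
        by (auto intro!: exI[of _ "r \<otimes> f"] simp: deg_lt_def coef_smult)
      fix b assume "b \<in> L i I"
      then obtain g where g: "b = coef i g" "g \<in> I" "deg_lt g (Suc i)" unfolding L_def by blast
      show "a \<oplus>\<^bsub>base\<^esub> b \<in> L i I"
        unfolding L_def using f g I.Icarr
        by (auto intro!: exI[of _ "f \<oplus> g"] simp: deg_lt_def coef_add)
    qed
  qed
  have L_mono: "L i I \<subseteq> L j J" if "i \<le> j" "I \<subseteq> J" "ideal J R" for i j I J
  proof
    interpret J: ideal J R by fact
    fix a assume "a \<in> L i I"
    then obtain f where f: "a = coef i f" "f \<in> I" "deg_lt f (Suc i)" unfolding L_def by blast
    have fJ: "f \<in> J" "f \<in> carrier R" using f that J.Icarr by auto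
    show "a \<in> L j J" unfolding L_def
    proof (intro CollectI exI conjI)
      show "x [^] (j - i) \<otimes> f \<in> J" using fJ by (intro J.I_l_closed) auto
      show "a = coef j (x [^] (j - i) \<otimes> f)" using f fJ that(1) by (auto simp: coef_x_pow)
      show "deg_lt (x [^] (j - i) \<otimes> f) (Suc j)"
        unfolding deg_lt_def
      proof (intro allI impI)
        fix k assume "Suc j \<le> k"
        then have "Suc i \<le> k - (j - i)" using that(1) by linarith
        then show "coef k (x [^] (j - i) \<otimes> f) = \<zero>"
          using f(3) fJ by (simp add: deg_lt_def coef_x_pow)
      qed
    qed
  qed
  have L_eq: "J \<subseteq> I" if "ideal I R" "ideal J R" "I \<subseteq> J" "\<And>i. L i J \<subseteq> L i I" for I J
  proof
    interpret I: ideal I R by fact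
    interpret J: ideal J R by fact
    fix f assume f: "f \<in> J"
    obtain d where "deg_lt f d" using ex_deg_lt J.Icarr f by blast
    then show "f \<in> I" using f
    proof (induction d arbitrary: f)
      case 0
      then show ?case using deg_lt_0 J.Icarr by auto
    next
      case (Suc d)
      then have "coef d f \<in> L d I" using that(4) unfolding L_def by blast
      then obtain g where g: "coef d f = coef d g" "g \<in> I" "deg_lt g (Suc d)" unfolding L_def by blast
      have fg: "f \<in> carrier R" "g \<in> carrier R" "g \<in> J"
        using Suc.prems g(2) that(3) I.Icarr J.Icarr by auto
      have "f \<ominus> g \<in> I"
        by (intro Suc.IH deg_lt_minus_lead J.diff_closed fg Suc.prems g)
      then have "(f \<ominus> g) \<oplus> g \<in> I" using g(2) by (rule I.a_closed)
      then show ?case using minus_add_cancel fg by simp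
    qed
  qed
  fix C assume C: "C \<noteq> {}" "subset.chain {I. ideal I R} C"
  have Ci: "ideal I R" if "I \<in> C" for I using C that unfolding pred_on.chain_def by blast
  have Cc: "I \<subseteq> J \<or> J \<subseteq> I" if "I \<in> C" "J \<in> C" for I J
    using C that unfolding pred_on.chain_def by blast
  \<comment> \<open>A maximal \<open>L i0 I0\<close> among all these ideals settles every index from
    \<open>i0\<close> on; the finitely many smaller ones are settled one at a time by ideals
    \<open>K i\<close>. A member of \<open>C\<close> above \<open>I0\<close> and these
    \<open>K i\<close> then contains all the others.\<close>
  let ?L = "case_prod L ` (UNIV \<times> C)"
  have "?L \<noteq> {}" using C(1) by blast
  then obtain M where M: "M \<in> ?L" "\<And>J. \<lbrakk>J \<in> ?L; M \<subseteq> J\<rbrakk> \<Longrightarrow> J = M"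
    by (rule A.ex_maximal_ideal) (use L_ideal Ci in auto)
  then obtain i0 I0 where I0: "I0 \<in> C" "M = L i0 I0" by auto
  have top: "L j J = L i0 I0" if "i0 \<le> j" "J \<in> C" "I0 \<subseteq> J" for j J
  proof -
    have "L j J \<in> ?L" using that(2) by auto
    then show ?thesis using M(2) L_mono[OF that(1,3) Ci[OF that(2)]] I0(2) by simp
  qed
  have "\<exists>I\<in>C. \<forall>J\<in>C. L i I \<subseteq> L i J \<longrightarrow> L i J = L i I" for i
  proof -
    have "L i ` C \<noteq> {}" using C(1) by blast
    then obtain M where M: "M \<in> L i ` C" "\<And>J. \<lbrakk>J \<in> L i ` C; M \<subseteq> J\<rbrakk> \<Longrightarrow> J = M"
      by (rule A.ex_maximal_ideal) (use L_ideal Ci in auto)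
    from M(1) obtain I where I: "I \<in> C" "M = L i I" by blast
    have "L i J = L i I" if "J \<in> C" "L i I \<subseteq> L i J" for J
      using M(2)[of "L i J"] that I(2) by simp
    then show ?thesis using I(1) by blast
  qed
  then have "\<forall>i. \<exists>I. I \<in> C \<and> (\<forall>J\<in>C. L i I \<subseteq> L i J \<longrightarrow> L i J = L i I)" by blast
  from choice[OF this] obtain K
    where K: "\<And>i. K i \<in> C" "\<And>i J. J \<in> C \<Longrightarrow> L i (K i) \<subseteq> L i J \<Longrightarrow> L i J = L i (K i)"
    by blast
  have "\<exists>U\<in>C. I0 \<subseteq> U \<and> (\<forall>i<n. K i \<subseteq> U)" for n
  proof (induction n)
    case (Suc n)
    then obtain U where "U \<in> C" "I0 \<subseteq> U" "\<forall>i<n. K i \<subseteq> U" by (elim bexE conjE)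
    show ?case
    proof (cases "U \<subseteq> K n")
      case True
      then have "I0 \<subseteq> K n \<and> (\<forall>i<Suc n. K i \<subseteq> K n)"
        using \<open>I0 \<subseteq> U\<close> \<open>\<forall>i<n. K i \<subseteq> U\<close> by (auto simp: less_Suc_eq)
      then show ?thesis using K(1) by blast
    next
      case False
      then have "I0 \<subseteq> U \<and> (\<forall>i<Suc n. K i \<subseteq> U)"
        using \<open>I0 \<subseteq> U\<close> \<open>\<forall>i<n. K i \<subseteq> U\<close> Cc[OF \<open>U \<in> C\<close> K(1)[of n]] by (auto simp: less_Suc_eq)
      then show ?thesis using \<open>U \<in> C\<close> by blast
    qed
  qed (use I0 in blast)
  then obtain U where U: "U \<in> C" "I0 \<subseteq> U" "\<And>i. i < i0 \<Longrightarrow> K i \<subseteq> U" by blast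
  have "J \<subseteq> U" if J: "J \<in> C" for J
  proof (cases "U \<subseteq> J")
    case True
    have "L i J \<subseteq> L i U" for i
    proof (cases "i0 \<le> i")
      case True
      have "I0 \<subseteq> J" using U(2) \<open>U \<subseteq> J\<close> by (rule order_trans)
      from top[OF True J this] top[OF True U(1,2)] show ?thesis by (rule ord_eq_le_trans[OF _ eq_refl[OF sym]])
    next
      case False
      then have "K i \<subseteq> U" using U(3) by simp
      then have "L i U = L i (K i)" by (intro K(2) U(1) L_mono[OF order_refl _ Ci[OF U(1)]])
      moreover have "K i \<subseteq> J" using \<open>K i \<subseteq> U\<close> \<open>U \<subseteq> J\<close> by (rule order_trans)
      then have "L i J = L i (K i)" by (intro K(2) J L_mono[OF order_refl _ Ci[OF J]])
      ultimately show ?thesis by (metis order_refl)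
    qed
    then show ?thesis by (rule L_eq[OF Ci[OF U(1)] Ci[OF J] True])
  qed (use Cc J U in blast)
  then have "\<Union>C = U" using U(1) by blast
  then show "\<Union>C \<in> C" using U(1) by simp
qed

end

section \<open>Primes of the base ring and of the polynomial ring over it\<close>

context poly_extension
begin

text \<open>For an ideal \<open>P\<close> of the base this is P[x], the ideal that \<open>P\<close>
  generates in the polynomial ring.\<close>

definition ext :: "'a set \<Rightarrow> 'a set" where
  "ext P = {f \<in> carrier R. \<forall>i. coef i f \<in> P}"

lemma ext_subset: "ext P \<subseteq> carrier R"
  by (auto simp: ext_def)

lemma base_idealD:
  assumes "ideal P base"
  shows "P \<subseteq> S" "\<zero> \<in> P" "\<And>a b. \<lbrakk>a \<in> P; b \<in> P\<rbrakk> \<Longrightarrow> a \<oplus> b \<in> P"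
    "\<And>a r. \<lbrakk>a \<in> P; r \<in> S\<rbrakk> \<Longrightarrow> r \<otimes> a \<in> P"
proof -
  note sg = ideal.axioms(1)[OF assms]
  show "P \<subseteq> S" using additive_subgroup.a_subset[OF sg] by simp
  show "\<zero> \<in> P" using additive_subgroup.zero_closed[OF sg] by simp
  show "a \<oplus> b \<in> P" if "a \<in> P" "b \<in> P" for a b
    using additive_subgroup.a_closed[OF sg that] by simp
  show "r \<otimes> a \<in> P" if "a \<in> P" "r \<in> S" for a r
    using ideal.I_l_closed[OF assms that(1)] that(2) by simp
qed

lemma base_primeD:
  assumes "primeideal P base"
  shows "ideal P base" "\<one> \<notin> P" "\<And>a b. \<lbrakk>a \<in> S; b \<in> S; a \<otimes> b \<in> P\<rbrakk> \<Longrightarrow> a \<in> P \<or> b \<in> P"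
  using primeideal.axioms(1)[OF assms] primeideal.one_notin[OF assms] primeideal.I_prime[OF assms]
  by simp_all

lemma ext_ideal:
  assumes "ideal P base"
  shows "ideal (ext P) R"
proof -
  note zeroP = base_idealD(2)[OF assms] and add = base_idealD(3)[OF assms]
    and mult = base_idealD(4)[OF assms]
  show ?thesis
  proof (rule cring_idealI)
    show "ext P \<subseteq> carrier R" by (rule ext_subset)
    show "\<zero> \<in> ext P" using zeroP by (simp add: ext_def)
    show sum: "f \<oplus> g \<in> ext P" if "f \<in> ext P" "g \<in> ext P" for f g
      using that add by (auto simp: ext_def coef_add)
    fix f r assume f: "f \<in> ext P" and r: "r \<in> carrier R"
    then have fc: "f \<in> carrier R" by (simp add: ext_def)
    obtain d where "deg_lt r d" using ex_deg_lt[OF r] by blast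
    with r show "r \<otimes> f \<in> ext P"
    proof (induction d r rule: poly_induct)
      case (zero d)
      then show ?case using zeroP fc by (simp add: ext_def)
    next
      case (lead d r)
      let ?m = "coef d r \<otimes> x [^] d"
      have m: "?m \<in> carrier R" using lead by simp
      have "coef i (?m \<otimes> f) \<in> P" for i
        using f lead(1) zeroP mult coef_monom_mult[of "coef d r" f i d] by (auto simp: ext_def coef_in)
      then have "?m \<otimes> f \<in> ext P" using m fc by (simp add: ext_def)
      with lead have "(r \<ominus> ?m) \<otimes> f \<oplus> ?m \<otimes> f \<in> ext P" by (intro sum) auto
      moreover have "(r \<ominus> ?m) \<otimes> f \<oplus> ?m \<otimes> f = r \<otimes> f" using lead(1) m fc by algebra
      ultimately show ?case by simp
    qed
  qed
qed

text \<open>Dropping top terms with coefficient in \<open>P\<close> does not change the class modulo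
  P[x]. The resulting \<open>d\<close> is the degree of f in (S/P)[x], so primality of P[x] becomes
  a comparison of leading coefficients.\<close>

lemma trunc:
  assumes "ideal P base" "f \<in> carrier R" "f \<notin> ext P"
  obtains g d where "g \<in> carrier R" "f \<ominus> g \<in> ext P" "deg_lt g (Suc d)" "coef d g \<notin> P"
proof -
  interpret E: ideal "ext P" R by (rule ext_ideal) fact
  obtain d where "deg_lt f d" using ex_deg_lt[OF assms(2)] by blast
  with assms(2) have "f \<notin> ext P \<longrightarrow>
    (\<exists>g d. g \<in> carrier R \<and> f \<ominus> g \<in> ext P \<and> deg_lt g (Suc d) \<and> coef d g \<notin> P)"
  proof (induction d f rule: poly_induct)
    case (zero d)
    then show ?case using E.zero_closed by blast
  next
    case (lead d f)
    let ?m = "coef d f \<otimes> x [^] d"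
    have m: "?m \<in> carrier R" using lead by simp
    have c: "coef d f \<in> S" using lead(1) by (rule coef_in)
    show ?case
    proof (rule impI)
      assume f: "f \<notin> ext P"
      show "\<exists>g d. g \<in> carrier R \<and> f \<ominus> g \<in> ext P \<and> deg_lt g (Suc d) \<and> coef d g \<notin> P"
      proof (cases "coef d f \<in> P")
        case True
        have "coef i ?m \<in> P" for i
          using True base_idealD(2)[OF assms(1)] unfolding coef_monom[OF c] by simp
        then have mE: "?m \<in> ext P" using m unfolding ext_def by blast
        have fm: "f \<ominus> ?m \<in> carrier R" using lead(1) m by (rule minus_closed)
        have "f \<ominus> ?m \<notin> ext P"
          using E.a_closed[OF _ mE, of "f \<ominus> ?m"] minus_add_cancel[OF lead(1) m] f by auto
        then obtain g e where g: "g \<in> carrier R" "f \<ominus> ?m \<ominus> g \<in> ext P" "deg_lt g (Suc e)" "coef e g \<notin> P"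
          using lead.IH by blast
        have "(f \<ominus> ?m \<ominus> g) \<oplus> ?m \<in> ext P" by (rule E.a_closed) fact+
        moreover have "(f \<ominus> ?m \<ominus> g) \<oplus> ?m = f \<ominus> g"
          using lead(1) m g(1) by algebra
        ultimately show ?thesis using g by auto
      next
        case False
        have "f \<ominus> f \<in> ext P" using lead(1) E.zero_closed by (simp add: minus_eq r_neg)
        then show ?thesis using False lead(1,2) by blast
      qed
    qed
  qed
  then show ?thesis using assms(3) that by blast
qed

lemma ext_prime:
  assumes "primeideal P base"
  shows "primeideal (ext P) R"
proof -
  note P = base_primeD[OF assms]
  interpret E: ideal "ext P" R by (rule ext_ideal[OF P(1)])
  show ?thesis
  proof (rule primeidealI[OF E.is_ideal is_cring])
    have "coef 0 \<one> = \<one>" by (simp add: coef_const)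
    then have "\<one> \<notin> ext P" using P(2) unfolding ext_def by (metis (mono_tags, lifting) mem_Collect_eq)
    then show "carrier R \<noteq> ext P" by blast
    fix f g assume f: "f \<in> carrier R" and g: "g \<in> carrier R" and fg: "f \<otimes> g \<in> ext P"
    show "f \<in> ext P \<or> g \<in> ext P"
    proof (rule ccontr)
      assume n: "\<not> (f \<in> ext P \<or> g \<in> ext P)"
      obtain f1 d where f1: "f1 \<in> carrier R" "f \<ominus> f1 \<in> ext P" "deg_lt f1 (Suc d)" "coef d f1 \<notin> P"
        using trunc[OF P(1) f] n by blast
      obtain g1 e where g1: "g1 \<in> carrier R" "g \<ominus> g1 \<in> ext P" "deg_lt g1 (Suc e)" "coef e g1 \<notin> P"
        using trunc[OF P(1) g] n by blast
      have "f1 \<otimes> g1 = f \<otimes> g \<ominus> ((f \<ominus> f1) \<otimes> g \<oplus> f1 \<otimes> (g \<ominus> g1))"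
        using f g f1(1) g1(1) by algebra
      moreover have "(f \<ominus> f1) \<otimes> g \<oplus> f1 \<otimes> (g \<ominus> g1) \<in> ext P"
        using f1(1,2) g1(2) g by (intro E.a_closed E.I_r_closed E.I_l_closed)
      ultimately have "f1 \<otimes> g1 \<in> ext P" using E.diff_closed[OF fg] by simp
      then have "coef (d + e) (f1 \<otimes> g1) \<in> P" unfolding ext_def by blast
      then have "coef d f1 \<otimes> coef e g1 \<in> P" by (simp only: coef_mult_lead[OF f1(1,3) g1(1,3)])
      then show False using P(3) coef_in f1(1,4) g1(1,4) by blast
    qed
  qed
qed

lemma ext_contract:
  assumes "ideal P base"
  shows "ext P \<inter> S = P"
proof
  show "ext P \<inter> S \<subseteq> P"
    using coef_const[of _ 0] by (auto simp: ext_def) metis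
  show "P \<subseteq> ext P \<inter> S"
    using base_idealD(1,2)[OF assms] by (auto simp: ext_def coef_const subset_iff)
qed

lemma ext_mono: "P \<subseteq> Q \<Longrightarrow> ext P \<subseteq> ext Q"
  by (auto simp: ext_def)

lemma ext_strict_mono:
  assumes "ideal P base" "ideal Q base" "P \<subset> Q"
  shows "ext P \<subset> ext Q"
  using ext_contract[OF assms(1)] ext_contract[OF assms(2)] ext_mono[of P Q] assms(3) by blast

lemma prime_chain_ext: "prime_chain base h P Q \<Longrightarrow> prime_chain R h (ext P) (ext Q)"
proof (induction rule: prime_chain.induct)
  case (prime_chain_step P P' h Q)
  then show ?case
    using prime_chain_prime[OF prime_chain_step(3)]
    by (intro prime_chain.prime_chain_step[of _ _ "ext P'"] ext_prime ext_strict_mono)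
      (auto intro: primeideal.axioms(1))
qed (intro prime_chain_refl ext_prime)

lemma ext_contract_subset:
  assumes "ideal P R"
  shows "ext (P \<inter> S) \<subseteq> P"
  using mem_ideal_if_coefs[OF assms] by (auto simp: ext_def)

text \<open>Top terms can be stripped off one after another without leaving \<open>P\<close>, since
  each leading coefficient met on the way lies in \<open>P\<close>.\<close>

lemma coefs_in_if_no_lead:
  assumes "ideal P R" and "\<And>e f. \<lbrakk>e < d; f \<in> P; deg_lt f (Suc e)\<rbrakk> \<Longrightarrow> coef e f \<in> P"
    and "f \<in> P" "deg_lt f d"
  shows "f \<in> ext (P \<inter> S)"
proof -
  interpret P: ideal P R by fact
  have "\<And>i. coef i f \<in> P"
    using P.Icarr[OF assms(3)] assms(4,2,3)
  proof (induction d f rule: poly_induct)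
    case (lead d f)
    let ?m = "coef d f \<otimes> x [^] d"
    have c: "coef d f \<in> P" using lead by blast
    have m: "?m \<in> P" using c P.I_r_closed by simp
    have "coef i (f \<ominus> ?m) \<in> P"
      by (rule lead.IH) (use lead m P.diff_closed in auto)
    moreover have "coef i f = coef i (f \<ominus> ?m)" if "i \<noteq> d"
      using that lead(1) coef_minus[of f ?m i] m P.Icarr by (simp add: coef_monom coef_in minus_eq)
    ultimately show ?case using c by (cases "i = d") auto
  qed (simp_all)
  then show ?thesis using P.Icarr[OF assms(3)] coef_in by (auto simp: ext_def)
qed

text \<open>For prime \<open>P\<close>, the f found here plays the part of a minimal polynomial of
  \<open>x\<close> over the fraction field of the base modulo \<open>P\<close>: its leading
  coefficient survives, and whatever in \<open>P\<close> has smaller degree is already extended from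
  the base.\<close>

lemma ex_minimal_lead:
  assumes "ideal P R" "P \<noteq> ext (P \<inter> S)"
  obtains f d where "f \<in> P" "deg_lt f (Suc d)" "coef d f \<notin> P"
    "\<And>g. \<lbrakk>g \<in> P; deg_lt g d\<rbrakk> \<Longrightarrow> g \<in> ext (P \<inter> S)"
proof -
  interpret P: ideal P R by fact
  let ?Q = "\<lambda>d. \<exists>f\<in>P. deg_lt f (Suc d) \<and> coef d f \<notin> P"
  obtain f where f: "f \<in> P" "f \<notin> ext (P \<inter> S)" using assms ext_contract_subset by blast
  obtain d where "deg_lt f d" using ex_deg_lt P.Icarr f by blast
  then have "\<exists>d. ?Q d"
    using coefs_in_if_no_lead[OF assms(1) _ f(1), of d] f(2) by blast
  then obtain d where d: "?Q d" "\<And>e. e < d \<Longrightarrow> \<not> ?Q e"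
    using exists_least_iff[of ?Q] by blast
  from d(1) obtain f where "f \<in> P" "deg_lt f (Suc d)" "coef d f \<notin> P" by blast
  moreover have "g \<in> ext (P \<inter> S)" if "g \<in> P" "deg_lt g d" for g
    using d(2) by (intro coefs_in_if_no_lead[OF assms(1) _ that]) blast
  ultimately show ?thesis using that by blast
qed

text \<open>An extended prime is still minimal over the old set; any other prime costs one more
  element, taken from \<open>ex_minimal_lead\<close>. A prime between the enlarged set and
  \<open>P\<close> has the same contraction as \<open>P\<close>, and pseudodivision by f puts all of
  \<open>P\<close> into it.\<close>

lemma minimal_prime_over_extension:
  assumes P: "primeideal P R" and F: "minimal_prime_over base F (P \<inter> S)"
  shows "minimal_prime_over R F P \<or> P \<noteq> ext (P \<inter> S) \<and> (\<exists>f\<in>P. minimal_prime_over R (insert f F) P)"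
proof (cases "P = ext (P \<inter> S)")
  case True
  have "Q = P" if Q: "primeideal Q R" "F \<subseteq> Q" "Q \<subseteq> P" for Q
  proof -
    have "primeideal (Q \<inter> S) base" by (rule contract_prime[OF Q(1) subring])
    then have "Q \<inter> S = P \<inter> S" using F Q(2,3) unfolding minimal_prime_over_def by blast
    then have "P \<subseteq> Q"
      using True ext_contract_subset[OF primeideal.axioms(1)[OF Q(1)]] by simp
    then show ?thesis using Q(3) by blast
  qed
  then show ?thesis using P F by (auto simp: minimal_prime_over_def)
next
  case False
  interpret P: primeideal P R by fact
  obtain f d where f: "f \<in> P" "deg_lt f (Suc d)" "coef d f \<notin> P"
    and low: "\<And>g. \<lbrakk>g \<in> P; deg_lt g d\<rbrakk> \<Longrightarrow> g \<in> ext (P \<inter> S)"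
    using ex_minimal_lead[OF P.is_ideal False] by blast
  have "Q = P" if Q: "primeideal Q R" "insert f F \<subseteq> Q" "Q \<subseteq> P" for Q
  proof -
    interpret Q: primeideal Q R by fact
    have "primeideal (Q \<inter> S) base" by (rule contract_prime[OF Q(1) subring])
    then have QS: "Q \<inter> S = P \<inter> S" using F Q(2,3) unfolding minimal_prime_over_def by blast
    have "g \<in> Q" if "g \<in> P" "deg_lt g e" for g e
      using that
    proof (induction e arbitrary: g rule: less_induct)
      case (less e)
      have gc: "g \<in> carrier R" and fc: "f \<in> carrier R" using less.prems f P.Icarr by auto
      show ?case
      proof (cases "e \<le> d")
        case True
        then have "g \<in> ext (P \<inter> S)" using low less.prems deg_lt_mono by blast
        then show ?thesis using QS ext_contract_subset[OF Q.is_ideal] by auto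
      next
        case False
        then obtain e' where e: "e = Suc e'" "d \<le> e'" by (cases e) auto
        let ?c = "coef d f" and ?m = "coef e' g \<otimes> x [^] (e' - d)"
        have c: "?c \<in> S" "coef e' g \<in> S" using fc gc coef_in by auto
        have m: "?m \<in> carrier R" using c by simp
        \<comment> \<open>One step of pseudodivision. Multiplying \<open>g\<close> by the leading
          coefficient \<open>?c\<close> of \<open>f\<close> is harmless: \<open>?c\<close> is
          outside \<open>P\<close>, hence outside the prime \<open>Q\<close>.\<close>
        have "deg_lt (?c \<otimes> g \<ominus> ?m \<otimes> f) e'"
        proof (rule deg_lt_minus_lead)
          show "deg_lt (?c \<otimes> g) (Suc e')"
            using less.prems(2) gc c e by (simp add: deg_lt_def coef_smult)
          show "deg_lt (?m \<otimes> f) (Suc e')"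
            using f(2) fc c e by (simp add: deg_lt_def coef_monom_mult)
          show "coef e' (?c \<otimes> g) = coef e' (?m \<otimes> f)"
            using gc fc c e by (auto simp: coef_smult coef_monom_mult m_comm[of "coef d f" "coef e' g"])
        qed (use gc fc m c in auto)
        moreover have "?c \<otimes> g \<ominus> ?m \<otimes> f \<in> P"
          using less.prems(1) f(1) m c by (intro P.diff_closed P.I_l_closed) auto
        ultimately have "?c \<otimes> g \<ominus> ?m \<otimes> f \<in> Q" using less.IH e by blast
        moreover have "?m \<otimes> f \<in> Q" using Q(2) m Q.I_l_closed by blast
        ultimately have "(?c \<otimes> g \<ominus> ?m \<otimes> f) \<oplus> ?m \<otimes> f \<in> Q" by (rule Q.a_closed)
        then have "?c \<otimes> g \<in> Q" using minus_add_cancel gc fc m c by simp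
        then show ?thesis using Q.I_prime[of ?c g] f(3) Q(3) c gc by auto
      qed
    qed
    then have "P \<subseteq> Q" using ex_deg_lt[OF P.Icarr] by blast
    then show ?thesis using Q(3) by (rule subset_antisym[rotated])
  qed
  then have "minimal_prime_over R (insert f F) P"
    using P F f by (auto simp: minimal_prime_over_def)
  then show ?thesis using False f(1) by blast
qed

end

section \<open>Polynomials in indexed variables\<close>

lemma finite_submultisets: "finite {K. K \<subseteq># M}"
proof (induction M)
  case (add x M)
  have "{K. K \<subseteq># add_mset x M} \<subseteq> {K. K \<subseteq># M} \<union> add_mset x ` {K. K \<subseteq># M}"
  proof
    fix K assume K: "K \<in> {K. K \<subseteq># add_mset x M}"
    show "K \<in> {K. K \<subseteq># M} \<union> add_mset x ` {K. K \<subseteq># M}"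
    proof (cases "x \<in># K")
      case True
      then obtain K' where "K = add_mset x K'" by (metis multi_member_split)
      then show ?thesis using K by auto
    next
      case False
      have "count K a \<le> count M a" for a
        using K False by (cases "a = x") (auto simp: subseteq_mset_def not_in_iff dest: spec[of _ a])
      then have "K \<subseteq># M" by (simp add: subseteq_mset_def)
      then show ?thesis by simp
    qed
  qed
  then show ?case using add by (meson finite_UnI finite_imageI finite_subset)
qed simp

text \<open>Rings for different variable sets share their operations and differ only in the carrier,
  so the ring over fewer variables is a subring of the larger one without any embedding.\<close>

definition indexed_poly_ring ::
    "('a, 'b) ring_scheme \<Rightarrow> 'v set \<Rightarrow> (('v multiset \<Rightarrow> 'a) \<Rightarrow> 'v multiset \<Rightarrow> 'a) list
      \<Rightarrow> ('v multiset \<Rightarrow> 'a) diff_ring" where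
  "indexed_poly_ring R W D =
    \<lparr>carrier = ring.indexed_pset R W (carrier R),
     monoid.mult = indexed_mult R,
     one = ring.indexed_const R \<one>\<^bsub>R\<^esub>,
     zero = ring.indexed_const R \<zero>\<^bsub>R\<^esub>,
     add = ring.indexed_padd R,
     derivs = D\<rparr>"

lemma diff_poly_ring_eq:
  "diff_poly_ring R n = indexed_poly_ring R (diff_vars (length (derivs R)) n)
     (map (\<lambda>j. indexed_deriv R (derivs R ! j) (diff_var_shift j)) [0..<length (derivs R)])"
  by (simp add: diff_poly_ring_def indexed_poly_ring_def)

lemma indexed_poly_ring_simps[simp]:
  "carrier (indexed_poly_ring R W D) = ring.indexed_pset R W (carrier R)"
  "monoid.mult (indexed_poly_ring R W D) = indexed_mult R"
  "one (indexed_poly_ring R W D) = ring.indexed_const R \<one>\<^bsub>R\<^esub>"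
  "zero (indexed_poly_ring R W D) = ring.indexed_const R \<zero>\<^bsub>R\<^esub>"
  "add (indexed_poly_ring R W D) = ring.indexed_padd R"
  "derivs (indexed_poly_ring R W D) = D"
  "indexed_poly_ring R W D\<lparr>carrier := ring.indexed_pset R W' (carrier R)\<rparr> = indexed_poly_ring R W' D"
  by (simp_all add: indexed_poly_ring_def)

section \<open>The ring of polynomials of finite support\<close>

context cring
begin

abbreviation "psupp f \<equiv> {M. f M \<noteq> \<zero>}"

lemma indexed_const_pset: "k \<in> carrier R \<Longrightarrow> indexed_const k \<in> indexed_pset W (carrier R)"
  by (rule indexed_pset.indexed_const)

lemma carrier_coeff_pset: "f \<in> indexed_pset W (carrier R) \<Longrightarrow> carrier_coeff f"
  by (rule indexed_pset_in_carrier) auto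

lemma pset_coeff[simp]: "f \<in> indexed_pset W (carrier R) \<Longrightarrow> f M \<in> carrier R"
  using carrier_coeff_pset carrier_coeffE by blast

lemma pset_mono:
  fixes W W' :: "'v set"
  shows "W \<subseteq> W' \<Longrightarrow> indexed_pset W (carrier R) \<subseteq> indexed_pset W' (carrier R)"
proof
  fix f assume "W \<subseteq> W'" "f \<in> indexed_pset W (carrier R)"
  from this(2,1) show "f \<in> indexed_pset W' (carrier R)"
    by (induction) (auto intro: indexed_pset.intros)
qed

text \<open>Turns the inductively generated carrier into a condition on supports. For the converse,
  monomials are built variable by variable and then split off from a finitely supported function one
  at a time.\<close>

lemma indexed_pset_iff:
  fixes f :: "'v multiset \<Rightarrow> 'a"
  shows
  "f \<in> indexed_pset W (carrier R) \<longleftrightarrow>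
     carrier_coeff f \<and> finite (psupp f) \<and> (\<forall>M\<in>psupp f. set_mset M \<subseteq> W)"
proof
  assume f: "f \<in> indexed_pset W (carrier R)"
  then have "finite (psupp f) \<and> (\<forall>M\<in>psupp f. set_mset M \<subseteq> W)"
  proof induction
    case (indexed_const k)
    have "psupp (indexed_const k) \<subseteq> {{#}}" by (auto simp: indexed_const_def)
    then show ?case by (auto intro: finite_subset)
  next
    case (indexed_padd P Q)
    have "psupp (P \<Oplus> Q) \<subseteq> psupp P \<union> psupp Q" by (auto simp: indexed_padd_def)
    then show ?case using indexed_padd.IH
      by (metis (no_types, lifting) Un_iff finite_UnI finite_subset subsetD)
  next
    case (indexed_pmult P i)
    have "psupp (P \<Otimes> i) \<subseteq> add_mset i ` psupp P"
    proof
      fix M assume "M \<in> psupp (P \<Otimes> i)"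
      then have "i \<in># M" "P (M - {#i#}) \<noteq> \<zero>" by (auto simp: indexed_pmult_def split: if_splits)
      then show "M \<in> add_mset i ` psupp P" by (intro image_eqI[of _ _ "M - {#i#}"]) auto
    qed
    moreover have "\<forall>M\<in>add_mset i ` psupp P. set_mset M \<subseteq> W"
      using indexed_pmult by auto
    ultimately show ?case using indexed_pmult.IH
      by (meson finite_imageI finite_subset subsetD)
  qed
  then show "carrier_coeff f \<and> finite (psupp f) \<and> (\<forall>M\<in>psupp f. set_mset M \<subseteq> W)"
    using carrier_coeff_pset[OF f] by blast
next
  assume f: "carrier_coeff f \<and> finite (psupp f) \<and> (\<forall>M\<in>psupp f. set_mset M \<subseteq> W)"
  have monom: "(\<lambda>N. if N = M then k else \<zero>) \<in> indexed_pset W (carrier R)"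
    if "k \<in> carrier R" "set_mset M \<subseteq> W" for k and M :: "'v multiset"
    using that(2)
  proof (induction M)
    case empty
    then show ?case using indexed_const_pset[OF that(1)] by (simp add: indexed_const_def)
  next
    case (add i M)
    then have "(\<lambda>N. if N = M then k else \<zero>) \<Otimes> i \<in> indexed_pset W (carrier R)"
      by (intro indexed_pset.indexed_pmult) auto
    moreover have "(\<lambda>N. if N = M then k else \<zero>) \<Otimes> i = (\<lambda>N. if N = add_mset i M then k else \<zero>)"
      by (auto simp: indexed_pmult_def fun_eq_iff dest!: multi_member_split)
    ultimately show ?case by simp
  qed
  have "\<forall>f :: 'v multiset \<Rightarrow> 'a. carrier_coeff f \<and> psupp f \<subseteq> F \<and> (\<forall>M\<in>F. set_mset M \<subseteq> W) \<longrightarrow> f \<in> indexed_pset W (carrier R)"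
    if "finite F" for F :: "'v multiset set"
    using that
  proof (induction F)
    case empty
    show ?case
    proof (intro allI impI)
      fix f :: "'v multiset \<Rightarrow> 'a"
      assume "carrier_coeff f \<and> psupp f \<subseteq> {} \<and> (\<forall>M\<in>{}. set_mset M \<subseteq> W)"
      then have "f = indexed_const \<zero>" by (auto simp: indexed_const_def)
      then show "f \<in> indexed_pset W (carrier R)" using indexed_const_pset[OF zero_closed] by simp
    qed
  next
    case (insert M F)
    show ?case
    proof (intro allI impI)
      fix f :: "'v multiset \<Rightarrow> 'a"
      assume f: "carrier_coeff f \<and> psupp f \<subseteq> insert M F \<and> (\<forall>M\<in>insert M F. set_mset M \<subseteq> W)"
      have "f(M := \<zero>) \<in> indexed_pset W (carrier R)"
      proof (rule insert.IH[rule_format], intro conjI ballI)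
        show "carrier_coeff (f(M := \<zero>))" using f by (simp add: carrier_coeff_def)
        show "psupp (f(M := \<zero>)) \<subseteq> F" using f by auto
      qed (use f in blast)
      moreover have "(\<lambda>N. if N = M then f M else \<zero>) \<in> indexed_pset W (carrier R)"
        using f by (intro monom) (auto simp: carrier_coeff_def)
      ultimately have "f(M := \<zero>) \<Oplus> (\<lambda>N. if N = M then f M else \<zero>) \<in> indexed_pset W (carrier R)"
        by (rule indexed_pset.indexed_padd)
      moreover have "f(M := \<zero>) \<Oplus> (\<lambda>N. if N = M then f M else \<zero>) = f"
        using f by (auto simp: indexed_padd_def carrier_coeff_def fun_eq_iff)
      ultimately show "f \<in> indexed_pset W (carrier R)" by simp
    qed
  qed
  then show "f \<in> indexed_pset W (carrier R)" using f by blast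
qed

lemma indexed_mult_coeff:
  "\<lbrakk>carrier_coeff f; carrier_coeff g\<rbrakk> \<Longrightarrow> carrier_coeff (indexed_mult R f g)"
  by (auto simp: indexed_mult_def carrier_coeff_def)

lemma indexed_mult_comm:
  fixes f g :: "'v multiset \<Rightarrow> 'a"
  assumes "carrier_coeff f" "carrier_coeff g"
  shows "indexed_mult R f g = indexed_mult R g f"
proof
  fix M :: "'v multiset"
  let ?A = "{K. K \<subseteq># M}"
  have img: "(\<lambda>K. M - K) ` ?A = ?A"
  proof
    show "(\<lambda>K. M - K) ` ?A \<subseteq> ?A" by auto
    show "?A \<subseteq> (\<lambda>K. M - K) ` ?A"
    proof
      fix K assume K: "K \<in> ?A"
      then have "K = M - (M - K)" by (simp add: multiset_eq_iff subseteq_mset_def)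
      then show "K \<in> (\<lambda>K. M - K) ` ?A" by (rule image_eqI) simp
    qed
  qed
  have inj: "inj_on (\<lambda>K. M - K) ?A"
  proof (rule inj_on_inverseI)
    fix K assume "K \<in> ?A"
    then show "M - (M - K) = K" by (simp add: multiset_eq_iff subseteq_mset_def)
  qed
  have "indexed_mult R g f M = (\<Oplus>K\<in>(\<lambda>K. M - K) ` ?A. g K \<otimes> f (M - K))"
    by (simp add: indexed_mult_def img)
  also have "\<dots> = (\<Oplus>K\<in>?A. g (M - K) \<otimes> f (M - (M - K)))"
    using assms inj by (subst finsum_reindex) (auto simp: carrier_coeff_def)
  also have "\<dots> = (\<Oplus>K\<in>?A. f K \<otimes> g (M - K))"
    using assms by (intro finsum_cong')
      (auto simp: carrier_coeff_def m_comm subset_mset.diff_diff_right)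
  finally show "indexed_mult R f g M = indexed_mult R g f M" by (simp add: indexed_mult_def)
qed

text \<open>With the rules for constants and sums this determines the product along the inductive
  generation of polynomials, so closure and associativity follow by induction on the first
  factor.\<close>

lemma indexed_mult_pmult:
  assumes "carrier_coeff f" "carrier_coeff g"
  shows "indexed_mult R (f \<Otimes> i) g = indexed_mult R f g \<Otimes> i"
proof
  fix M
  have f: "f N \<in> carrier R" "g N \<in> carrier R" for N using assms by (auto simp: carrier_coeff_def)
  show "indexed_mult R (f \<Otimes> i) g M = (indexed_mult R f g \<Otimes> i) M"
  proof (cases "i \<in># M")
    case False
    then have "(\<Oplus>K\<in>{K. K \<subseteq># M}. (f \<Otimes> i) K \<otimes> g (M - K)) = (\<Oplus>K\<in>{K. K \<subseteq># M}. \<zero>)"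
      by (intro finsum_cong') (auto simp: indexed_pmult_def f dest: mset_subset_eqD)
    then show ?thesis using False by (simp add: indexed_mult_def indexed_pmult_def)
  next
    case True
    then obtain M' where M: "M = add_mset i M'" by (metis multi_member_split)
    have inj: "inj_on (add_mset i) {K. K \<subseteq># M'}" by (auto intro: inj_onI)
    have "(\<Oplus>K\<in>add_mset i ` {K. K \<subseteq># M'}. (f \<Otimes> i) K \<otimes> g (M - K)) =
        (\<Oplus>K\<in>{K. K \<subseteq># M}. (f \<Otimes> i) K \<otimes> g (M - K))"
    proof (rule add.finprod_mono_neutral_cong_left[OF finite_submultisets])
      fix K assume "K \<in> {K. K \<subseteq># M} - add_mset i ` {K. K \<subseteq># M'}"
      then have "i \<notin># K" using M by (auto dest!: multi_member_split)
      then show "(f \<Otimes> i) K \<otimes> g (M - K) = \<zero>" by (simp add: indexed_pmult_def f)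
    qed (auto simp: M indexed_pmult_def f)
    moreover have "(\<Oplus>K\<in>add_mset i ` {K. K \<subseteq># M'}. (f \<Otimes> i) K \<otimes> g (M - K)) =
        (\<Oplus>K\<in>{K. K \<subseteq># M'}. f K \<otimes> g (M' - K))"
      by (subst finsum_reindex[OF _ inj]) (auto simp: M indexed_pmult_def f)
    ultimately show ?thesis by (simp add: indexed_mult_def indexed_pmult_def M)
  qed
qed

lemma indexed_mult_const:
  assumes "k \<in> carrier R" "carrier_coeff g"
  shows "indexed_mult R (indexed_const k) g = (\<lambda>M. k \<otimes> g M)"
proof
  fix M
  have g: "g N \<in> carrier R" for N using assms by (auto simp: carrier_coeff_def)
  have "(\<Oplus>K\<in>{{#}}. indexed_const k K \<otimes> g (M - K)) = (\<Oplus>K\<in>{K. K \<subseteq># M}. indexed_const k K \<otimes> g (M - K))"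
    by (rule add.finprod_mono_neutral_cong_left[OF finite_submultisets])
      (auto simp: indexed_const_def g assms)
  then show "indexed_mult R (indexed_const k) g M = k \<otimes> g M"
    using assms g by (simp add: indexed_mult_def indexed_const_def)
qed

lemma indexed_mult_padd_l:
  assumes "carrier_coeff f" "carrier_coeff f'" "carrier_coeff g"
  shows "indexed_mult R (f \<Oplus> f') g = indexed_mult R f g \<Oplus> indexed_mult R f' g"
  using assms
  by (auto simp: indexed_mult_def indexed_padd_def carrier_coeff_def fun_eq_iff l_distr
      simp flip: finsum_addf intro!: finsum_cong')

lemma indexed_mult_closed:
  assumes "f \<in> indexed_pset W (carrier R)" "g \<in> indexed_pset W (carrier R)"
  shows "indexed_mult R f g \<in> indexed_pset W (carrier R)"
  using assms
proof (induction f)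
  case (indexed_const k)
  note g = carrier_coeff_pset[OF indexed_const(2)]
  have "psupp (\<lambda>M. k \<otimes> g M) \<subseteq> psupp g" using indexed_const(1) by auto
  then show ?case
    using indexed_const g unfolding indexed_mult_const[OF indexed_const(1) g] indexed_pset_iff
    by (auto simp: carrier_coeff_def intro: finite_subset)
next
  case (indexed_padd P Q)
  then show ?case
    by (simp add: indexed_mult_padd_l carrier_coeff_pset indexed_pset.indexed_padd)
next
  case (indexed_pmult P i)
  then show ?case
    by (simp add: indexed_mult_pmult carrier_coeff_pset indexed_pset.indexed_pmult)
qed

lemma indexed_mult_assoc:
  assumes "f \<in> indexed_pset W (carrier R)" "carrier_coeff g" "carrier_coeff h"
  shows "indexed_mult R (indexed_mult R f g) h = indexed_mult R f (indexed_mult R g h)"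
  using assms
proof (induction f)
  case (indexed_const k)
  have gh: "g M \<in> carrier R" "h M \<in> carrier R" for M using indexed_const by (auto simp: carrier_coeff_def)
  have "indexed_mult R (\<lambda>M. k \<otimes> g M) h = (\<lambda>M. k \<otimes> indexed_mult R g h M)"
  proof
    fix M
    have "(\<Oplus>K\<in>{K. K \<subseteq># M}. k \<otimes> g K \<otimes> h (M - K)) = (\<Oplus>K\<in>{K. K \<subseteq># M}. k \<otimes> (g K \<otimes> h (M - K)))"
      by (intro finsum_cong') (auto simp: gh indexed_const(1) m_assoc)
    also have "\<dots> = k \<otimes> (\<Oplus>K\<in>{K. K \<subseteq># M}. g K \<otimes> h (M - K))"
      by (rule finsum_rdistr[symmetric]) (auto simp: finite_submultisets indexed_const(1) gh)
    finally show "indexed_mult R (\<lambda>M. k \<otimes> g M) h M = k \<otimes> indexed_mult R g h M"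
      by (simp add: indexed_mult_def)
  qed
  then show ?case using indexed_const by (simp add: indexed_mult_const indexed_mult_coeff)
next
  case (indexed_padd P Q)
  then show ?case
    by (simp add: indexed_mult_padd_l carrier_coeff_pset indexed_mult_coeff)
next
  case (indexed_pmult P i)
  then show ?case
    by (simp add: indexed_mult_pmult carrier_coeff_pset indexed_mult_coeff)
qed

lemma indexed_poly_cring: "cring (indexed_poly_ring R W D)"
proof (rule cringI)
  let ?P = "indexed_poly_ring R W D"
  show "abelian_group ?P"
  proof (rule abelian_groupI)
    fix f g h assume fg: "f \<in> carrier ?P" "g \<in> carrier ?P"
    then have c: "f M \<in> carrier R" "g M \<in> carrier R" for M by auto
    show "f \<oplus>\<^bsub>?P\<^esub> g \<in> carrier ?P" using fg by (simp add: indexed_pset.indexed_padd)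
    show "f \<oplus>\<^bsub>?P\<^esub> g = g \<oplus>\<^bsub>?P\<^esub> f" using c by (simp add: indexed_padd_def a_comm)
    show "\<zero>\<^bsub>?P\<^esub> \<oplus>\<^bsub>?P\<^esub> f = f" using c by (simp add: indexed_padd_def indexed_zero_def)
    show "\<exists>y\<in>carrier ?P. y \<oplus>\<^bsub>?P\<^esub> f = \<zero>\<^bsub>?P\<^esub>"
    proof
      show "indexed_mult R (indexed_const (\<ominus> \<one>)) f \<in> carrier ?P"
        using fg by (auto intro: indexed_mult_closed indexed_const_pset)
      have "\<ominus> \<one> \<otimes> f M \<oplus> f M = \<zero>" for M using c(1)[of M] by (simp add: l_minus l_neg)
      then show "indexed_mult R (indexed_const (\<ominus> \<one>)) f \<oplus>\<^bsub>?P\<^esub> f = \<zero>\<^bsub>?P\<^esub>"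
        using fg(1) by (simp add: indexed_mult_const carrier_coeff_pset indexed_padd_def indexed_zero_def)
    qed
    assume "h \<in> carrier ?P"
    then have "h M \<in> carrier R" for M by simp
    with c show "f \<oplus>\<^bsub>?P\<^esub> g \<oplus>\<^bsub>?P\<^esub> h = f \<oplus>\<^bsub>?P\<^esub> (g \<oplus>\<^bsub>?P\<^esub> h)"
      by (simp add: indexed_padd_def a_assoc)
  qed (simp add: indexed_const_pset)
  show "comm_monoid ?P"
  proof (rule comm_monoidI)
    fix f g h assume fg: "f \<in> carrier ?P" "g \<in> carrier ?P"
    show "f \<otimes>\<^bsub>?P\<^esub> g \<in> carrier ?P" using fg by (simp add: indexed_mult_closed)
    show "f \<otimes>\<^bsub>?P\<^esub> g = g \<otimes>\<^bsub>?P\<^esub> f" using fg by (simp add: indexed_mult_comm carrier_coeff_pset)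
    show "\<one>\<^bsub>?P\<^esub> \<otimes>\<^bsub>?P\<^esub> f = f" using fg by (simp add: indexed_mult_const carrier_coeff_pset)
    assume "h \<in> carrier ?P"
    with fg show "f \<otimes>\<^bsub>?P\<^esub> g \<otimes>\<^bsub>?P\<^esub> h = f \<otimes>\<^bsub>?P\<^esub> (g \<otimes>\<^bsub>?P\<^esub> h)"
      by (auto intro: indexed_mult_assoc carrier_coeff_pset)
  qed (simp add: indexed_const_pset)
  fix f g h assume "f \<in> carrier ?P" "g \<in> carrier ?P" "h \<in> carrier ?P"
  then show "(f \<oplus>\<^bsub>?P\<^esub> g) \<otimes>\<^bsub>?P\<^esub> h = f \<otimes>\<^bsub>?P\<^esub> h \<oplus>\<^bsub>?P\<^esub> g \<otimes>\<^bsub>?P\<^esub> h"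
    by (simp add: indexed_mult_padd_l carrier_coeff_pset)
qed

lemma indexed_pset_subring:
  assumes "W \<subseteq> W'"
  shows "subring (indexed_pset W (carrier R)) (indexed_poly_ring R W' D)"
proof -
  interpret P: cring "indexed_poly_ring R W' D" by (rule indexed_poly_cring)
  have "ring (indexed_poly_ring R W' D\<lparr>carrier := indexed_pset W (carrier R)\<rparr>)"
    using indexed_poly_cring[of W D] by (simp add: cring.axioms)
  then show ?thesis using pset_mono[OF assms] by (intro P.ring_incl_imp_subring) auto
qed

text \<open>The coefficient of v^i in \<open>f\<close> as a polynomial in \<open>v\<close>. The
  value 0 on monomials containing \<open>v\<close> keeps the result free of \<open>v\<close> and
  assigns each monomial of \<open>f\<close> to exactly one power.\<close>

definition var_coef :: "'c \<Rightarrow> nat \<Rightarrow> ('c multiset \<Rightarrow> 'a) \<Rightarrow> 'c multiset \<Rightarrow> 'a" where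
  "var_coef v i f = (\<lambda>M. if v \<in># M then \<zero> else f (M + replicate_mset i v))"

lemma var_coef_padd: "var_coef v i (f \<Oplus> g) = var_coef v i f \<Oplus> var_coef v i g"
  by (auto simp: var_coef_def indexed_padd_def fun_eq_iff)

lemma var_coef_pmult_other:
  assumes "w \<noteq> v"
  shows "var_coef v i (f \<Otimes> w) = var_coef v i f \<Otimes> w"
proof
  fix M
  show "var_coef v i (f \<Otimes> w) M = (var_coef v i f \<Otimes> w) M"
  proof (cases "v \<in># M")
    case True
    then have "v \<in># M - {#w#}" using assms by (simp add: in_diff_count)
    with True show ?thesis by (simp add: var_coef_def indexed_pmult_def)
  next
    case False
    then have "v \<notin># M - {#w#}" by (auto dest: in_diffD)
    moreover have "M - {#w#} + replicate_mset i v = M + replicate_mset i v - {#w#}" if "w \<in># M"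
      using that by (auto dest!: multi_member_split)
    ultimately show ?thesis using False assms by (simp add: var_coef_def indexed_pmult_def)
  qed
qed

lemma var_coef_smult:
  assumes "a \<in> indexed_pset W (carrier R)" "v \<notin> W" "carrier_coeff f"
  shows "var_coef v i (indexed_mult R a f) = indexed_mult R a (var_coef v i f)"
proof -
  have c: "carrier_coeff (var_coef v i f)" using assms(3) by (auto simp: var_coef_def carrier_coeff_def)
  show ?thesis
    using assms
  proof (induction a)
    case (indexed_const k)
    then show ?case using c by (auto simp: indexed_mult_const var_coef_def fun_eq_iff)
  next
    case (indexed_padd P Q)
    then show ?case using c by (simp add: indexed_mult_padd_l carrier_coeff_pset var_coef_padd)
  next
    case (indexed_pmult P w)
    then have "w \<noteq> v" by blast
    with indexed_pmult show ?case using c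
      by (simp add: indexed_mult_pmult carrier_coeff_pset var_coef_pmult_other)
  qed
qed

lemma var_coef_closed:
  assumes f: "f \<in> indexed_pset (insert v W) (carrier R)"
  shows "var_coef v i f \<in> indexed_pset W (carrier R)"
proof -
  have "psupp (var_coef v i f) \<subseteq> (\<lambda>M. M - replicate_mset i v) ` psupp f"
  proof
    fix M assume "M \<in> psupp (var_coef v i f)"
    then have "M + replicate_mset i v \<in> psupp f" by (auto simp: var_coef_def split: if_splits)
    then show "M \<in> (\<lambda>M. M - replicate_mset i v) ` psupp f" by force
  qed
  moreover have "set_mset M \<subseteq> W" if "M \<in> psupp (var_coef v i f)" for M
  proof -
    from that have "v \<notin># M" "M + replicate_mset i v \<in> psupp f" by (auto simp: var_coef_def split: if_splits)
    then have "set_mset (M + replicate_mset i v) \<subseteq> insert v W" using f unfolding indexed_pset_iff by blast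
    then have "set_mset M \<subseteq> insert v W" by simp
    then show ?thesis using \<open>v \<notin># M\<close> by blast
  qed
  moreover have "finite ((\<lambda>M. M - replicate_mset i v) ` psupp f)" "carrier_coeff f"
    using f unfolding indexed_pset_iff by blast+
  moreover from this(2) have "carrier_coeff (var_coef v i f)"
    by (simp add: carrier_coeff_def var_coef_def)
  ultimately show ?thesis
    unfolding indexed_pset_iff using finite_subset by blast
qed

lemma indexed_poly_extension:
  assumes v: "v \<notin> W"
  shows "poly_extension (indexed_poly_ring R (insert v W) D) (indexed_pset W (carrier R))
           (indexed_var v) (var_coef v)"
    (is "poly_extension ?P ?S _ _")
proof -
  interpret P: cring ?P by (rule indexed_poly_cring)
  have var_mult: "indexed_mult R (indexed_var v) f = f \<Otimes> v" if "carrier_coeff f" for f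
  proof -
    have "carrier_coeff (indexed_const \<one>)" by (auto simp: indexed_const_def carrier_coeff_def)
    from indexed_mult_pmult[OF this that] indexed_mult_const[OF one_closed that] show ?thesis
      using carrier_coeffE[OF that] by (simp add: indexed_var_def)
  qed
  show ?thesis
  proof (intro poly_extension.intro poly_extension_axioms.intro)
    show "cring ?P" by (rule indexed_poly_cring)
    show "subring ?S ?P" by (rule indexed_pset_subring) blast
    show "indexed_var v \<in> carrier ?P"
      by (auto simp: indexed_var_def intro: indexed_pset.intros)
    show "var_coef v i f \<in> ?S" if "f \<in> carrier ?P" for f i
      using that by (simp add: var_coef_closed)
    show "var_coef v i (f \<oplus>\<^bsub>?P\<^esub> g) = var_coef v i f \<oplus>\<^bsub>?P\<^esub> var_coef v i g" for f g i
      by (simp add: var_coef_padd)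
    show "var_coef v i (a \<otimes>\<^bsub>?P\<^esub> f) = a \<otimes>\<^bsub>?P\<^esub> var_coef v i f"
      if "a \<in> ?S" "f \<in> carrier ?P" for a f i
      using var_coef_smult[OF that(1) v] that(2) by (simp add: carrier_coeff_pset)
    show "var_coef v (Suc i) (indexed_var v \<otimes>\<^bsub>?P\<^esub> f) = var_coef v i f" if "f \<in> carrier ?P" for f i
      using that by (auto simp: var_mult carrier_coeff_pset var_coef_def indexed_pmult_def)
    show "var_coef v 0 (indexed_var v \<otimes>\<^bsub>?P\<^esub> f) = \<zero>\<^bsub>?P\<^esub>" if "f \<in> carrier ?P" for f
      using that by (auto simp: var_mult carrier_coeff_pset var_coef_def indexed_pmult_def indexed_zero_def)
    show "var_coef v i a = (if i = 0 then a else \<zero>\<^bsub>?P\<^esub>)" if "a \<in> ?S" for a i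
    proof -
      have "a M = \<zero>" if "v \<in># M" for M
        using \<open>a \<in> ?S\<close> v that by (auto simp: indexed_pset_iff)
      then show ?thesis by (auto simp: var_coef_def indexed_zero_def fun_eq_iff)
    qed
    show "\<exists>d. \<forall>i\<ge>d. var_coef v i f = \<zero>\<^bsub>?P\<^esub>" if "f \<in> carrier ?P" for f
    proof -
      have fin: "finite ((\<lambda>M. count M v) ` psupp f)" using that by (simp add: indexed_pset_iff)
      obtain d where d: "\<And>M. M \<in> psupp f \<Longrightarrow> count M v < d"
        using finite_nat_set_iff_bounded[THEN iffD1, OF fin] by auto
      have "f (M + replicate_mset i v) = \<zero>" if "d \<le> i" for M i
        using d[of "M + replicate_mset i v"] that by force
      then show ?thesis by (intro exI[of _ d]) (auto simp: var_coef_def indexed_zero_def)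
    qed
    fix f assume "f \<in> carrier ?P" and zero: "\<And>i. var_coef v i f = \<zero>\<^bsub>?P\<^esub>"
    show "f = \<zero>\<^bsub>?P\<^esub>"
    proof -
      have "f M = \<zero>" for M
      proof -
        have "M = filter_mset (\<lambda>w. w \<noteq> v) M + replicate_mset (count M v) v"
          by (rule multiset_eqI) auto
        moreover have "var_coef v (count M v) f (filter_mset (\<lambda>w. w \<noteq> v) M) = \<zero>"
          using zero by (simp add: indexed_zero_def)
        ultimately show ?thesis by (simp add: var_coef_def)
      qed
      then show ?thesis by (simp add: indexed_zero_def fun_eq_iff)
    qed
  qed
qed

end

section \<open>Towers of polynomial rings\<close>

context cring
begin

lemma indexed_const_hom:
  assumes "a \<in> carrier R" "b \<in> carrier R"
  shows "indexed_mult R (indexed_const a) (indexed_const b) = indexed_const (a \<otimes> b)"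
proof -
  have "carrier_coeff (indexed_const b)" using assms by (auto simp: indexed_const_def carrier_coeff_def)
  from indexed_mult_const[OF assms(1) this]
  have "indexed_mult R (indexed_const a) (indexed_const b) = (\<lambda>M. a \<otimes> indexed_const b M)" .
  also have "\<dots> = indexed_const (a \<otimes> b)" using assms by (auto simp: indexed_const_def fun_eq_iff)
  finally show ?thesis .
qed

lemma indexed_pset_empty: "indexed_pset {} (carrier R) = indexed_const ` carrier R"
proof
  show "indexed_pset {} (carrier R) \<subseteq> indexed_const ` carrier R"
  proof
    fix f :: "'v multiset \<Rightarrow> 'a" assume f: "f \<in> indexed_pset {} (carrier R)"
    then have "f M = \<zero>" if "M \<noteq> {#}" for M using that by (auto simp: indexed_pset_iff)
    then have "f = indexed_const (f {#})" by (auto simp: indexed_const_def)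
    then show "f \<in> indexed_const ` carrier R" using pset_coeff[OF f] by (rule image_eqI)
  qed
qed (auto intro: indexed_const_pset)

lemma indexed_const_contract:
  assumes "ideal I (indexed_poly_ring R W D)"
  shows "ideal {a \<in> carrier R. indexed_const a \<in> I} R"
proof -
  interpret P: cring "indexed_poly_ring R W D" by (rule indexed_poly_cring)
  interpret I: additive_subgroup I "indexed_poly_ring R W D" using assms by (rule ideal.axioms)
  show ?thesis
  proof (rule cring_idealI)
    show "\<zero> \<in> {a \<in> carrier R. indexed_const a \<in> I}" using I.zero_closed by simp
    show "a \<oplus> b \<in> {a \<in> carrier R. indexed_const a \<in> I}"
      if "a \<in> {a \<in> carrier R. indexed_const a \<in> I}" "b \<in> {a \<in> carrier R. indexed_const a \<in> I}" for a b
      using that I.a_closed[of "indexed_const a" "indexed_const b"] by (simp add: indexed_padd_const)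
    show "r \<otimes> a \<in> {a \<in> carrier R. indexed_const a \<in> I}"
      if "a \<in> {a \<in> carrier R. indexed_const a \<in> I}" "r \<in> carrier R" for a r
      using that ideal.I_l_closed[OF assms, of "indexed_const a" "indexed_const r"]
      by (simp add: indexed_const_hom indexed_const_pset)
  qed auto
qed

lemma indexed_const_contract_prime:
  assumes "primeideal P (indexed_poly_ring R W D)"
  shows "primeideal {a \<in> carrier R. indexed_const a \<in> P} R"
proof (rule primeidealI[OF indexed_const_contract[OF primeideal.axioms(1)[OF assms]] is_cring])
  show "carrier R \<noteq> {a \<in> carrier R. indexed_const a \<in> P}"
    using primeideal.one_notin[OF assms] one_closed by auto
  fix a b assume "a \<in> carrier R" "b \<in> carrier R" "a \<otimes> b \<in> {a \<in> carrier R. indexed_const a \<in> P}"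
  then show "a \<in> {a \<in> carrier R. indexed_const a \<in> P} \<or> b \<in> {a \<in> carrier R. indexed_const a \<in> P}"
    using primeideal.I_prime[OF assms, of "indexed_const a" "indexed_const b"]
    by (simp add: indexed_const_hom indexed_const_pset)
qed

end

text \<open>Without variables the ring is only an isomorphic copy of \<open>R\<close>, so generators
  are carried over through \<open>indexed_const\<close>.\<close>

lemma (in noetherian_cring) noetherian_indexed_poly_empty:
  "noetherian_ring (indexed_poly_ring R {} D)"
proof -
  let ?P = "indexed_poly_ring R {} D"
  interpret P: cring ?P by (rule indexed_poly_cring)
  show ?thesis
  proof (rule P.noetherian_ringI)
    fix I assume I: "ideal I ?P"
    obtain A where A: "A \<subseteq> carrier R" "finite A" "{a \<in> carrier R. indexed_const a \<in> I} = Idl A"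
      using finetely_gen[OF indexed_const_contract[OF I]] by blast
    let ?A = "indexed_const ` A :: ('c multiset \<Rightarrow> 'a) set"
    have Ac: "?A \<subseteq> carrier ?P" using A(1) by (auto intro: indexed_const_pset)
    note G = P.genideal_ideal[OF Ac]
    have "A \<subseteq> {a \<in> carrier R. indexed_const a \<in> Idl\<^bsub>?P\<^esub> ?A}"
      using A(1) P.genideal_self[OF Ac] by auto
    then have sub: "{a \<in> carrier R. indexed_const a \<in> I} \<subseteq> {a \<in> carrier R. indexed_const a \<in> Idl\<^bsub>?P\<^esub> ?A}"
      unfolding A(3) by (rule genideal_minimal[OF indexed_const_contract[OF G]])
    have "I \<subseteq> Idl\<^bsub>?P\<^esub> ?A"
    proof
      fix f assume f: "f \<in> I"
      then have "f \<in> indexed_const ` carrier R"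
        using additive_subgroup.a_subset[OF ideal.axioms(1)[OF I]] by (auto simp: indexed_pset_empty)
      then show "f \<in> Idl\<^bsub>?P\<^esub> ?A" using sub f by auto
    qed
    moreover have "?A \<subseteq> I" using A(3) genideal_self[OF A(1)] by auto
    then have "Idl\<^bsub>?P\<^esub> ?A \<subseteq> I" by (rule P.genideal_minimal[OF I])
    ultimately show "\<exists>A\<subseteq>carrier ?P. finite A \<and> I = Idl\<^bsub>?P\<^esub> A"
      using Ac A(2) by blast
  qed
qed

lemma (in noetherian_cring) noetherian_indexed_poly_ring:
  assumes "finite W"
  shows "noetherian_cring (indexed_poly_ring R W D)"
proof -
  have "noetherian_ring (indexed_poly_ring R W D)"
    using assms
  proof (induction W)
    case (insert v W)
    interpret E: poly_extension "indexed_poly_ring R (insert v W) D" "indexed_pset W (carrier R)"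
      "indexed_var v" "var_coef v" by (rule indexed_poly_extension) fact
    show ?case by (rule E.hilbert_basis) (use insert.IH in simp)
  qed (rule noetherian_indexed_poly_empty)
  then show ?thesis using indexed_poly_cring by (simp add: noetherian_cring_def)
qed

text \<open>The order in which \<open>x\<close> lists the variables fixes the truncations:
  \<open>A m\<close> involves the first m of them, and \<open>A 0\<close> is the copy of
  \<open>R\<close> formed by the constants.\<close>

locale poly_tower = cring R for R (structure) +
  fixes x :: "nat \<Rightarrow> 'v" and D :: "(('v multiset \<Rightarrow> 'a) \<Rightarrow> 'v multiset \<Rightarrow> 'a) list"
  assumes inj_x: "inj x"
begin

abbreviation "S \<equiv> indexed_poly_ring R (range x) D"
abbreviation "T m \<equiv> indexed_pset (x ` {..<m}) (carrier R)"
abbreviation "A m \<equiv> indexed_poly_ring R (x ` {..<m}) D"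

lemma extension: "poly_extension (A (Suc m)) (T m) (indexed_var (x m)) (var_coef (x m))"
proof -
  have "x m \<notin> x ` {..<m}" using inj_x by (auto dest: injD)
  from indexed_poly_extension[OF this] show ?thesis by (simp add: lessThan_Suc)
qed

lemma T_mono: "m \<le> m' \<Longrightarrow> T m \<subseteq> T m'"
  by (intro pset_mono) auto

lemma T_subset: "T m \<subseteq> carrier S"
  by (simp add: pset_mono image_mono)

lemma ex_T: 
  assumes "f \<in> carrier S"
  shows "\<exists>m. f \<in> T m"
proof -
  have f: "carrier_coeff f" "finite (psupp f)" "\<And>M. M \<in> psupp f \<Longrightarrow> set_mset M \<subseteq> range x"
    using assms unfolding indexed_poly_ring_simps indexed_pset_iff by auto
  let ?B = "\<Union>M\<in>psupp f. set_mset M"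
  have "finite ?B" using f(2) by simp
  moreover have "?B \<subseteq> range x" using f(3) by blast
  ultimately obtain C where C: "finite C" "?B = x ` C" by (meson finite_subset_image)
  obtain m where "C \<subseteq> {..<m}" using C(1) finite_nat_iff_bounded by blast
  then have "\<forall>M\<in>psupp f. set_mset M \<subseteq> x ` {..<m}" using C(2) by blast
  then show ?thesis using f(1,2) by (auto simp: indexed_pset_iff intro!: exI[of _ m])
qed

lemma tower_prime: "primeideal P S \<Longrightarrow> primeideal (P \<inter> T m) (A m)"
  using cring.contract_prime[OF indexed_poly_cring _ indexed_pset_subring[of "x ` {..<m}" "range x" D], of P]
  by (simp add: image_mono)

text \<open>For prime \<open>P\<close> this expresses without fraction fields that the variable
  satisfies a nonzero polynomial relation over the domain \<open>T m\<close> modulo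
  \<open>P\<close>.\<close>

definition jump :: "('v multiset \<Rightarrow> 'a) set \<Rightarrow> nat \<Rightarrow> bool" where
  "jump P m \<longleftrightarrow> (\<exists>f\<in>P \<inter> T (Suc m). \<exists>i. var_coef (x m) i f \<notin> P)"

abbreviation "jumps P m \<equiv> {j. j < m \<and> jump P j}"

abbreviation "ext m \<equiv> poly_extension.ext (A (Suc m)) (var_coef (x m))"

lemma jump_iff:
  assumes "primeideal P S"
  shows "jump P m \<longleftrightarrow> P \<inter> T (Suc m) \<noteq> ext m (P \<inter> T m)"
proof -
  interpret E: poly_extension "A (Suc m)" "T m" "indexed_var (x m)" "var_coef (x m)" by (rule extension)
  have eq: "P \<inter> T (Suc m) \<inter> T m = P \<inter> T m" using T_mono[of m "Suc m"] by auto
  have sub: "ext m (P \<inter> T m) \<subseteq> P \<inter> T (Suc m)"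
    using E.ext_contract_subset[OF primeideal.axioms(1)[OF tower_prime[OF assms]]] by (simp add: eq)
  have "var_coef (x m) i f \<in> T m" if "f \<in> T (Suc m)" for f i using E.coef_in that by simp
  then have "P \<inter> T (Suc m) \<subseteq> ext m (P \<inter> T m) \<longleftrightarrow> \<not> jump P m"
    by (auto simp: jump_def E.ext_def)
  then show ?thesis using sub by blast
qed

lemma jumps_Suc: "jumps P (Suc m) = (if jump P m then insert m (jumps P m) else jumps P m)"
  by (auto simp: less_Suc_eq)

lemma card_jumps_Suc: "card (jumps P (Suc m)) = card (jumps P m) + (if jump P m then 1 else 0)"
  unfolding jumps_Suc by simp

text \<open>The lower bound for heights. Passing to the next variable extends the whole chain, and
  at a jump the contraction of \<open>P\<close> lies strictly above the extended one, which adds a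
  step.\<close>

lemma ex_prime_chain_jumps:
  assumes "primeideal P S"
  shows "\<exists>Q. prime_chain (A m) (card (jumps P m)) (P \<inter> T m) Q"
proof (induction m)
  case 0
  show ?case using prime_chain_refl[OF tower_prime[OF assms, of 0]] by auto
next
  case (Suc m)
  interpret E: poly_extension "A (Suc m)" "T m" "indexed_var (x m)" "var_coef (x m)" by (rule extension)
  from Suc obtain Q where "prime_chain (A m) (card (jumps P m)) (P \<inter> T m) Q" by blast
  then have ch: "prime_chain (A (Suc m)) (card (jumps P m)) (ext m (P \<inter> T m)) (ext m Q)"
    using E.prime_chain_ext by simp
  have sub: "ext m (P \<inter> T m) \<subseteq> P \<inter> T (Suc m)"
    using E.ext_contract_subset[OF primeideal.axioms(1)[OF tower_prime[OF assms]]] T_mono[of m "Suc m"]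
    by (simp add: Int_assoc Int_absorb1)
  show ?case
  proof (cases "jump P m")
    case True
    then have "ext m (P \<inter> T m) \<subset> P \<inter> T (Suc m)" using sub jump_iff[OF assms] by blast
    from prime_chain_step[OF tower_prime[OF assms] this ch] show ?thesis
      using True unfolding card_jumps_Suc by auto
  next
    case False
    then show ?thesis using ch jump_iff[OF assms, of m] unfolding card_jumps_Suc by auto
  qed
qed

text \<open>The upper bound for heights, in the form that feeds the height theorem: a jump adds at
  most one polynomial to the set over which the contraction of \<open>P\<close> is minimal.\<close>

lemma minimal_prime_over_tower:
  assumes P: "primeideal P S" and F0: "finite F0" "minimal_prime_over (A 0) F0 (P \<inter> T 0)"
  shows "\<exists>F. finite F \<and> card F \<le> card F0 + card (jumps P m) \<and> minimal_prime_over (A m) F (P \<inter> T m)"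
proof (induction m)
  case 0
  then show ?case using F0 by auto
next
  case (Suc m)
  interpret E: poly_extension "A (Suc m)" "T m" "indexed_var (x m)" "var_coef (x m)" by (rule extension)
  from Suc obtain F where F: "finite F" "card F \<le> card F0 + card (jumps P m)"
    "minimal_prime_over (A m) F (P \<inter> T m)" by blast
  have eq: "P \<inter> T (Suc m) \<inter> T m = P \<inter> T m" using T_mono[of m "Suc m"] by auto
  from E.minimal_prime_over_extension[OF tower_prime[OF P], of F] F(3)
  consider "minimal_prime_over (A (Suc m)) F (P \<inter> T (Suc m))"
    | f where "jump P m" "minimal_prime_over (A (Suc m)) (insert f F) (P \<inter> T (Suc m))"
    using jump_iff[OF P, of m] by (auto simp: eq)
  then show ?case
  proof cases
    case 1
    then show ?thesis using F unfolding card_jumps_Suc by (intro exI[of _ F]) auto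
  next
    case 2
    have "card (insert f F) \<le> card F + 1" using F(1) by (simp add: card_insert_if)
    then show ?thesis using F 2 unfolding card_jumps_Suc by (intro exI[of _ "insert f F"]) auto
  qed
qed

end

section \<open>Comparing the jumps of two primes\<close>

locale noetherian_tower = poly_tower R x D + noetherian_cring R for R (structure) and x D
begin

text \<open>\<open>N\<close> is the number of chosen generators of the contraction of
  \<open>P\<close> to \<open>T 0\<close>, hence independent of m. The given chain is prolonged below
  \<open>P'\<close> by the chain that the jumps of \<open>P'\<close> provide, and the height theorem
  at \<open>P\<close> bounds the total length.\<close>

lemma jumps_le:
  assumes P: "primeideal P S"
  obtains N where "\<And>m k P'. \<lbrakk>primeideal P' S; prime_chain (A m) k (P \<inter> T m) (P' \<inter> T m)\<rbrakk>
    \<Longrightarrow> k + card (jumps P' m) \<le> N + card (jumps P m)"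
proof -
  interpret A0: noetherian_cring "A 0" by (rule noetherian_indexed_poly_ring) simp
  have P0: "primeideal (P \<inter> T 0) (A 0)" by (rule tower_prime[OF P])
  obtain F0 where F0: "F0 \<subseteq> carrier (A 0)" "finite F0" "P \<inter> T 0 = Idl\<^bsub>A 0\<^esub> F0"
    using A0.finetely_gen[OF primeideal.axioms(1)[OF P0]] by blast
  have "minimal_prime_over (A 0) F0 (P \<inter> T 0)"
    unfolding minimal_prime_over_def
  proof (intro conjI allI impI P0)
    show "F0 \<subseteq> P \<inter> T 0" using A0.genideal_self[OF F0(1)] F0(3) by simp
    fix Q assume Q: "primeideal Q (A 0) \<and> F0 \<subseteq> Q \<and> Q \<subseteq> P \<inter> T 0"
    then have "P \<inter> T 0 \<subseteq> Q"
      unfolding F0(3) by (intro A0.genideal_minimal primeideal.axioms(1)) auto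
    then show "Q = P \<inter> T 0" using Q by blast
  qed
  note up = minimal_prime_over_tower[OF P F0(2) this]
  have "k + card (jumps P' m) \<le> card F0 + card (jumps P m)"
    if P': "primeideal P' S" and ch: "prime_chain (A m) k (P \<inter> T m) (P' \<inter> T m)" for m k P'
  proof -
    interpret Am: noetherian_cring "A m" by (rule noetherian_indexed_poly_ring) simp
    obtain F where F: "finite F" "card F \<le> card F0 + card (jumps P m)"
      "minimal_prime_over (A m) F (P \<inter> T m)" using up by blast
    obtain Q where "prime_chain (A m) (card (jumps P' m)) (P' \<inter> T m) Q"
      using ex_prime_chain_jumps[OF P'] by blast
    then have ch2: "prime_chain (A m) (k + card (jumps P' m)) (P \<inter> T m) Q"
      by (rule prime_chain_trans[OF ch])
    then have "Q \<subseteq> P \<inter> T m" using prime_chain_prime by blast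
    then have "minimal_prime_over (A m) (Q \<union> F) (P \<inter> T m)"
      using F(3) unfolding minimal_prime_over_def by blast
    moreover have "F \<subseteq> carrier (A m)" using F(3) unfolding minimal_prime_over_def by auto
    ultimately show ?thesis using Am.height_theorem[OF F(1) _ _ ch2] F(2) by fastforce
  qed
  then show ?thesis using that by blast
qed

text \<open>A witness of a strict inclusion involves finitely many variables, so k steps of the
  chain remain strict in all large truncations. As \<open>N\<close> does not depend on k, the
  difference of the two counts eventually exceeds every bound.\<close>

lemma jumps_le_chain:
  assumes "\<And>i. primeideal (c i) S" "\<And>i. c (Suc i) \<subset> c i"
    and P': "primeideal P' S" "\<And>i. P' \<subseteq> c i"
  obtains N where "\<And>k. \<exists>m0. \<forall>m\<ge>m0. k + card (jumps P' m) \<le> N + card (jumps (c 0) m)"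
proof -
  obtain N where N: "\<And>m k P'. \<lbrakk>primeideal P' S; prime_chain (A m) k (c 0 \<inter> T m) (P' \<inter> T m)\<rbrakk>
    \<Longrightarrow> k + card (jumps P' m) \<le> N + card (jumps (c 0) m)"
    using jumps_le[OF assms(1)] by blast
  have "\<exists>m0. \<forall>m\<ge>m0. prime_chain (A m) k (c i \<inter> T m) (c (i + k) \<inter> T m)" for i k
  proof (induction k arbitrary: i)
    case 0
    show ?case using prime_chain_refl[OF tower_prime[OF assms(1)]] by simp
  next
    case (Suc k)
    obtain m0 where m0: "\<And>m. m \<ge> m0 \<Longrightarrow> prime_chain (A m) k (c (Suc i) \<inter> T m) (c (Suc i + k) \<inter> T m)"
      using Suc.IH by blast
    obtain f where f: "f \<in> c i" "f \<notin> c (Suc i)" using assms(2) by blast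
    have "f \<in> carrier S" using f assms(1) by (meson ideal.Icarr primeideal.axioms(1))
    then obtain m1 where m1: "f \<in> T m1" using ex_T by blast
    have "prime_chain (A m) (Suc k) (c i \<inter> T m) (c (i + Suc k) \<inter> T m)" if "m \<ge> max m0 m1" for m
    proof -
      have "f \<in> T m" using m1 T_mono[of m1 m] that by auto
      then have "c (Suc i) \<inter> T m \<subset> c i \<inter> T m" using f assms(2)[of i] by blast
      from prime_chain_step[OF tower_prime[OF assms(1)] this m0] that show ?thesis by simp
    qed
    then show ?case by blast
  qed
  from this[of _ 0] have ch: "\<exists>m0. \<forall>m\<ge>m0. prime_chain (A m) k (c 0 \<inter> T m) (c k \<inter> T m)" for k by simp
  have "\<exists>m0. \<forall>m\<ge>m0. k + card (jumps P' m) \<le> N + card (jumps (c 0) m)" for k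
  proof -
    obtain m0 where m0: "\<And>m. m \<ge> m0 \<Longrightarrow> prime_chain (A m) k (c 0 \<inter> T m) (c k \<inter> T m)" using ch by blast
    have "k + card (jumps P' m) \<le> N + card (jumps (c 0) m)" if "m \<ge> m0" for m
    proof -
      obtain Q where Q: "prime_chain (A m) (card (jumps P' m)) (P' \<inter> T m) Q"
        using ex_prime_chain_jumps[OF P'(1)] by blast
      show ?thesis
      \<comment> \<open>From \<open>c k\<close> one further step leads to \<open>P'\<close>, unless
        the two already agree in this truncation.\<close>
      proof (cases "c k \<inter> T m = P' \<inter> T m")
        case True
        then show ?thesis using m0[OF that] N[OF P'(1)] by simp
      next
        case False
        then have "P' \<inter> T m \<subset> c k \<inter> T m" using P'(2)[of k] by blast
        then have "prime_chain (A m) 1 (c k \<inter> T m) (P' \<inter> T m)"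
          using prime_chain_step[OF tower_prime[OF assms(1)] _ prime_chain_refl[OF tower_prime[OF P'(1)]]]
          by simp
        from prime_chain_trans[OF m0[OF that] this] show ?thesis
          using N[OF P'(1)] by fastforce
      qed
    qed
    then show ?thesis by blast
  qed
  then show ?thesis using that by blast
qed

end

section \<open>Differential polynomials in one derivation\<close>

definition (in cring) var_pderiv :: "'v \<Rightarrow> ('v multiset \<Rightarrow> 'a) \<Rightarrow> 'v multiset \<Rightarrow> 'a" where
  "var_pderiv v f = (\<lambda>M. [Suc (count M v)] \<cdot> f (add_mset v M))"

context cring
begin

lemma var_pderiv_closed:
  assumes f: "f \<in> indexed_pset W (carrier R)"
  shows "var_pderiv v f \<in> indexed_pset W (carrier R)"
proof -
  have c: "carrier_coeff f" "finite (psupp f)" "\<And>M. M \<in> psupp f \<Longrightarrow> set_mset M \<subseteq> W"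
    using f unfolding indexed_pset_iff by auto
  have sub: "add_mset v M \<in> psupp f" if "M \<in> psupp (var_pderiv v f)" for M
    using that by (auto simp: var_pderiv_def)
  have "psupp (var_pderiv v f) \<subseteq> (\<lambda>M. M - {#v#}) ` psupp f"
  proof
    fix M assume "M \<in> psupp (var_pderiv v f)"
    from sub[OF this] show "M \<in> (\<lambda>M. M - {#v#}) ` psupp f" by (rule rev_image_eqI) simp
  qed
  then have "finite (psupp (var_pderiv v f))" using c(2) by (meson finite_imageI finite_subset)
  moreover have "set_mset M \<subseteq> W" if "M \<in> psupp (var_pderiv v f)" for M
    using c(3)[OF sub[OF that]] by simp
  moreover have "carrier_coeff (var_pderiv v f)"
    using c(1) by (simp add: carrier_coeff_def var_pderiv_def)
  ultimately show ?thesis unfolding indexed_pset_iff by blast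
qed

text \<open>The integer factor appears as multiplication by a constant polynomial, so that primality
  can later separate it from the coefficient.\<close>

lemma var_coef_pderiv:
  assumes f: "carrier_coeff f"
  shows "var_coef v i (var_pderiv v f) =
    indexed_mult R (indexed_const ([Suc i] \<cdot> \<one>)) (var_coef v (Suc i) f)"
proof -
  have fc: "f M \<in> carrier R" for M using f by (simp add: carrier_coeff_def)
  have "carrier_coeff (var_coef v (Suc i) f)" using fc by (simp add: carrier_coeff_def var_coef_def)
  from indexed_mult_const[OF _ this, of "[Suc i] \<cdot> \<one>"]
  have "indexed_mult R (indexed_const ([Suc i] \<cdot> \<one>)) (var_coef v (Suc i) f) =
    (\<lambda>M. [Suc i] \<cdot> \<one> \<otimes> var_coef v (Suc i) f M)" by simp
  also have "\<dots> = var_coef v i (var_pderiv v f)"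
  proof
    fix M
    have "[Suc i] \<cdot> \<one> \<otimes> f N = [Suc i] \<cdot> f N" for N
      using add_pow_ldistr[OF one_closed fc, of "Suc i" N] fc by simp
    then show "[Suc i] \<cdot> \<one> \<otimes> var_coef v (Suc i) f M = var_coef v i (var_pderiv v f) M"
      by (cases "v \<in># M")
        (simp_all add: var_coef_def var_pderiv_def count_eq_zero_iff[THEN iffD2] del: add.nat_pow_Suc)
  qed
  finally show ?thesis ..
qed

end

context differential_ring
begin

lemma indexed_deriv_in_pset:
  fixes s :: "'v \<Rightarrow> 'v"
  assumes d: "d \<in> set (derivs R)" and s: "inj s" and f: "f \<in> indexed_pset W (carrier R)"
  shows "indexed_deriv R d s f \<in> indexed_pset (W \<union> s ` W) (carrier R)"
proof -
  have c: "carrier_coeff f" "finite (psupp f)" "\<And>M. M \<in> psupp f \<Longrightarrow> set_mset M \<subseteq> W"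
    using f unfolding indexed_pset_iff by auto
  have fc: "f M \<in> carrier R" for M using c(1) by (simp add: carrier_coeff_def)
  have "carrier_coeff (indexed_deriv R d s f)"
    unfolding carrier_coeff_def indexed_deriv_def
    by (intro allI a_closed deriv_closed[OF d] finsum_closed) (auto simp: fc Let_def)
  moreover define B where "B = psupp f \<union> (\<Union>N\<in>psupp f. (\<lambda>v. add_mset (s v) (N - {#v#})) ` set_mset N)"
  have sub: "psupp (indexed_deriv R d s f) \<subseteq> B"
  proof
    fix M assume M: "M \<in> psupp (indexed_deriv R d s f)"
    show "M \<in> B"
    proof (rule ccontr)
      assume "M \<notin> B"
      then have "f M = \<zero>" by (auto simp: B_def)
      moreover have "f (add_mset v (M - {#s v#})) = \<zero>" if "s v \<in># M" for v
      proof (rule ccontr)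
        assume "f (add_mset v (M - {#s v#})) \<noteq> \<zero>"
        moreover have "M = add_mset (s v) (add_mset v (M - {#s v#}) - {#v#})" using that by simp
        ultimately have "M \<in> B" unfolding B_def by fastforce
        then show False using \<open>M \<notin> B\<close> by simp
      qed
      then have "(\<Oplus>v\<in>{v. s v \<in># M}. let N = add_mset v (M - {#s v#}) in [count N v] \<cdot> f N) =
          (\<Oplus>v\<in>{v. s v \<in># M}. \<zero>)"
        by (intro finsum_cong') (auto simp: Let_def)
      ultimately show False using M deriv_zero[OF d] by (simp add: indexed_deriv_def)
    qed
  qed
  moreover have "finite B" unfolding B_def using c(2) by simp
  moreover have "set_mset M \<subseteq> W \<union> s ` W" if "M \<in> B" for M
    using that c(3) unfolding B_def by (auto dest!: in_diffD split: if_splits) blast+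
  ultimately show ?thesis unfolding indexed_pset_iff using finite_subset by blast
qed

text \<open>The variable \<open>s v\<close> does not occur in \<open>f\<close>, and \<open>s\<close>
  is injective; so \<open>s v\<close> enters the derived polynomial only by differentiating
  \<open>v\<close>, and the chain rule makes its coefficient the partial derivative.\<close>

lemma var_coef_indexed_deriv:
  fixes s :: "'v \<Rightarrow> 'v"
  assumes d: "d \<in> set (derivs R)" and s: "inj s" and f: "f \<in> indexed_pset W (carrier R)"
    and v: "s v \<notin> W"
  shows "var_coef (s v) 1 (indexed_deriv R d s f) = var_pderiv v f"
proof
  fix M :: "'v multiset"
  have f0: "f N = \<zero>" if "s v \<in># N" for N using f v that by (auto simp: indexed_pset_iff)
  have fc: "f M \<in> carrier R" for M using f by simp
  show "var_coef (s v) 1 (indexed_deriv R d s f) M = var_pderiv v f M"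
  proof (cases "s v \<in># M")
    case True
    then show ?thesis using f0[of "add_mset v M"] by (simp add: var_coef_def var_pderiv_def)
  next
    case False
    let ?M = "add_mset (s v) M"
    let ?t = "\<lambda>w. let N = add_mset w (?M - {#s w#}) in [count N w] \<cdot> f N"
    have fin: "finite {w. s w \<in># ?M}"
      using finite_vimageI[OF finite_set_mset s, of ?M] by (simp add: vimage_def)
    have "(\<Oplus>w\<in>{w. s w \<in># ?M}. ?t w) = (\<Oplus>w\<in>{w. s w \<in># ?M}. if v = w then ?t v else \<zero>)"
    proof (rule finsum_cong')
      fix w assume w: "w \<in> {w. s w \<in># ?M}"
      show "?t w = (if v = w then ?t v else \<zero>)"
      proof (cases "v = w")
        case False
        then have "s w \<noteq> s v" using s by (auto dest: injD)
        then have "f (add_mset w (?M - {#s w#})) = \<zero>" by (intro f0) simp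
        then show ?thesis using False by (simp add: Let_def)
      qed simp
    qed (auto simp: fc Let_def)
    also have "\<dots> = ?t v"
      using add.finprod_singleton[OF _ fin, of v "\<lambda>_. ?t v"] by (simp add: fc Let_def)
    also have "\<dots> = var_pderiv v f M" by (simp add: var_pderiv_def Let_def)
    finally show ?thesis
      using False f0[of ?M] fc deriv_zero[OF d]
      by (simp add: var_coef_def indexed_deriv_def var_pderiv_def)
  qed
qed

end

text \<open>Indeterminates are numbered from 1, hence the \<open>+ 1\<close>, and the only
  derivation has number 0. Listing by order makes differentiation the map j -> j + n on
  indices.\<close>

definition dvar :: "nat \<Rightarrow> nat \<Rightarrow> diff_var" where
  "dvar n j = (j mod n + 1, replicate_mset (j div n) 0)"

lemma inj_dvar: "inj (dvar n)"
proof (rule injI)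
  fix i j assume "dvar n i = dvar n j"
  then have "i mod n = j mod n" "size (snd (dvar n i)) = size (snd (dvar n j))" by (simp_all add: dvar_def)
  then have "i mod n = j mod n" "i div n = j div n" by (simp_all add: dvar_def)
  then show "i = j" by (metis mult_div_mod_eq)
qed

lemma range_dvar:
  assumes "n > 0"
  shows "range (dvar n) = diff_vars 1 n"
proof
  show "range (dvar n) \<subseteq> diff_vars 1 n"
    using assms by (auto simp: dvar_def diff_vars_def Suc_le_eq split: if_splits)
  show "diff_vars 1 n \<subseteq> range (dvar n)"
  proof
    fix p assume "p \<in> diff_vars 1 n"
    then obtain i \<theta> where p: "p = (i, \<theta>)" "1 \<le> i" "i \<le> n" "set_mset \<theta> \<subseteq> {0}"
      by (auto simp: diff_vars_def)
    obtain k where "\<theta> = replicate_mset k 0" 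
      using set_mset_subset_singletonD[OF p(4)] by (rule that)
    moreover obtain i' where "i = Suc i'" using p(2) by (cases i) auto
    ultimately have "p = dvar n (i' + n * k)" using p(1,3) by (simp add: dvar_def)
    then show "p \<in> range (dvar n)" by simp
  qed
qed

lemma shift_dvar: "n > 0 \<Longrightarrow> diff_var_shift 0 (dvar n j) = dvar n (j + n)"
  by (simp add: dvar_def diff_var_shift_def)

text \<open>Assumption \<open>char_zero\<close> is standardness in elementwise form; it will be
  applied to contractions of differential primes of the polynomial ring.\<close>

locale ordinary_diff_poly = differential_ring R + noetherian_ring R for R (structure) +
  fixes d :: "'a \<Rightarrow> 'a" and n :: nat
  assumes derivs: "derivs R = [d]" and n: "n > 0"
    and char_zero: "\<And>Q k. \<lbrakk>Q \<in> diff_spec R; 0 < (k::nat)\<rbrakk> \<Longrightarrow> [k] \<cdot> \<one> \<notin> Q"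
begin

abbreviation "\<delta> \<equiv> indexed_deriv R d (diff_var_shift 0)"

sublocale noetherian_tower R "dvar n" "[\<delta>]"
  by unfold_locales (rule inj_dvar)

lemma diff_poly_ring: "diff_poly_ring R n = S"
  using derivs range_dvar[OF n] by (simp add: diff_poly_ring_eq)

lemma d: "d \<in> set (derivs R)" using derivs by simp

lemma diff_spec_S_iff: "P \<in> diff_spec S \<longleftrightarrow> primeideal P S \<and> (\<forall>f\<in>P. \<delta> f \<in> P)"
  by (auto simp: diff_spec_def diff_ideal_def primeideal.axioms(1))

lemma contract_diff_spec:
  assumes "P \<in> diff_spec S"
  shows "{a \<in> carrier R. indexed_const a \<in> P} \<in> diff_spec R"
proof -
  have P: "primeideal P S" "\<And>f. f \<in> P \<Longrightarrow> \<delta> f \<in> P" using assms by (auto simp: diff_spec_S_iff)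
  have "primeideal {a \<in> carrier R. indexed_const a \<in> P} R" by (rule indexed_const_contract_prime[OF P(1)])
  moreover have "indexed_const (d a) \<in> P" if "a \<in> carrier R" "indexed_const a \<in> P" for a
    using P(2)[OF that(2)] indexed_deriv_const[OF d that(1), of "diff_var_shift 0"] by simp
  ultimately show ?thesis
    using deriv_closed[OF d] derivs by (auto simp: diff_spec_def diff_ideal_def primeideal.axioms(1))
qed

text \<open>The witness is taken of least degree in the variable of index \<open>j\<close>. Its
  partial derivative has smaller degree but a leading coefficient outside \<open>P\<close>, so by
  minimality it is outside \<open>P\<close>; and it is the coefficient of the variable of index
  \<open>j + n\<close> in the derivative of the witness.\<close>

lemma jump_shift:
  assumes P: "P \<in> diff_spec S" and j: "jump P j"
  shows "jump P (j + n)"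
proof -
  have pr: "primeideal P S" and dP: "\<And>f. f \<in> P \<Longrightarrow> \<delta> f \<in> P" using P by (auto simp: diff_spec_S_iff)
  let ?v = "dvar n j" and ?s = "diff_var_shift 0"
  interpret E: poly_extension "A (Suc j)" "T j" "indexed_var ?v" "var_coef ?v" by (rule extension)
  note P1 = tower_prime[OF pr, of "Suc j"]
  have eq: "P \<inter> T (Suc j) \<inter> T j = P \<inter> T j" using T_mono[of j "Suc j"] by auto
  have "P \<inter> T (Suc j) \<noteq> E.ext (P \<inter> T (Suc j) \<inter> T j)" using j jump_iff[OF pr] by (simp add: eq)
  then obtain f e where f: "f \<in> P \<inter> T (Suc j)" "E.deg_lt f (Suc e)" "var_coef ?v e f \<notin> P \<inter> T (Suc j)"
    and low: "\<And>g. \<lbrakk>g \<in> P \<inter> T (Suc j); E.deg_lt g e\<rbrakk> \<Longrightarrow> g \<in> E.ext (P \<inter> T (Suc j) \<inter> T j)"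
    using E.ex_minimal_lead[OF primeideal.axioms(1)[OF P1]] by blast
  have fT: "f \<in> T (Suc j)" using f(1) by blast
  have coefT: "var_coef ?v i g \<in> T (Suc j)" if "g \<in> T (Suc j)" for i g
    using E.coef_in[of g i] that T_mono[of j "Suc j"] by auto
  have lead: "var_coef ?v e f \<notin> P" using f(3) coefT[OF fT] by blast
  \<comment> \<open>A witness of degree 0 would equal its own leading coefficient, which is outside
    \<open>P\<close>.\<close>
  have "e \<noteq> 0"
  proof
    assume e: "e = 0"
    let ?c = "var_coef ?v 0 f"
    have c: "?c \<in> T j" using E.coef_in fT by simp
    have co: "var_coef ?v i ?c = var_coef ?v i f" for i
      using f(2) e E.coef_const[OF c, of i] by (cases i) (auto simp: E.deg_lt_def)
    have fc: "f \<in> carrier (A (Suc j))" and cc: "?c \<in> carrier (A (Suc j))"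
      using fT coefT[OF fT] by simp_all
    have "var_coef ?v i (f \<ominus>\<^bsub>A (Suc j)\<^esub> ?c) = \<zero>\<^bsub>A (Suc j)\<^esub>" for i
      unfolding E.coef_minus[OF fc cc] co using E.r_right_minus_eq E.coef_closed[OF fc] by blast
    then have "E.deg_lt (f \<ominus>\<^bsub>A (Suc j)\<^esub> ?c) 0" unfolding E.deg_lt_def by blast
    then have "f \<ominus>\<^bsub>A (Suc j)\<^esub> ?c = \<zero>\<^bsub>A (Suc j)\<^esub>"
      using E.deg_lt_0[OF E.minus_closed[OF fc cc]] by blast
    then have "f = ?c" using E.r_right_minus_eq[OF fc cc] by blast
    then show False using lead f(1) e by auto
  qed
  then obtain e' where e: "e = Suc e'" by (cases e) auto
  let ?g = "var_pderiv ?v f"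
  have gT: "?g \<in> T (Suc j)" by (rule var_pderiv_closed[OF fT])
  have coef_g: "var_coef ?v i ?g = indexed_mult R (indexed_const ([Suc i] \<cdot> \<one>)) (var_coef ?v (Suc i) f)" for i
    by (rule var_coef_pderiv[OF carrier_coeff_pset[OF fT]])
  \<comment> \<open>This coefficient is the integer \<open>e\<close> times the leading coefficient
    of \<open>f\<close>. Neither factor lies in \<open>P\<close>, the integer because the
    contraction of \<open>P\<close> to \<open>R\<close> is a differential prime.\<close>
  have "var_coef ?v e' ?g \<notin> P"
  proof
    assume "var_coef ?v e' ?g \<in> P"
    moreover have "indexed_const ([Suc e'] \<cdot> \<one>) \<in> carrier S" by (auto intro: indexed_const_pset)
    moreover have "var_coef ?v e f \<in> carrier S" using coefT[OF fT] T_subset by blast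
    ultimately have "indexed_const ([Suc e'] \<cdot> \<one>) \<in> P"
      using primeideal.I_prime[OF pr, of "indexed_const ([Suc e'] \<cdot> \<one>)" "var_coef ?v e f"] lead
      by (simp add: coef_g e del: add.nat_pow_Suc)
    then show False using char_zero[OF contract_diff_spec[OF P], of "Suc e'"] by simp
  qed
  moreover have "E.deg_lt ?g e"
    unfolding E.deg_lt_def
  proof (intro allI impI)
    fix i assume "e \<le> i"
    then have z: "var_coef ?v (Suc i) f = indexed_const \<zero>" using f(2) by (simp add: E.deg_lt_def)
    show "var_coef ?v i ?g = \<zero>\<^bsub>A (Suc j)\<^esub>"
      unfolding coef_g z by (subst indexed_const_hom) auto
  qed
  ultimately have g: "?g \<notin> P" using low[of ?g] gT by (auto simp: E.ext_def eq)
  have "\<delta> f \<in> T (Suc (j + n))"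
  proof -
    have "\<delta> f \<in> indexed_pset (dvar n ` {..<Suc j} \<union> ?s ` dvar n ` {..<Suc j}) (carrier R)"
      by (rule indexed_deriv_in_pset[OF d inj_diff_var_shift fT])
    moreover have "dvar n ` {..<Suc j} \<union> ?s ` dvar n ` {..<Suc j} \<subseteq> dvar n ` {..<Suc (j + n)}"
      using n by (auto simp: shift_dvar)
    ultimately show ?thesis using pset_mono by blast
  qed
  moreover have "\<delta> f \<in> P" using dP f(1) by blast
  moreover have "var_coef (dvar n (j + n)) 1 (\<delta> f) = ?g"
  proof -
    have "?s ?v \<notin> dvar n ` {..<Suc j}"
      using n inj_dvar[of n] by (auto simp: shift_dvar dest: injD)
    from var_coef_indexed_deriv[OF d inj_diff_var_shift fT this] show ?thesis
      using n by (simp add: shift_dvar)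
  qed
  ultimately show ?thesis using g unfolding jump_def by (metis IntI)
qed

section \<open>Counting jumps by residue classes\<close>

definition jump_classes :: "(diff_var multiset \<Rightarrow> 'a) set \<Rightarrow> nat set" where
  "jump_classes P = {i. i < n \<and> (\<exists>r. jump P (i + n * r))}"

lemma finite_jump_classes[simp]: "finite (jump_classes P)"
  by (simp add: jump_classes_def)

lemma card_jump_classes_le: "card (jump_classes P) \<le> n"
proof -
  have "jump_classes P \<subseteq> {..<n}" by (auto simp: jump_classes_def)
  from card_mono[OF _ this] show ?thesis by simp
qed

text \<open>An index is determined by its residue and its quotient modulo \<open>n\<close>. The
  residue of a jump is a jump class, and below \<open>n * r\<close> there are \<open>r\<close>
  quotients.\<close>

lemma card_jumps_upper: "card (jumps P (n * r)) \<le> card (jump_classes P) * r"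
proof -
  have "inj_on (\<lambda>j. (j mod n, j div n)) (jumps P (n * r))"
    by (auto intro!: inj_onI) (metis mult_div_mod_eq)
  moreover have "(\<lambda>j. (j mod n, j div n)) ` jumps P (n * r) \<subseteq> jump_classes P \<times> {..<r}"
  proof
    fix y assume "y \<in> (\<lambda>j. (j mod n, j div n)) ` jumps P (n * r)"
    then obtain j where j: "y = (j mod n, j div n)" "j < n * r" "jump P j" by blast
    have "j mod n \<in> jump_classes P"
      unfolding jump_classes_def using n j(3) by (intro CollectI conjI exI[of _ "j div n"]) simp_all
    moreover have "j div n < r" using j(2) n by (simp add: div_less_iff_less_mult mult.commute)
    ultimately show "y \<in> jump_classes P \<times> {..<r}" using j(1) by simp
  qed
  ultimately have "card (jumps P (n * r)) \<le> card (jump_classes P \<times> {..<r})"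
    by (intro card_inj_on_le) auto
  then show ?thesis by (simp add: card_cartesian_product)
qed

lemma jump_shift_iterate:
  assumes "P \<in> diff_spec S" "jump P (i + n * r)" "r \<le> r'"
  shows "jump P (i + n * r')"
  using assms(3)
proof (induction r' rule: dec_induct)
  case (step q)
  from jump_shift[OF assms(1) step.IH] show ?case by (simp add: algebra_simps)
qed (rule assms(2))

text \<open>Differentiation turns a jump into jumps at all later indices of its class, so from
  quotient \<open>r0\<close> on every jump class is filled completely.\<close>

lemma card_jumps_lower:
  assumes "P \<in> diff_spec S"
  obtains r0 where "\<And>r. card (jump_classes P) * (r - r0) \<le> card (jumps P (n * r))"
proof -
  have "\<forall>i\<in>jump_classes P. \<exists>r. jump P (i + n * r)" by (auto simp: jump_classes_def)
  from bchoice[OF this] obtain q where q: "\<And>i. i \<in> jump_classes P \<Longrightarrow> jump P (i + n * q i)" by blast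
  \<comment> \<open>Any common bound for the starting points \<open>q i\<close> would do; the sum is
    one, also when there are no classes.\<close>
  define r0 where "r0 = (\<Sum>i\<in>jump_classes P. q i)"
  have q_le: "q i \<le> r0" if "i \<in> jump_classes P" for i
    unfolding r0_def using member_le_sum[OF that, of q] by simp
  have "card (jump_classes P) * (r - r0) \<le> card (jumps P (n * r))" for r
  proof -
    let ?f = "\<lambda>(i, k). i + n * k"
    have "inj_on ?f (jump_classes P \<times> {r0..<r})"
    proof (rule inj_onI, clarify)
      fix i k i' k'
      assume "i \<in> jump_classes P" "i' \<in> jump_classes P" and eq: "i + n * k = i' + n * k'"
      then have lt: "i < n" "i' < n" by (auto simp: jump_classes_def)
      from arg_cong[OF eq, of "\<lambda>j. j mod n"] lt have "i = i'" by simp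
      then show "i = i' \<and> k = k'" using eq n by simp
    qed
    moreover have "?f ` (jump_classes P \<times> {r0..<r}) \<subseteq> jumps P (n * r)"
    proof clarify
      fix i k assume i: "i \<in> jump_classes P" and k: "k \<in> {r0..<r}"
      have "i < n" using i by (auto simp: jump_classes_def)
      moreover have "n * Suc k \<le> n * r" using k by (intro mult_le_mono2) auto
      ultimately have "i + n * k < n * r" by simp
      moreover have "jump P (i + n * k)"
        using jump_shift_iterate[OF assms q[OF i], of k] q_le[OF i] k by simp
      ultimately show "i + n * k < n * r \<and> jump P (i + n * k)" ..
    qed
    ultimately have "card (jump_classes P \<times> {r0..<r}) \<le> card (jumps P (n * r))"
      by (intro card_inj_on_le) auto
    then show ?thesis by (simp add: card_cartesian_product)
  qed
  then show ?thesis using that by blast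
qed

lemma jump_classes_less:
  assumes ch: "descending_chain (diff_spec S) P P' c" and P': "P' \<in> diff_spec S"
  shows "card (jump_classes P') < card (jump_classes P)"
proof -
  have c: "c 0 = P" "\<And>i. c i \<in> diff_spec S" "\<And>i. P' \<subseteq> c i" "\<And>i. c (Suc i) \<subset> c i"
    using ch by (auto simp: descending_chain_def)
  obtain N where N: "\<And>k. \<exists>m0. \<forall>m\<ge>m0. k + card (jumps P' m) \<le> N + card (jumps (c 0) m)"
    by (rule jumps_le_chain[of c P']) (use c P' diff_spec_S_iff in blast)+
  obtain r0 where r0: "\<And>r. card (jump_classes P') * (r - r0) \<le> card (jumps P' (n * r))"
    using card_jumps_lower[OF P'] by blast
  let ?a = "card (jump_classes P)" and ?a' = "card (jump_classes P')"
  \<comment> \<open>The length of chain used here beats the constant \<open>N\<close> and the loss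
    \<open>?a' * r0\<close> in the lower count for \<open>P'\<close>, with 1 to spare for
    strictness.\<close>
  obtain m0 where m0: "\<And>m. m \<ge> m0 \<Longrightarrow>
      (N + ?a' * r0 + 1) + card (jumps P' m) \<le> N + card (jumps P m)"
    using N[of "N + ?a' * r0 + 1"] unfolding c(1) by (elim exE) (rule that, blast)
  \<comment> \<open>With this \<open>r\<close>, the index \<open>n * r\<close> reaches the threshold
    \<open>m0\<close>, and \<open>r - r0\<close> is a genuine difference.\<close>
  define r where "r = m0 + r0"
  have "m0 \<le> n * r" using n by (cases n) (auto simp: r_def)
  from m0[OF this] have "?a' * r0 + 1 + card (jumps P' (n * r)) \<le> card (jumps P (n * r))" by simp
  moreover have "?a' * (r - r0) + ?a' * r0 = ?a' * r" by (simp add: r_def algebra_simps)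
  ultimately have "?a' * r < ?a * r" using r0[of r] card_jumps_upper[of r P] by linarith
  then show ?thesis by simp
qed

end

section \<open>Characteristic of residue fields\<close>

text \<open>The operations of the localization are unions over all pairs of representatives. When
  all contributions agree, the union is their common value, provided that both index sets are
  inhabited.\<close>

lemma UN2_eq_const:
  assumes "(a0, s0) \<in> U" "(b0, t0) \<in> V"
    and "\<And>a s b t. (a, s) \<in> U \<Longrightarrow> (b, t) \<in> V \<Longrightarrow> f a s b t = C"
  shows "(\<Union>(a, s)\<in>U. \<Union>(b, t)\<in>V. f a s b t) = C"
proof -
  have inner: "(\<Union>(b, t)\<in>V. f a s b t) = C" if "(a, s) \<in> U" for a s
  proof -
    have "(\<Union>(b, t)\<in>V. f a s b t) = (\<Union>y\<in>V. C)"
      using assms(3)[OF that] by (intro SUP_cong refl) auto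
    then show ?thesis using assms(2) by auto
  qed
  have "(\<Union>(a, s)\<in>U. \<Union>(b, t)\<in>V. f a s b t) = (\<Union>y\<in>U. C)"
  proof (rule SUP_cong[OF refl])
    fix y assume "y \<in> U"
    then show "(case y of (a, s) \<Rightarrow> \<Union>(b, t)\<in>V. f a s b t) = C"
      using inner by (cases y) (simp only: prod.case)
  qed
  then show ?thesis using assms(1) by auto
qed

locale multiplicative_subset = cring R for R (structure) +
  fixes S :: "'a set"
  assumes S_subset: "S \<subseteq> carrier R" and one_S: "\<one> \<in> S"
    and mult_S: "\<lbrakk>s \<in> S; t \<in> S\<rbrakk> \<Longrightarrow> s \<otimes> t \<in> S"
begin

lemma S_carr: "s \<in> S \<Longrightarrow> s \<in> carrier R" using S_subset by blast

lemma loc_rel_iff: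
  "((a, s), (b, t)) \<in> loc_rel R S \<longleftrightarrow> a \<in> carrier R \<and> b \<in> carrier R \<and> s \<in> S \<and> t \<in> S \<and>
     (\<exists>u\<in>S. u \<otimes> (a \<otimes> t) = u \<otimes> (b \<otimes> s))"
  by (simp add: loc_rel_def)

lemma equiv_loc_rel: "equiv (carrier R \<times> S) (loc_rel R S)"
proof (rule equivI)
  show "loc_rel R S \<subseteq> (carrier R \<times> S) \<times> (carrier R \<times> S)" by (auto simp: loc_rel_def)
  show "refl_on (carrier R \<times> S) (loc_rel R S)"
    using one_S by (auto simp: refl_on_def loc_rel_iff)
  show "sym (loc_rel R S)" by (auto simp: sym_def loc_rel_iff) (metis)
  show "trans (loc_rel R S)"
  proof (rule transI, clarify)
    fix a s b t c r
    assume "((a, s), (b, t)) \<in> loc_rel R S" "((b, t), (c, r)) \<in> loc_rel R S"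
    then obtain u w where h: "a \<in> carrier R" "b \<in> carrier R" "c \<in> carrier R" "s \<in> S" "t \<in> S" "r \<in> S"
      "u \<in> S" "w \<in> S" and e: "u \<otimes> (a \<otimes> t) = u \<otimes> (b \<otimes> s)" "w \<otimes> (b \<otimes> r) = w \<otimes> (c \<otimes> t)"
      by (auto simp: loc_rel_iff)
    have c: "a \<in> carrier R" "b \<in> carrier R" "c \<in> carrier R" "s \<in> carrier R" "t \<in> carrier R" "r \<in> carrier R"
      "u \<in> carrier R" "w \<in> carrier R" using h S_carr by auto
    \<comment> \<open>Besides \<open>u\<close> and \<open>w\<close> the multiplier contains the
      middle denominator \<open>t\<close>, which cannot be cancelled in general.\<close>
    have "(u \<otimes> w \<otimes> t) \<otimes> (a \<otimes> r) = (w \<otimes> r) \<otimes> (u \<otimes> (a \<otimes> t))" using c by algebra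
    also have "\<dots> = (u \<otimes> s) \<otimes> (w \<otimes> (b \<otimes> r))" unfolding e(1) using c by algebra
    also have "\<dots> = (u \<otimes> w \<otimes> t) \<otimes> (c \<otimes> s)" unfolding e(2) using c by algebra
    finally show "((a, s), (c, r)) \<in> loc_rel R S"
      using h mult_S by (auto simp: loc_rel_iff)
  qed
qed

lemma loc_frac_eqI:
  assumes "((a, s), (b, t)) \<in> loc_rel R S"
  shows "loc_frac R S a s = loc_frac R S b t"
  unfolding loc_frac_def by (rule equiv_class_eq[OF equiv_loc_rel assms])

lemma loc_frac_memD: "(b, t) \<in> loc_frac R S a s \<Longrightarrow> ((a, s), (b, t)) \<in> loc_rel R S"
  by (simp add: loc_frac_def)

lemma loc_frac_self: "a \<in> carrier R \<Longrightarrow> s \<in> S \<Longrightarrow> (a, s) \<in> loc_frac R S a s"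
  using one_S by (auto simp: loc_frac_def loc_rel_iff)

abbreviation "L \<equiv> localization R S"

lemma carrier_L: "carrier L = {loc_frac R S a s | a s. a \<in> carrier R \<and> s \<in> S}"
  unfolding localization_def quotient_def loc_frac_def by auto

lemma loc_one: "\<one>\<^bsub>L\<^esub> = loc_frac R S \<one> \<one>" by (simp add: localization_def)
lemma loc_zero: "\<zero>\<^bsub>L\<^esub> = loc_frac R S \<zero> \<one>" by (simp add: localization_def)

lemma loc_mult:
  assumes "a \<in> carrier R" "s \<in> S" "b \<in> carrier R" "t \<in> S"
  shows "loc_frac R S a s \<otimes>\<^bsub>L\<^esub> loc_frac R S b t = loc_frac R S (a \<otimes> b) (s \<otimes> t)"
proof -
  have "loc_frac R S (a' \<otimes> b') (s' \<otimes> t') = loc_frac R S (a \<otimes> b) (s \<otimes> t)"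
    if ab: "(a', s') \<in> loc_frac R S a s" "(b', t') \<in> loc_frac R S b t" for a' s' b' t'
  proof (rule loc_frac_eqI[symmetric])
    obtain u w where h: "a' \<in> carrier R" "b' \<in> carrier R" "s' \<in> S" "t' \<in> S" "u \<in> S" "w \<in> S"
      and e: "u \<otimes> (a \<otimes> s') = u \<otimes> (a' \<otimes> s)" "w \<otimes> (b \<otimes> t') = w \<otimes> (b' \<otimes> t)"
      using ab[THEN loc_frac_memD] by (auto simp: loc_rel_iff)
    note c = h(1,2) h(3-6)[THEN S_carr] assms(1,3) assms(2,4)[THEN S_carr]
    have "(u \<otimes> w) \<otimes> (a \<otimes> b \<otimes> (s' \<otimes> t')) = (u \<otimes> (a \<otimes> s')) \<otimes> (w \<otimes> (b \<otimes> t'))" using c by algebra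
    also have "\<dots> = (u \<otimes> w) \<otimes> (a' \<otimes> b' \<otimes> (s \<otimes> t))" unfolding e using c by algebra
    finally show "((a \<otimes> b, s \<otimes> t), (a' \<otimes> b', s' \<otimes> t')) \<in> loc_rel R S"
      using h assms mult_S by (auto simp: loc_rel_iff)
  qed
  then have "(\<Union>(a', s')\<in>loc_frac R S a s. \<Union>(b', t')\<in>loc_frac R S b t. loc_frac R S (a' \<otimes> b') (s' \<otimes> t')) =
      loc_frac R S (a \<otimes> b) (s \<otimes> t)"
    by (intro UN2_eq_const[OF loc_frac_self[OF assms(1,2)] loc_frac_self[OF assms(3,4)]])
  then show ?thesis by (simp add: localization_def)
qed

lemma loc_add:
  assumes "a \<in> carrier R" "s \<in> S" "b \<in> carrier R" "t \<in> S"
  shows "loc_frac R S a s \<oplus>\<^bsub>L\<^esub> loc_frac R S b t = loc_frac R S (a \<otimes> t \<oplus> b \<otimes> s) (s \<otimes> t)"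
proof -
  have "loc_frac R S (a' \<otimes> t' \<oplus> b' \<otimes> s') (s' \<otimes> t') = loc_frac R S (a \<otimes> t \<oplus> b \<otimes> s) (s \<otimes> t)"
    if ab: "(a', s') \<in> loc_frac R S a s" "(b', t') \<in> loc_frac R S b t" for a' s' b' t'
  proof (rule loc_frac_eqI[symmetric])
    obtain u w where h: "a' \<in> carrier R" "b' \<in> carrier R" "s' \<in> S" "t' \<in> S" "u \<in> S" "w \<in> S"
      and e: "u \<otimes> (a \<otimes> s') = u \<otimes> (a' \<otimes> s)" "w \<otimes> (b \<otimes> t') = w \<otimes> (b' \<otimes> t)"
      using ab[THEN loc_frac_memD] by (auto simp: loc_rel_iff)
    note c = h(1,2) h(3-6)[THEN S_carr] assms(1,3) assms(2,4)[THEN S_carr]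
    have "(u \<otimes> w) \<otimes> ((a \<otimes> t \<oplus> b \<otimes> s) \<otimes> (s' \<otimes> t')) =
        (w \<otimes> t \<otimes> t') \<otimes> (u \<otimes> (a \<otimes> s')) \<oplus> (u \<otimes> s \<otimes> s') \<otimes> (w \<otimes> (b \<otimes> t'))" using c by algebra
    also have "\<dots> = (u \<otimes> w) \<otimes> ((a' \<otimes> t' \<oplus> b' \<otimes> s') \<otimes> (s \<otimes> t))" unfolding e using c by algebra
    finally show "((a \<otimes> t \<oplus> b \<otimes> s, s \<otimes> t), (a' \<otimes> t' \<oplus> b' \<otimes> s', s' \<otimes> t')) \<in> loc_rel R S"
      using h assms mult_S S_carr by (auto simp: loc_rel_iff)
  qed
  then have "(\<Union>(a', s')\<in>loc_frac R S a s. \<Union>(b', t')\<in>loc_frac R S b t.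
      loc_frac R S (a' \<otimes> t' \<oplus> b' \<otimes> s') (s' \<otimes> t')) = loc_frac R S (a \<otimes> t \<oplus> b \<otimes> s) (s \<otimes> t)"
    by (intro UN2_eq_const[OF loc_frac_self[OF assms(1,2)] loc_frac_self[OF assms(3,4)]])
  then show ?thesis by (simp add: localization_def)
qed

lemma loc_cring: "cring L"
proof (rule cringI)
  note simps = loc_mult loc_add loc_one loc_zero mult_S one_S S_carr
  have el: "\<exists>a s. f = loc_frac R S a s \<and> a \<in> carrier R \<and> s \<in> S" if "f \<in> carrier L" for f
    using that carrier_L by blast
  have inL: "loc_frac R S a s \<in> carrier L" if "a \<in> carrier R" "s \<in> S" for a s
    using that carrier_L by blast
  have eqI: "loc_frac R S a s = loc_frac R S b t"
    if "a \<otimes> t = b \<otimes> s" "a \<in> carrier R" "b \<in> carrier R" "s \<in> S" "t \<in> S" for a s b t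
    using that one_S by (intro loc_frac_eqI) (auto simp: loc_rel_iff intro!: bexI[of _ \<one>])
  show "abelian_group L"
  proof (rule abelian_groupI)
    fix f g h assume "f \<in> carrier L" "g \<in> carrier L"
    then obtain a s b t where f: "f = loc_frac R S a s" "g = loc_frac R S b t"
      and c: "a \<in> carrier R" "s \<in> S" "b \<in> carrier R" "t \<in> S" using el by metis
    note cc = c(1,3) c(2,4)[THEN S_carr]
    show "f \<oplus>\<^bsub>L\<^esub> g \<in> carrier L" unfolding f using c cc by (simp add: simps inL)
    show "f \<oplus>\<^bsub>L\<^esub> g = g \<oplus>\<^bsub>L\<^esub> f" unfolding f using c cc by (simp add: simps a_comm m_comm)
    show "\<zero>\<^bsub>L\<^esub> \<oplus>\<^bsub>L\<^esub> f = f" unfolding f using c cc by (simp add: simps)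
    show "\<exists>y\<in>carrier L. y \<oplus>\<^bsub>L\<^esub> f = \<zero>\<^bsub>L\<^esub>"
    proof
      show "loc_frac R S (\<ominus> a) s \<in> carrier L" using c by (intro inL) auto
      have "loc_frac R S (\<ominus> a \<otimes> s \<oplus> a \<otimes> s) (s \<otimes> s) = loc_frac R S \<zero> \<one>"
        using c cc mult_S one_S by (intro eqI) (auto simp: l_minus l_neg)
      then show "loc_frac R S (\<ominus> a) s \<oplus>\<^bsub>L\<^esub> f = \<zero>\<^bsub>L\<^esub>" unfolding f using c by (simp add: simps)
    qed
    assume "h \<in> carrier L"
    then obtain e r where h: "h = loc_frac R S e r" "e \<in> carrier R" "r \<in> S" using el by metis
    note cc = cc h(2) S_carr[OF h(3)]
    have "(a \<otimes> t \<oplus> b \<otimes> s) \<otimes> r \<oplus> e \<otimes> (s \<otimes> t) = a \<otimes> (t \<otimes> r) \<oplus> (b \<otimes> r \<oplus> e \<otimes> t) \<otimes> s"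
      using cc by algebra
    then show "f \<oplus>\<^bsub>L\<^esub> g \<oplus>\<^bsub>L\<^esub> h = f \<oplus>\<^bsub>L\<^esub> (g \<oplus>\<^bsub>L\<^esub> h)"
      unfolding f h(1) using c h cc by (simp add: simps m_assoc)
  qed (simp add: loc_zero inL one_S)
  show "comm_monoid L"
  proof (rule comm_monoidI)
    fix f g h assume "f \<in> carrier L" "g \<in> carrier L"
    then obtain a s b t where f: "f = loc_frac R S a s" "g = loc_frac R S b t"
      and c: "a \<in> carrier R" "s \<in> S" "b \<in> carrier R" "t \<in> S" using el by metis
    note cc = c(1,3) c(2,4)[THEN S_carr]
    show "f \<otimes>\<^bsub>L\<^esub> g \<in> carrier L" unfolding f using c cc by (simp add: simps inL)
    show "f \<otimes>\<^bsub>L\<^esub> g = g \<otimes>\<^bsub>L\<^esub> f" unfolding f using c cc by (simp add: simps m_comm)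
    show "\<one>\<^bsub>L\<^esub> \<otimes>\<^bsub>L\<^esub> f = f" unfolding f using c cc by (simp add: simps)
    assume "h \<in> carrier L"
    then obtain e r where h: "h = loc_frac R S e r" "e \<in> carrier R" "r \<in> S" using el by metis
    show "f \<otimes>\<^bsub>L\<^esub> g \<otimes>\<^bsub>L\<^esub> h = f \<otimes>\<^bsub>L\<^esub> (g \<otimes>\<^bsub>L\<^esub> h)"
      unfolding f h(1) using c h cc by (simp add: simps m_assoc)
  qed (simp add: loc_one inL one_S)
  fix f g h assume "f \<in> carrier L" "g \<in> carrier L" "h \<in> carrier L"
  then obtain a s b t e r where f: "f = loc_frac R S a s" "g = loc_frac R S b t" "h = loc_frac R S e r"
    and c: "a \<in> carrier R" "s \<in> S" "b \<in> carrier R" "t \<in> S" "e \<in> carrier R" "r \<in> S" using el by metis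
  note cc = c(1,3,5) c(2,4,6)[THEN S_carr]
  \<comment> \<open>The two sides of the distributive law carry the denominators s t r and s r t r;
    this is their cross multiplication.\<close>
  have "(a \<otimes> t \<oplus> b \<otimes> s) \<otimes> e \<otimes> (s \<otimes> r \<otimes> (t \<otimes> r)) =
      (a \<otimes> e \<otimes> (t \<otimes> r) \<oplus> b \<otimes> e \<otimes> (s \<otimes> r)) \<otimes> (s \<otimes> t \<otimes> r)" using cc by algebra
  then have "loc_frac R S ((a \<otimes> t \<oplus> b \<otimes> s) \<otimes> e) (s \<otimes> t \<otimes> r) =
      loc_frac R S (a \<otimes> e \<otimes> (t \<otimes> r) \<oplus> b \<otimes> e \<otimes> (s \<otimes> r)) (s \<otimes> r \<otimes> (t \<otimes> r))"
    using c cc by (intro eqI) (auto simp: mult_S)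
  then show "(f \<oplus>\<^bsub>L\<^esub> g) \<otimes>\<^bsub>L\<^esub> h = f \<otimes>\<^bsub>L\<^esub> h \<oplus>\<^bsub>L\<^esub> g \<otimes>\<^bsub>L\<^esub> h"
    unfolding f using c cc by (simp add: simps)
qed

lemma loc_hom: "(\<lambda>a. loc_frac R S a \<one>) \<in> ring_hom R L"
  using one_S by (intro ring_hom_memI) (auto simp: loc_mult loc_add loc_one carrier_L)

end

lemma (in ring_hom_ring) hom_add_pow_nat:
  fixes k :: nat
  shows "a \<in> carrier R \<Longrightarrow> h ([k] \<cdot>\<^bsub>R\<^esub> a) = [k] \<cdot>\<^bsub>S\<^esub> h a"
  by (induction k) simp_all

text \<open>The canonical map from \<open>R\<close> through the localization to the residue field is
  a ring homomorphism that kills \<open>P\<close>; an integer in \<open>P\<close> would therefore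
  become 0 there.\<close>

lemma (in cring) nat_notin_if_residue_char_zero:
  assumes P: "primeideal P R" and char: "char_zero (residue_field R P)" and "0 < (k::nat)"
  shows "[k] \<cdot> \<one> \<notin> P"
proof
  assume k: "[k] \<cdot> \<one> \<in> P"
  interpret P: primeideal P R by fact
  interpret M: multiplicative_subset R "carrier R - P"
    using P.one_notin P.mult_notin by unfold_locales auto
  interpret L: cring M.L by (rule M.loc_cring)
  let ?h = "\<lambda>a. loc_frac R (carrier R - P) a \<one>"
  let ?I = "Idl\<^bsub>M.L\<^esub> (?h ` P)"
  have sub: "?h ` P \<subseteq> carrier M.L" using ring_hom_closed[OF M.loc_hom] P.Icarr by auto
  interpret I: ideal ?I M.L by (rule L.genideal_ideal[OF sub])
  have F: "residue_field R P = M.L Quot ?I" by (simp add: residue_field_def Let_def)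
  have hom: "(\<lambda>x. ?I +>\<^bsub>M.L\<^esub> x) \<circ> ?h \<in> ring_hom R (M.L Quot ?I)"
    by (rule ring_hom_trans[OF M.loc_hom I.rcos_ring_hom])
  interpret H: ring_hom_ring R "M.L Quot ?I" "(\<lambda>x. ?I +>\<^bsub>M.L\<^esub> x) \<circ> ?h"
    by (rule ring_hom_ringI2[OF ring_axioms I.quotient_is_ring hom])
  have "?h ([k] \<cdot> \<one>) \<in> ?I" using L.genideal_self[OF sub] k by blast
  then have "?I +>\<^bsub>M.L\<^esub> ?h ([k] \<cdot> \<one>) = ?I" by (rule L.a_rcos_zero[OF I.is_ideal])
  moreover have "?I +>\<^bsub>M.L\<^esub> ?h ([k] \<cdot> \<one>) = [k] \<cdot>\<^bsub>M.L Quot ?I\<^esub> \<one>\<^bsub>M.L Quot ?I\<^esub>"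
    using H.hom_add_pow_nat[OF one_closed, of k] H.hom_one by simp
  moreover have "\<zero>\<^bsub>M.L Quot ?I\<^esub> = ?I" by (simp add: FactRing_def)
  ultimately show False using char assms(3) unfolding char_zero_def F by simp
qed

section \<open>Gap measure, type and dimension\<close>

context poly_extension
begin

text \<open>Taking the constant term is substitution of 0 for \<open>x\<close>.\<close>

lemma coef_0_mult:
  assumes f: "f \<in> carrier R" and g: "g \<in> carrier R"
  shows "coef 0 (f \<otimes> g) = coef 0 f \<otimes> coef 0 g"
proof -
  obtain e where "deg_lt f e" using ex_deg_lt[OF f] by blast
  with f show ?thesis
  proof (induction e f rule: poly_induct)
    case (lead e f)
    let ?m = "coef e f \<otimes> x [^] e"
    have c: "coef e f \<in> S" using lead(1) by (rule coef_in)
    have m: "?m \<in> carrier R" using c by simp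
    have f': "f \<ominus> ?m \<in> carrier R" using lead(1) m by (rule minus_closed)
    have "coef 0 (?m \<otimes> g) = coef 0 ?m \<otimes> coef 0 g"
      unfolding coef_monom_mult[OF c g] coef_monom[OF c] using g by (cases e) auto
    then have "coef 0 ((f \<ominus> ?m) \<otimes> g \<oplus> ?m \<otimes> g) = (coef 0 (f \<ominus> ?m) \<oplus> coef 0 ?m) \<otimes> coef 0 g"
      using lead.IH f' m g by (simp only: coef_add l_distr coef_closed m_closed)
    moreover have "(f \<ominus> ?m) \<otimes> g \<oplus> ?m \<otimes> g = f \<otimes> g" using lead(1) m g by algebra
    moreover have "coef 0 (f \<ominus> ?m) \<oplus> coef 0 ?m = coef 0 f"
      using coef_add[OF f' m, of 0] minus_add_cancel[OF lead(1) m] by simp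
    ultimately show ?case by simp
  qed (use g in simp)
qed

text \<open>This is the prime generated by \<open>P\<close> and \<open>x\<close>, obtained as the
  preimage of \<open>P\<close> under x -> 0.\<close>

lemma coef_0_vimage_prime:
  assumes "primeideal P base"
  shows "primeideal {f \<in> carrier R. coef 0 f \<in> P} R"
proof -
  note P = base_primeD[OF assms] and I = base_idealD[OF base_primeD(1)[OF assms]]
  show ?thesis
  proof (rule cring_primeidealI)
    show "\<one> \<notin> {f \<in> carrier R. coef 0 f \<in> P}" using P(2) coef_const[of \<one> 0] by simp
    show "f \<in> {f \<in> carrier R. coef 0 f \<in> P} \<or> g \<in> {f \<in> carrier R. coef 0 f \<in> P}"
      if "f \<in> carrier R" "g \<in> carrier R" "f \<otimes> g \<in> {f \<in> carrier R. coef 0 f \<in> P}" for f g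
      using that P(3)[of "coef 0 f" "coef 0 g"] coef_in by (simp add: coef_0_mult)
  qed (use I coef_in in \<open>auto simp: coef_add coef_0_mult\<close>)
qed

end

text \<open>For an ideal \<open>Q\<close>, this is the ideal generated by \<open>Q\<close> and the
  variables of \<open>W\<close> in \<open>V\<close>: the kernel of setting these variables to 0 and
  reducing coefficients modulo \<open>Q\<close>.\<close>

definition (in ring) restricted_ideal :: "'v set \<Rightarrow> 'v set \<Rightarrow> 'a set \<Rightarrow> ('v multiset \<Rightarrow> 'a) set" where
  "restricted_ideal W V Q =
    {f \<in> indexed_pset W (carrier R). \<forall>M. set_mset M \<inter> V = {} \<longrightarrow> f M \<in> Q}"

context cring
begin

text \<open>A new variable outside \<open>V\<close> extends the prime coefficientwise; one in
  \<open>V\<close> leads to the preimage under setting it to 0. Both operations preserve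
  primality.\<close>

lemma restricted_ideal_finite_prime:
  assumes Q: "primeideal Q R" and "finite W"
  shows "primeideal (restricted_ideal W V Q) (indexed_poly_ring R W D)"
  using assms(2)
proof (induction W)
  case empty
  interpret Q: primeideal Q R by fact
  interpret P: cring "indexed_poly_ring R {} D" by (rule indexed_poly_cring)
  have eq: "restricted_ideal {} V Q = indexed_const ` Q"
  proof
    show "restricted_ideal {} V Q \<subseteq> indexed_const ` Q"
    proof
      fix f assume f: "f \<in> restricted_ideal {} V Q"
      then obtain a where "f = indexed_const a" "a \<in> carrier R"
        unfolding restricted_ideal_def indexed_pset_empty by blast
      moreover have "f {#} \<in> Q" using f unfolding restricted_ideal_def by simp
      ultimately show "f \<in> indexed_const ` Q" by (simp add: indexed_const_def)
    qed
    show "indexed_const ` Q \<subseteq> restricted_ideal {} V Q"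
      using additive_subgroup.zero_closed[OF Q.additive_subgroup_axioms] Q.Icarr
      unfolding restricted_ideal_def indexed_pset_empty by (auto simp: indexed_const_def)
  qed
  have inj: "indexed_const a = (indexed_const b :: 'c multiset \<Rightarrow> 'a) \<longleftrightarrow> a = b" for a b
    by (metis indexed_const_def)
  have mem: "indexed_const a \<in> restricted_ideal {} V Q \<longleftrightarrow> a \<in> Q" for a
    unfolding eq image_iff inj by simp
  show ?case
  proof (rule P.cring_primeidealI)
    show "restricted_ideal {} V Q \<subseteq> carrier (indexed_poly_ring R {} D)"
      by (auto simp: restricted_ideal_def)
    show "\<zero>\<^bsub>indexed_poly_ring R {} D\<^esub> \<in> restricted_ideal {} V Q"
      using additive_subgroup.zero_closed[OF Q.additive_subgroup_axioms] by (simp add: mem)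
    show "\<one>\<^bsub>indexed_poly_ring R {} D\<^esub> \<notin> restricted_ideal {} V Q"
      using Q.one_notin by (simp add: mem)
    show "f \<oplus>\<^bsub>indexed_poly_ring R {} D\<^esub> g \<in> restricted_ideal {} V Q"
      if "f \<in> restricted_ideal {} V Q" "g \<in> restricted_ideal {} V Q" for f g
      using that additive_subgroup.a_closed[OF Q.additive_subgroup_axioms]
      unfolding eq by (auto simp: indexed_padd_const)
    show "r \<otimes>\<^bsub>indexed_poly_ring R {} D\<^esub> f \<in> restricted_ideal {} V Q"
      if "f \<in> restricted_ideal {} V Q" "r \<in> carrier (indexed_poly_ring R {} D)" for f r
      using that Q.I_l_closed Q.Icarr unfolding eq by (auto simp: indexed_pset_empty indexed_const_hom)
    fix f g assume "f \<in> carrier (indexed_poly_ring R {} D)" "g \<in> carrier (indexed_poly_ring R {} D)"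
      and fg: "f \<otimes>\<^bsub>indexed_poly_ring R {} D\<^esub> g \<in> restricted_ideal {} V Q"
    then obtain a b where "f = indexed_const a" "g = indexed_const b" "a \<in> carrier R" "b \<in> carrier R"
      by (auto simp: indexed_pset_empty)
    then show "f \<in> restricted_ideal {} V Q \<or> g \<in> restricted_ideal {} V Q"
      using fg Q.I_prime[of a b] by (simp add: indexed_const_hom mem)
  qed
next
  case (insert v W)
  interpret E: poly_extension "indexed_poly_ring R (insert v W) D" "indexed_pset W (carrier R)"
    "indexed_var v" "var_coef v" by (rule indexed_poly_extension) fact
  have zQ: "\<zero> \<in> Q"
    using Q by (meson additive_subgroup.zero_closed ideal.axioms(1) primeideal.axioms(1))
  have IH: "primeideal (restricted_ideal W V Q) E.base" using insert.IH by simp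
  have split: "f M = var_coef v (count M v) f (filter_mset (\<lambda>w. w \<noteq> v) M)" for f :: "'c multiset \<Rightarrow> 'a" and M
  proof -
    have "M = filter_mset (\<lambda>w. w \<noteq> v) M + replicate_mset (count M v) v" by (rule multiset_eqI) auto
    then show ?thesis by (simp add: var_coef_def)
  qed
  show ?case
  proof (cases "v \<in> V")
    case True
    have "restricted_ideal (insert v W) V Q =
        {f \<in> carrier (indexed_poly_ring R (insert v W) D). var_coef v 0 f \<in> restricted_ideal W V Q}"
      using True zQ var_coef_closed[of _ v W 0] by (auto simp: restricted_ideal_def var_coef_def)
    then show ?thesis using E.coef_0_vimage_prime[OF IH] by simp
  next
    case False
    have "restricted_ideal (insert v W) V Q = E.ext (restricted_ideal W V Q)"
    proof (intro subset_antisym subsetI)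
      fix f assume f: "f \<in> restricted_ideal (insert v W) V Q"
      then show "f \<in> E.ext (restricted_ideal W V Q)"
        using False zQ var_coef_closed[of f v W]
        by (auto simp: restricted_ideal_def E.ext_def var_coef_def)
    next
      fix f assume f: "f \<in> E.ext (restricted_ideal W V Q)"
      have "f M \<in> Q" if "set_mset M \<inter> V = {}" for M
      proof -
        have "set_mset (filter_mset (\<lambda>w. w \<noteq> v) M) \<inter> V = {}" using that by auto
        then show ?thesis using f unfolding split[of f M] E.ext_def restricted_ideal_def by blast
      qed
      then show "f \<in> restricted_ideal (insert v W) V Q"
        using f by (auto simp: restricted_ideal_def E.ext_def)
    qed
    then show ?thesis using E.ext_prime[OF IH] by simp
  qed
qed

end

text \<open>Absorption of products and primality each concern two polynomials, which lie in a common
  truncation, where the finite case applies.\<close>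

lemma (in poly_tower) restricted_ideal_prime:
  assumes Q: "primeideal Q R"
  shows "primeideal (restricted_ideal (range x) V Q) S"
proof -
  interpret P: cring S by (rule indexed_poly_cring)
  let ?I = "restricted_ideal (range x) V Q"
  have sub: "?I \<inter> T m = restricted_ideal (x ` {..<m}) V Q" for m
    using T_subset[of m] by (auto simp: restricted_ideal_def)
  have pr: "primeideal (?I \<inter> T m) (A m)" for m
    unfolding sub by (rule restricted_ideal_finite_prime[OF Q]) simp
  have common: "\<exists>m. f \<in> T m \<and> g \<in> T m" if fg: "f \<in> carrier S" "g \<in> carrier S" for f g
  proof -
    obtain m1 m2 where "f \<in> T m1" "g \<in> T m2" using ex_T[OF fg(1)] ex_T[OF fg(2)] by blast
    then have "f \<in> T (max m1 m2) \<and> g \<in> T (max m1 m2)"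
      using T_mono[of m1 "max m1 m2"] T_mono[of m2 "max m1 m2"] by auto
    then show ?thesis ..
  qed
  have IS: "?I \<subseteq> carrier S" by (auto simp: restricted_ideal_def)
  have zQ: "\<zero> \<in> Q" and aQ: "\<And>a b. a \<in> Q \<Longrightarrow> b \<in> Q \<Longrightarrow> a \<oplus> b \<in> Q"
    using ideal.axioms(1)[OF primeideal.axioms(1)[OF Q]]
    by (auto intro: additive_subgroup.zero_closed additive_subgroup.a_closed)
  show ?thesis
  proof (rule P.cring_primeidealI[OF IS])
    show "\<zero>\<^bsub>S\<^esub> \<in> ?I"
      using zQ indexed_const_pset[OF zero_closed] by (auto simp: restricted_ideal_def indexed_const_def)
    show "f \<oplus>\<^bsub>S\<^esub> g \<in> ?I" if "f \<in> ?I" "g \<in> ?I" for f g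
      using that aQ by (auto simp: restricted_ideal_def indexed_padd_def intro: indexed_pset.indexed_padd[unfolded indexed_padd_def])
    show "r \<otimes>\<^bsub>S\<^esub> f \<in> ?I" if f: "f \<in> ?I" and r: "r \<in> carrier S" for f r
    proof -
      obtain m where m: "f \<in> T m" "r \<in> T m" using common f r IS by blast
      then show ?thesis
        using ideal.I_l_closed[OF primeideal.axioms(1)[OF pr], of f m r] f by simp
    qed
    show "\<one>\<^bsub>S\<^esub> \<notin> ?I"
    proof
      assume "\<one>\<^bsub>S\<^esub> \<in> ?I"
      then have "(indexed_const \<one> :: 'v multiset \<Rightarrow> 'a) {#} \<in> Q" unfolding restricted_ideal_def by simp
      then show False using primeideal.one_notin[OF Q] by (simp add: indexed_const_def)
    qed
    fix f g assume f: "f \<in> carrier S" and g: "g \<in> carrier S" and fg: "f \<otimes>\<^bsub>S\<^esub> g \<in> ?I"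
    obtain m where m: "f \<in> T m" "g \<in> T m" using common f g by blast
    then have "f \<otimes>\<^bsub>S\<^esub> g \<in> ?I \<inter> T m" using fg by (simp add: indexed_mult_closed)
    then show "f \<in> ?I \<or> g \<in> ?I" using primeideal.I_prime[OF pr, of f m g] m by simp
  qed
qed

lemma (in ideal) finsum_closed_ideal:
  assumes "finite B" "\<And>b. b \<in> B \<Longrightarrow> g b \<in> I"
  shows "finsum R g B \<in> I"
  using assms
proof (induction B)
  case (insert b B)
  then have "g \<in> B \<rightarrow> carrier R" "g b \<in> carrier R" using Icarr by auto
  then show ?case using insert by simp
qed simp

lemma (in ideal) add_pow_closed: "a \<in> I \<Longrightarrow> [(k::nat)] \<cdot> a \<in> I"
  by (induction k) auto

text \<open>If \<open>s v\<close> occurs in a monomial free of \<open>V\<close>, then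
  \<open>v\<close> is not in \<open>V\<close>, since \<open>V\<close> is closed under
  \<open>s\<close>. So only coefficients of \<open>f\<close> at monomials free of \<open>V\<close>
  contribute, and these lie in the differential ideal \<open>Q\<close>.\<close>

lemma (in differential_ring) restricted_ideal_deriv:
  fixes s :: "'v \<Rightarrow> 'v"
  assumes d: "d \<in> set (derivs R)" and s: "inj s" "s ` W \<subseteq> W" "\<And>v. v \<in> V \<Longrightarrow> s v \<in> V"
    and Q: "Q \<in> diff_spec R" and f: "f \<in> restricted_ideal W V Q"
  shows "indexed_deriv R d s f \<in> restricted_ideal W V Q"
proof -
  interpret Q: primeideal Q R using Q by (simp add: diff_spec_def)
  have fW: "f \<in> indexed_pset W (carrier R)" and fQ: "\<And>M. set_mset M \<inter> V = {} \<Longrightarrow> f M \<in> Q"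
    using f by (auto simp: restricted_ideal_def)
  have "indexed_deriv R d s f \<in> indexed_pset W (carrier R)"
    using indexed_deriv_in_pset[OF d s(1) fW] s(2) by (simp add: Un_absorb2)
  moreover have "indexed_deriv R d s f M \<in> Q" if M: "set_mset M \<inter> V = {}" for M
    unfolding indexed_deriv_def
  proof (intro Q.a_closed Q.finsum_closed_ideal)
    show "d (f M) \<in> Q" using fQ[OF M] Q d by (simp add: diff_spec_def diff_ideal_def)
    show "finite {v. s v \<in># M}"
      using finite_vimageI[OF finite_set_mset s(1), of M] by (simp add: vimage_def)
    fix v assume "v \<in> {v. s v \<in># M}"
    then have "set_mset (add_mset v (M - {#s v#})) \<inter> V = {}"
      using M s(3) by (auto dest: in_diffD)
    then show "(let N = add_mset v (M - {#s v#}) in [count N v] \<cdot> f N) \<in> Q"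
      using fQ Q.add_pow_closed unfolding Let_def by blast
  qed
  ultimately show ?thesis by (simp add: restricted_ideal_def)
qed

lemma (in ring) restricted_ideal_mono: "V \<subseteq> V' \<Longrightarrow> restricted_ideal W V Q \<subseteq> restricted_ideal W V' Q"
  by (auto simp: restricted_ideal_def)

text \<open>The variable \<open>v\<close> itself separates the two ideals.\<close>

lemma (in cring) restricted_ideal_strict_mono:
  assumes Q: "primeideal Q R" and "V \<subseteq> V'" and v: "v \<in> V'" "v \<notin> V" "v \<in> W"
  shows "restricted_ideal W V Q \<subset> restricted_ideal W V' Q"
proof -
  have zQ: "\<zero> \<in> Q"
    using Q by (meson additive_subgroup.zero_closed ideal.axioms(1) primeideal.axioms(1))
  have var: "indexed_var v M = (if M = {#v#} then \<one> else \<zero>)" for M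
    by (auto simp: indexed_var_def indexed_pmult_def indexed_const_def dest!: multi_member_split)
  have "indexed_var v \<in> indexed_pset W (carrier R)"
    using v(3) by (auto simp: indexed_var_def intro: indexed_pset.intros)
  then have "indexed_var v \<in> restricted_ideal W V' Q"
    using v(1) zQ by (auto simp: restricted_ideal_def var)
  moreover have "indexed_var v \<notin> restricted_ideal W V Q"
    using v(2) primeideal.one_notin[OF Q] by (auto simp: restricted_ideal_def var intro!: exI[of _ "{#v#}"])
  ultimately show ?thesis using restricted_ideal_mono[OF assms(2)] by blast
qed

text \<open>The top prime is minimal over its finitely many generators together with any prime below
  it, so the height theorem bounds every chain that starts there.\<close>

lemma (in noetherian_cring) no_descending_prime_chain:
  assumes "\<And>i. primeideal (c i) R"
  shows "\<not> (\<forall>i::nat. c (Suc i) \<subset> c i)"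
proof
  assume dec: "\<forall>i. c (Suc i) \<subset> c i"
  have ch: "prime_chain R h (c i) (c (i + h))" for h i
  proof (induction h arbitrary: i)
    case (Suc h)
    from prime_chain_step[OF assms _ Suc.IH[of "Suc i"]] dec show ?case by simp
  qed (simp add: prime_chain_refl assms)
  obtain F where F: "F \<subseteq> carrier R" "finite F" "c 0 = Idl F"
    using finetely_gen[OF primeideal.axioms(1)[OF assms]] by blast
  define h where "h = Suc (card F)"
  have "c h \<subseteq> c 0" using prime_chain_prime[OF ch[of h 0]] by simp
  moreover have "F \<subseteq> c 0" using genideal_self[OF F(1)] F(3) by simp
  moreover have "c 0 \<subseteq> Q" if "primeideal Q R" "F \<subseteq> Q" for Q
    using genideal_minimal[OF primeideal.axioms(1)[OF that(1)] that(2)] F(3) by simp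
  ultimately have "minimal_prime_over R (c h \<union> F) (c 0)"
    using assms[of 0] unfolding minimal_prime_over_def by auto
  from height_theorem[OF F(2,1) this ch[of h 0, simplified]] show False by (simp add: h_def)
qed

lemma gap_measure_eq_0_if_no_chain:
  assumes "p \<in> Y" "p' \<in> Y" "p' \<subseteq> p" "\<And>c. \<not> descending_chain Y p p' c"
  shows "gap_measure Y p p' = 0"
proof -
  have "\<not> enat (Suc 0) \<le> gap_measure Y p p'"
    using assms(4) by (simp add: enat_le_gap_measure_iff[OF assms(1-3)])
  then show ?thesis by (simp add: Suc_ile_eq flip: zero_enat_def)
qed

lemma (in differential_ring) diff_type_noetherian:
  assumes "noetherian_ring R"
  shows "diff_type R = 0"
proof -
  interpret noetherian_cring R using assms cring_axioms by (simp add: noetherian_cring_def)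
  have "gap_measure (diff_spec R) p p' = 0"
    if "p \<in> diff_spec R" "p' \<in> diff_spec R" "p' \<subseteq> p" for p p'
  proof (rule gap_measure_eq_0_if_no_chain[OF that])
    fix c
    show "\<not> descending_chain (diff_spec R) p p' c"
    proof
      assume c: "descending_chain (diff_spec R) p p' c"
      then have "primeideal (c i) R" for i by (auto simp: descending_chain_def diff_spec_def)
      from no_descending_prime_chain[of c, OF this] c show False by (simp add: descending_chain_def)
    qed
  qed
  then have "diff_type R \<le> 0" unfolding diff_type_def by (intro Sup_least) auto
  then show ?thesis by simp
qed

section \<open>Gaps in the differential spectrum of the polynomial ring\<close>

context ordinary_diff_poly
begin

lemma restricted_ideal_diff_spec:
  assumes "Q \<in> diff_spec R" "\<And>v. v \<in> V \<Longrightarrow> diff_var_shift 0 v \<in> V"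
  shows "restricted_ideal (range (dvar n)) V Q \<in> diff_spec S"
proof -
  have "primeideal Q R" using assms(1) by (simp add: diff_spec_def)
  moreover have "diff_var_shift 0 ` range (dvar n) \<subseteq> range (dvar n)" using n by (auto simp: shift_dvar)
  ultimately show ?thesis
    unfolding diff_spec_S_iff using assms
    by (intro conjI ballI restricted_ideal_prime restricted_ideal_deriv[OF d inj_diff_var_shift]) auto
qed

lemma card_jump_classes_gap:
  assumes "p \<in> diff_spec S" "p' \<in> diff_spec S" "p' \<subseteq> p" "gap_measure (diff_spec S) p p' \<ge> 1"
  shows "card (jump_classes p') < card (jump_classes p)"
proof -
  have "gap_ge (diff_spec S) (Suc 0) p p'"
    using assms(4) unfolding enat_le_gap_measure_iff[OF assms(1-3), symmetric] by (simp add: one_enat_def)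
  then show ?thesis using jump_classes_less assms(2) by auto
qed

text \<open>A gap of 2 would need an infinite chain whose steps all have gap at least 1, and each
  such step lowers the number of jump classes.\<close>

lemma gap_measure_le_1:
  assumes "p \<in> diff_spec S" "p' \<in> diff_spec S" "p' \<subseteq> p"
  shows "gap_measure (diff_spec S) p p' \<le> 1"
proof (rule ccontr)
  assume "\<not> gap_measure (diff_spec S) p p' \<le> 1"
  then have "enat (Suc (Suc 0)) \<le> gap_measure (diff_spec S) p p'"
    by (simp add: Suc_ile_eq one_enat_def)
  then have "gap_ge (diff_spec S) (Suc (Suc 0)) p p'" by (simp only: enat_le_gap_measure_iff[OF assms])
  then obtain c where c: "descending_chain (diff_spec S) p p' c"
    and g: "\<And>i. gap_ge (diff_spec S) (Suc 0) (c i) (c (Suc i))" by auto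
  have "card (jump_classes (c (Suc i))) < card (jump_classes (c i))" for i
  proof -
    obtain c' where "descending_chain (diff_spec S) (c i) (c (Suc i)) c'" using g[of i] by auto
    then show ?thesis using jump_classes_less descending_chain_domain[OF c] by blast
  qed
  then show False
    using wf_less_than wf_iff_no_infinite_down_chain[of less_than]
    by (auto dest!: spec[of _ "\<lambda>i. card (jump_classes (c i))"])
qed

text \<open>Along \<open>p\<close> the indeterminates are released one at a time, the last one
  first. Releasing the derivatives of a single indeterminate by increasing order gives the infinite
  chain between neighbours.\<close>

lemma ex_gap_chain:
  assumes Q: "Q \<in> diff_spec R"
  obtains p where "\<And>i. i \<le> n \<Longrightarrow> p i \<in> diff_spec S"
    "\<And>i. i < n \<Longrightarrow> p (Suc i) \<subset> p i \<and> gap_measure (diff_spec S) (p i) (p (Suc i)) = 1"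
proof -
  have prQ: "primeideal Q R" using Q by (simp add: diff_spec_def)
  let ?I = "\<lambda>V. restricted_ideal (range (dvar n)) V Q"
  \<comment> \<open>For \<open>j\<close> = 0 and \<open>i\<close> < \<open>n\<close> this selects
    all derivatives of the first \<open>n - i\<close> indeterminates; for larger \<open>j\<close>
    the last of these counts only from order \<open>j\<close> on. No variable has index 0, so
    \<open>p n\<close> is generated by \<open>Q\<close> alone.\<close>
  define V where "V i j = {(a, \<theta> :: nat multiset). a < n - i \<or> a = n - i \<and> j \<le> size \<theta>}" for i j
  define p where "p i = ?I (V i 0)" for i
  have VI: "?I (V i j) \<in> diff_spec S" for i j
    by (rule restricted_ideal_diff_spec[OF Q]) (auto simp: V_def diff_var_shift_def)
  have step: "?I (V i (Suc j)) \<subset> ?I (V i j)" if "i < n" for i j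
  proof (rule restricted_ideal_strict_mono[OF prQ])
    show "(n - i, replicate_mset j 0) \<in> range (dvar n)"
      unfolding range_dvar[OF n] using that by (auto simp: diff_vars_def)
  qed (auto simp: V_def)
  have below: "p (Suc i) \<subseteq> ?I (V i j)" if "i < n" for i j
    unfolding p_def by (rule restricted_ideal_mono) (use that in \<open>auto simp: V_def\<close>)
  have "p (Suc i) \<subset> p i \<and> gap_measure (diff_spec S) (p i) (p (Suc i)) = 1" if i: "i < n" for i
  proof -
    have less: "p (Suc i) \<subset> p i" using below[OF i, of "Suc 0"] step[OF i, of 0] unfolding p_def by blast
    have sp: "p i \<in> diff_spec S" "p (Suc i) \<in> diff_spec S" unfolding p_def by (rule VI)+
    have "descending_chain (diff_spec S) (p i) (p (Suc i)) (\<lambda>j. ?I (V i j))"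
      unfolding descending_chain_def using VI below[OF i] step[OF i] by (simp add: p_def)
    then have "gap_ge (diff_spec S) (Suc 0) (p i) (p (Suc i))" using less by auto
    then have "1 \<le> gap_measure (diff_spec S) (p i) (p (Suc i))"
      using enat_le_gap_measure_iff[OF sp, of "Suc 0"] less by (simp add: one_enat_def less_imp_le)
    then show ?thesis using gap_measure_le_1[OF sp] less by (auto intro: antisym)
  qed
  then show ?thesis using that[of p] VI unfolding p_def by blast
qed

lemma diff_type_S:
  assumes "diff_spec R \<noteq> {}"
  shows "diff_type S = 1"
proof (rule antisym)
  show "diff_type S \<le> 1" unfolding diff_type_def using gap_measure_le_1 by (intro Sup_least) auto
  obtain Q where "Q \<in> diff_spec R" using assms by blast
  then obtain p where p: "\<And>i. i \<le> n \<Longrightarrow> p i \<in> diff_spec S"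
    "\<And>i. i < n \<Longrightarrow> p (Suc i) \<subset> p i \<and> gap_measure (diff_spec S) (p i) (p (Suc i)) = 1"
    by (rule ex_gap_chain) blast
  have "p 0 \<in> diff_spec S" "p (Suc 0) \<in> diff_spec S" using p(1) n by auto
  then have "gap_measure (diff_spec S) (p 0) (p (Suc 0)) \<le> diff_type S"
    unfolding diff_type_def using p(2)[OF n] by (intro Sup_upper) blast
  then show "1 \<le> diff_type S" using p(2)[OF n] by simp
qed

text \<open>Each step of gap 1 lowers the number of jump classes, which is at most \<open>n\<close>
  at the start; the chain from \<open>ex_gap_chain\<close> attains this bound.\<close>

lemma diff_dim_S:
  assumes "diff_spec R \<noteq> {}"
  shows "diff_dim S = enat n"
proof (rule antisym)
  note type = diff_type_S[OF assms]
  show "diff_dim S \<le> enat n"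
    unfolding diff_dim_def type
  proof (intro Sup_least, clarify)
    fix k :: nat and p
    assume spec: "\<forall>i\<le>k. p i \<in> diff_spec S"
      and gap: "\<forall>i\<in>{1..k}. p i \<subset> p (i - 1) \<and> gap_measure (diff_spec S) (p (i - 1)) (p i) = 1"
    have "card (jump_classes (p i)) + i \<le> card (jump_classes (p 0))" if "i \<le> k" for i
      using that
    proof (induction i)
      case (Suc i)
      have "p (Suc i) \<subset> p i \<and> gap_measure (diff_spec S) (p i) (p (Suc i)) = 1"
        using bspec[OF gap, of "Suc i"] Suc.prems by simp
      then have "card (jump_classes (p (Suc i))) < card (jump_classes (p i))"
        using Suc.prems spec by (intro card_jump_classes_gap) auto
      then show ?case using Suc by simp
    qed simp
    from this[of k] card_jump_classes_le[of "p 0"] show "enat k \<le> enat n" by simp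
  qed
  obtain Q where "Q \<in> diff_spec R" using assms by blast
  then obtain p where p: "\<And>i. i \<le> n \<Longrightarrow> p i \<in> diff_spec S"
    "\<And>i. i < n \<Longrightarrow> p (Suc i) \<subset> p i \<and> gap_measure (diff_spec S) (p i) (p (Suc i)) = 1"
    by (rule ex_gap_chain) blast
  have "p i \<subset> p (i - 1) \<and> gap_measure (diff_spec S) (p (i - 1)) (p i) = 1" if "i \<in> {1..n}" for i
    using p(2)[of "i - 1"] that by (cases i) auto
  then show "enat n \<le> diff_dim S"
    unfolding diff_dim_def type using p(1) by (intro Sup_upper) blast
qed

end

theorem corollary32:
  fixes R :: "('a, 'b) diff_ring_scheme"
  assumes "differential_ring R"
    and "length (derivs R) = 1"
    and "diff_spec R \<noteq> {}"
    and "noetherian_ring R"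
    and "standard R"
  shows "J_ring R"
proof -
  interpret differential_ring R by fact
  obtain d where d: "derivs R = [d]" using assms(2) by (auto simp: length_Suc_conv)
  \<comment> \<open>Type 0 is below the number 1 of derivations, so of the three clauses only the
    first, with dimension n, has its premise satisfied.\<close>
  have type: "diff_type R = 0" by (rule diff_type_noetherian) fact
  have "diff_type (diff_poly_ring R n) = 1 \<and> diff_dim (diff_poly_ring R n) = enat n" if "n > 0" for n
  proof -
    interpret ordinary_diff_poly R d n
    proof (intro ordinary_diff_poly.intro ordinary_diff_poly_axioms.intro)
      show "[k] \<cdot>\<^bsub>R\<^esub> \<one>\<^bsub>R\<^esub> \<notin> Q" if "Q \<in> diff_spec R" "0 < k" for Q and k :: nat
        using that assms(5) by (intro nat_notin_if_residue_char_zero) (auto simp: standard_def diff_spec_def)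
    qed fact+
    show ?thesis using diff_type_S diff_dim_S assms(3) by (simp add: diff_poly_ring)
  qed
  moreover have "enat (length (derivs R)) = 1" using assms(2) by (simp add: one_enat_def)
  ultimately show ?thesis
    using assms(1) unfolding J_ring_def Let_def type by simp
qed

end
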